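(* Let $\mathbb{X}$ be a $0$-dimensional subscheme of $\mathbb{P}^n$ with $K$-rational support and homogeneous coordinate ring $R$ (setting and notation as in the context), and let $d\in\mathbb{N}$. Suppose that $\mathrm{char}(K)=0$ or $\mathrm{char}(K)>r_{\mathbb{X}}$. Then the scheme $\mathbb{X}$ has $\mathrm{CBP}(d)$ if and only if $\mathrm{HF}_{\Omega^1_{R/K}}(d)=\mathrm{HF}_{\Omega^1_{R_{\mathbb{Y}}/K}}(d)$ for every subscheme $\mathbb{Y}\subseteq\mathbb{X}$ of degree $\deg(\mathbb{Y})=\deg(\mathbb{X})-1$.
   Context: Let $K$ be a perfect field, $P=K[X_0,\dots,X_n]$ with the standard grading, and $\mathbb{X}\subseteq\mathbb{P}^n$ a $0$-dimensional subscheme over $K$ all of whose support points are $K$-rational, with saturated homogeneous vanishing ideal $I_{\mathbb{X}}$. Put $R=P/I_{\mathbb{X}}$ and let $x_i$ be the image of $X_i$ in $R$. Assume no point of the support of $\mathbb{X}$ lies on the hyperplane $X_0=0$; then $x_0$ is a non-zerodivisor of $R$. Let $\mathrm{HF}_{\mathbb{X}}(i)=\dim_K R_i$, $\deg(\mathbb{X})$ its constant value for $i\gg0$, and $r_{\mathbb{X}}$ the least integer with $\mathrm{HF}_{\mathbb{X}}(i)=\deg(\mathbb{X})$ for all $i\ge r_{\mathbb{X}}$. The scheme $\mathbb{X}$ has the Cayley-Bacharach property of degree $d$, in short $\mathrm{CBP}(d)$, if every hypersurface of degree $d$ which contains a subscheme $\mathbb{Y}$ of $\mathbb{X}$ of degree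 $\deg(\mathbb{Y})=\deg(\mathbb{X})-1$ automatically contains $\mathbb{X}$. For a subscheme $\mathbb{Y}$ of $\mathbb{X}$ with saturated homogeneous vanishing ideal $I_{\mathbb{Y}}\subseteq P$, $R_{\mathbb{Y}}=P/I_{\mathbb{Y}}$ is its homogeneous coordinate ring. For $A=R$ or $A=R_{\mathbb{Y}}$, $\Omega^1_{A/K}$ is the module of Kähler differentials of $A/K$, graded so that the differentials of the residue classes of the $X_i$ have degree $1$, and $\mathrm{HF}_M(i)=\dim_K M_i$ for a finitely generated graded module $M$. *)

theory Defs
  imports
    "HOL-Algebra.QuotRing"
    "HOL-Algebra.Algebraic_Closure_Type"
    "Jordan_Normal_Form.Missing_VectorSpace"
    "HOL-Library.Poly_Mapping"
begin

text \<open>A field is perfect if it has characteristic 0 or its Frobenius map is onto.\<close>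

definition perfect_field :: "'k::field itself \<Rightarrow> bool"
  where "perfect_field _ \<longleftrightarrow> CHAR('k) = 0 \<or> (\<forall>x::'k. \<exists>y. y ^ CHAR('k) = x)"

subsection \<open>The standard graded polynomial ring\<close>

text \<open>Polynomials in the countably many indeterminates \<open>X\<^sub>0, X\<^sub>1, \<dots>\<close>;
  \<open>mpoly_ring n\<close> is the subring \<open>K[X\<^sub>0, \<dots>, X\<^sub>n]\<close>.\<close>

type_synonym 'k mpoly = "(nat \<Rightarrow>\<^sub>0 nat) \<Rightarrow>\<^sub>0 'k"

definition indet :: "nat \<Rightarrow> 'k::field mpoly"
  where "indet i = Poly_Mapping.single (Poly_Mapping.single i 1) 1"

definition const :: "'k \<Rightarrow> 'k::field mpoly"
  where "const c = Poly_Mapping.single 0 c"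

definition mpoly_ring :: "nat \<Rightarrow> 'k::field mpoly ring"
  where "mpoly_ring n =
    \<lparr>carrier = {p. \<forall>t\<in>Poly_Mapping.keys p. Poly_Mapping.keys t \<subseteq> {..n}},
     monoid.mult = (*), one = 1, ring.zero = 0, add = (+)\<rparr>"

definition mon_deg :: "(nat \<Rightarrow>\<^sub>0 nat) \<Rightarrow> nat"
  where "mon_deg t = (\<Sum>i\<in>Poly_Mapping.keys t. Poly_Mapping.lookup t i)"

definition forms :: "nat \<Rightarrow> nat \<Rightarrow> 'k::field mpoly set"
  where "forms n d = {f \<in> carrier (mpoly_ring n). \<forall>t\<in>Poly_Mapping.keys f. mon_deg t = d}"

definition hom_comp :: "nat \<Rightarrow> 'k::field mpoly \<Rightarrow> 'k mpoly"
  where "hom_comp d f =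
    (\<Sum>t\<in>{t\<in>Poly_Mapping.keys f. mon_deg t = d}. Poly_Mapping.single t (Poly_Mapping.lookup f t))"

definition homogeneous_ideal :: "nat \<Rightarrow> 'k::field mpoly set \<Rightarrow> bool"
  where "homogeneous_ideal n I \<longleftrightarrow>
    ideal I (mpoly_ring n) \<and> (\<forall>f\<in>I. \<forall>d. hom_comp d f \<in> I)"

definition saturated :: "nat \<Rightarrow> 'k::field mpoly set \<Rightarrow> bool"
  where "saturated n I \<longleftrightarrow>
    (\<forall>f\<in>carrier (mpoly_ring n). (\<exists>k. \<forall>g\<in>forms n k. g * f \<in> I) \<longrightarrow> f \<in> I)"

subsection \<open>Subschemes of projective space\<close>

text \<open>A closed subscheme of \<open>P\<^sup>n\<close> over \<open>K\<close> is represented by its saturated homogeneous vanishing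
  ideal in \<open>K[X\<^sub>0, \<dots>, X\<^sub>n]\<close>; this is a bijection which reverses inclusions. The empty subscheme
  corresponds to the unit ideal.\<close>

definition closed_subscheme :: "nat \<Rightarrow> 'k::field mpoly set \<Rightarrow> bool"
  where "closed_subscheme n I \<longleftrightarrow> homogeneous_ideal n I \<and> saturated n I"

definition subscheme_of :: "nat \<Rightarrow> 'k::field mpoly set \<Rightarrow> 'k mpoly set \<Rightarrow> bool"
  where "subscheme_of n J I \<longleftrightarrow> closed_subscheme n J \<and> I \<subseteq> J"

text \<open>The support consists of the points of \<open>Proj K[X\<^sub>0, \<dots>, X\<^sub>n]\<close> on the subscheme, that is, of the
  homogeneous prime ideals that contain \<open>I\<close> but not all of \<open>X\<^sub>0, \<dots>, X\<^sub>n\<close>.\<close>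

definition support :: "nat \<Rightarrow> 'k::field mpoly set \<Rightarrow> 'k mpoly set set"
  where "support n I =
    {P. primeideal P (mpoly_ring n) \<and> homogeneous_ideal n P \<and> (\<exists>i\<le>n. indet i \<notin> P) \<and> I \<subseteq> P}"

text \<open>Dimension 0: the underlying space is nonempty and its points admit no proper
  specializations.\<close>

definition zero_dim_subscheme :: "nat \<Rightarrow> 'k::field mpoly set \<Rightarrow> bool"
  where "zero_dim_subscheme n I \<longleftrightarrow>
    closed_subscheme n I \<and> support n I \<noteq> {} \<and>
    (\<forall>P\<in>support n I. \<forall>Q\<in>support n I. P \<subseteq> Q \<longrightarrow> P = Q)"

text \<open>The prime ideal of the \<open>K\<close>-rational point \<open>(a\<^sub>0 : \<dots> : a\<^sub>n)\<close>.\<close>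

definition point_ideal :: "nat \<Rightarrow> (nat \<Rightarrow> 'k::field) \<Rightarrow> 'k mpoly set"
  where "point_ideal n a =
    Idl\<^bsub>mpoly_ring n\<^esub> {const (a i) * indet j - const (a j) * indet i | i j. i \<le> n \<and> j \<le> n}"

definition rational_support :: "nat \<Rightarrow> 'k::field mpoly set \<Rightarrow> bool"
  where "rational_support n I \<longleftrightarrow>
    (\<forall>P\<in>support n I. \<exists>a. (\<exists>i\<le>n. a i \<noteq> 0) \<and> P = point_ideal n a)"

subsection \<open>Graded vector spaces and Hilbert functions\<close>

definition regular_module :: "'a ring \<Rightarrow> ('a, 'a) module"
  where "regular_module A = \<lparr>carrier = carrier A, monoid.mult = monoid.mult A, one = one A,
    ring.zero = ring.zero A, add = add A, module.smult = monoid.mult A\<rparr>"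

definition restrict_scalars :: "('k \<Rightarrow> 'a) \<Rightarrow> ('a, 'm) module \<Rightarrow> ('k, 'm) module"
  where "restrict_scalars \<kappa> M = \<lparr>carrier = carrier M, monoid.mult = monoid.mult M, one = one M,
    ring.zero = ring.zero M, add = add M, module.smult = (\<lambda>c. module.smult M (\<kappa> c))\<rparr>"

text \<open>The dimension of a subspace \<open>W\<close> of a module over a \<open>K\<close>-algebra with structure map \<open>\<kappa>\<close>.\<close>

definition subspace_dim :: "('k::field \<Rightarrow> 'a) \<Rightarrow> ('a, 'm) module \<Rightarrow> 'm set \<Rightarrow> nat"
  where "subspace_dim \<kappa> M W =
    vectorspace.dim (ring_of_type_algebra :: 'k ring) ((restrict_scalars \<kappa> M)\<lparr>carrier := W\<rparr>)"

definition coord_ring :: "nat \<Rightarrow> 'k::field mpoly set \<Rightarrow> 'k mpoly set ring"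
  where "coord_ring n I = mpoly_ring n Quot I"

definition coord_const :: "nat \<Rightarrow> 'k::field mpoly set \<Rightarrow> 'k \<Rightarrow> 'k mpoly set"
  where "coord_const n I c = I +>\<^bsub>mpoly_ring n\<^esub> const c"

definition coord_comp :: "nat \<Rightarrow> 'k::field mpoly set \<Rightarrow> nat \<Rightarrow> 'k mpoly set set"
  where "coord_comp n I i = (\<lambda>f. I +>\<^bsub>mpoly_ring n\<^esub> f) ` forms n i"

definition HF :: "nat \<Rightarrow> 'k::field mpoly set \<Rightarrow> nat \<Rightarrow> nat"
  where "HF n I i =
    subspace_dim (coord_const n I) (regular_module (coord_ring n I)) (coord_comp n I i)"

definition scheme_degree :: "nat \<Rightarrow> 'k::field mpoly set \<Rightarrow> nat"
  where "scheme_degree n I = (THE c. eventually (\<lambda>i. HF n I i = c) sequentially)"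

text \<open>The least \<^emph>\<open>integer\<close> with this property is not negative if the scheme is nonempty, because
  the Hilbert function vanishes in negative degrees.\<close>

definition regularity_index :: "nat \<Rightarrow> 'k::field mpoly set \<Rightarrow> nat"
  where "regularity_index n I = (LEAST r. \<forall>i\<ge>r. HF n I i = scheme_degree n I)"

subsection \<open>Kaehler differentials\<close>

text \<open>\<open>\<Omega>\<^sup>1\<close> of a \<open>K\<close>-algebra \<open>A\<close> with structure map \<open>\<kappa>\<close> is the free \<open>A\<close>-module on symbols \<open>da\<close>
  (\<open>a \<in> A\<close>) modulo additivity of \<open>d\<close>, the Leibniz rule and \<open>dc = 0\<close> for \<open>c \<in> K\<close>.\<close>

definition free_module :: "'a ring \<Rightarrow> 'b set \<Rightarrow> ('a, 'b \<Rightarrow> 'a) module"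
  where "free_module A S = (ring.func_space A S)
    \<lparr>carrier := {f \<in> S \<rightarrow>\<^sub>E carrier A. finite {s\<in>S. f s \<noteq> \<zero>\<^bsub>A\<^esub>}}\<rparr>"

definition free_gen :: "'a ring \<Rightarrow> 'b set \<Rightarrow> 'b \<Rightarrow> 'b \<Rightarrow> 'a"
  where "free_gen A S s = (\<lambda>t\<in>S. if t = s then \<one>\<^bsub>A\<^esub> else \<zero>\<^bsub>A\<^esub>)"

definition quot_module :: "('a, 'm) module \<Rightarrow> 'm set \<Rightarrow> ('a, 'm set) module"
  where "quot_module M N = \<lparr>carrier = a_rcosets\<^bsub>M\<^esub> N, monoid.mult = undefined, one = undefined,
    ring.zero = N, add = set_add M, module.smult = (\<lambda>a C. \<Union>x\<in>C. N +>\<^bsub>M\<^esub> (a \<odot>\<^bsub>M\<^esub> x))\<rparr>"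

definition kaehler_relations :: "'a ring \<Rightarrow> ('k \<Rightarrow> 'a) \<Rightarrow> ('a \<Rightarrow> 'a) set"
  where "kaehler_relations A \<kappa> =
    (let F = free_module A (carrier A); D = free_gen A (carrier A) in
      {D (a \<oplus>\<^bsub>A\<^esub> b) \<ominus>\<^bsub>F\<^esub> (D a \<oplus>\<^bsub>F\<^esub> D b) | a b. a \<in> carrier A \<and> b \<in> carrier A} \<union>
      {D (a \<otimes>\<^bsub>A\<^esub> b) \<ominus>\<^bsub>F\<^esub> (a \<odot>\<^bsub>F\<^esub> D b \<oplus>\<^bsub>F\<^esub> b \<odot>\<^bsub>F\<^esub> D a) | a b. a \<in> carrier A \<and> b \<in> carrier A} \<union>
      range (\<lambda>c. D (\<kappa> c)))"

definition kaehler_submodule :: "'a ring \<Rightarrow> ('k \<Rightarrow> 'a) \<Rightarrow> ('a \<Rightarrow> 'a) set"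
  where "kaehler_submodule A \<kappa> =
    module.span A (free_module A (carrier A)) (kaehler_relations A \<kappa>)"

definition kaehler :: "'a ring \<Rightarrow> ('k \<Rightarrow> 'a) \<Rightarrow> ('a, ('a \<Rightarrow> 'a) set) module"
  where "kaehler A \<kappa> = quot_module (free_module A (carrier A)) (kaehler_submodule A \<kappa>)"

definition kaehler_d :: "'a ring \<Rightarrow> ('k \<Rightarrow> 'a) \<Rightarrow> 'a \<Rightarrow> ('a \<Rightarrow> 'a) set"
  where "kaehler_d A \<kappa> a =
    kaehler_submodule A \<kappa> +>\<^bsub>free_module A (carrier A)\<^esub> free_gen A (carrier A) a"

text \<open>The grading induced by a grading \<open>G\<close> of \<open>A\<close>: if \<open>a\<close> and \<open>b\<close> are homogeneous then \<open>a db\<close> is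
  homogeneous of degree \<open>deg a + deg b\<close>. So \<open>d\<close> preserves degrees, and the differentials of the
  classes of the indeterminates have degree 1.\<close>

definition kaehler_comp ::
    "'a ring \<Rightarrow> ('k::field \<Rightarrow> 'a) \<Rightarrow> (nat \<Rightarrow> 'a set) \<Rightarrow> nat \<Rightarrow> ('a \<Rightarrow> 'a) set set"
  where "kaehler_comp A \<kappa> G i =
    module.span (ring_of_type_algebra :: 'k ring) (restrict_scalars \<kappa> (kaehler A \<kappa>))
      {a \<odot>\<^bsub>kaehler A \<kappa>\<^esub> kaehler_d A \<kappa> b | a b j k. a \<in> G j \<and> b \<in> G k \<and> j + k = i}"

definition HF_kaehler :: "nat \<Rightarrow> 'k::field mpoly set \<Rightarrow> nat \<Rightarrow> nat"
  where "HF_kaehler n I i =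
    subspace_dim (coord_const n I) (kaehler (coord_ring n I) (coord_const n I))
      (kaehler_comp (coord_ring n I) (coord_const n I) (coord_comp n I) i)"

subsection \<open>The Cayley-Bacharach property\<close>

text \<open>A hypersurface of degree \<open>d\<close> is given by a nonzero, nonconstant form \<open>f\<close> of degree \<open>d\<close>, and it
  contains a subscheme iff \<open>f\<close> lies in the vanishing ideal. The subscheme of colength 1 may be
  empty, namely if the given scheme has degree 1. Only in this case does it matter that there are no
  hypersurfaces of degree 0.\<close>

definition is_hypersurface :: "nat \<Rightarrow> nat \<Rightarrow> 'k::field mpoly \<Rightarrow> bool"
  where "is_hypersurface n d f \<longleftrightarrow> f \<in> forms n d \<and> f \<noteq> 0 \<and> d > 0"

definition CBP :: "nat \<Rightarrow> 'k::field mpoly set \<Rightarrow> nat \<Rightarrow> bool"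
  where "CBP n I d \<longleftrightarrow>
    (\<forall>J f. subscheme_of n J I \<and> scheme_degree n J + 1 = scheme_degree n I \<and>
       is_hypersurface n d f \<and> f \<in> J \<longrightarrow> f \<in> I)"

end

theory Submission
  imports Defs "HOL-Library.Function_Algebras" "Jordan_Normal_Form.DL_Rank"
begin

text \<open>Since no point of the support lies on \<open>X\<^sub>0 = 0\<close>, a power of the irrelevant ideal lies in
  \<open>I + (X\<^sub>0)\<close>. Hence multiplication by \<open>x\<^sub>0\<close> is surjective, and for dimension reasons bijective, in
  high degrees; by saturation it is injective on all of \<open>R\<close>.

  Sending \<open>(g\<^sub>0, \<dots>, g\<^sub>n)\<close> to \<open>\<Sum> g\<^sub>j dx\<^sub>j\<close> identifies the degree-\<open>d\<close> part of \<open>\<Omega>\<^sup>1\<close> with the vectors of forms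
  of degree \<open>d - 1\<close> modulo the submodule \<open>N\<^sub>I\<close> generated by \<open>I e\<^sub>j\<close> and by the gradients of
  elements of \<open>I\<close>. For a subscheme with ideal \<open>J \<supseteq> I\<close> the two Hilbert functions of \<open>\<Omega>\<^sup>1\<close> therefore
  agree at \<open>d\<close> iff \<open>N\<^sub>I\<close> and \<open>N\<^sub>J\<close> agree in degree \<open>d\<close>. If \<open>I\<close> and \<open>J\<close> agree in degree \<open>d\<close>, they do so in all
  smaller degrees because \<open>x\<^sub>0\<close> is a nonzerodivisor, and \<open>N\<^sub>I\<close> and \<open>N\<^sub>J\<close> agree in degree \<open>d\<close>. Conversely,
  contraction with the Euler vector field maps \<open>N\<^sub>I\<close> into \<open>I\<close>. If some form \<open>g \<in> J - I\<close> has degree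
  \<open>a < d\<close>, then \<open>X\<^sub>0\<^bsup>d-1-a\<^esup> g e\<^sub>0\<close> lies in \<open>N\<^sub>J\<close> but its contraction \<open>X\<^sub>0\<^bsup>d-a\<^esup> g\<close> is not in \<open>I\<close>. Otherwise \<open>d\<close> is at
  most the regularity index, hence invertible in \<open>K\<close>, and a form \<open>f \<in> J - I\<close> of degree \<open>d\<close> has its
  gradient in \<open>N\<^sub>J\<close>, with contraction \<open>d f\<close> not in \<open>I\<close>.\<close>

subsection \<open>Linear maps out of a common source\<close>

abbreviation scalars :: "'k::field ring"
  where "scalars \<equiv> ring_of_type_algebra"

lemma scalars_simps [simp]:
  "carrier (scalars :: 'k::field ring) = UNIV"
  "x \<oplus>\<^bsub>scalars\<^esub> y = (x + y :: 'k)"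
  "x \<otimes>\<^bsub>scalars\<^esub> y = (x * y :: 'k)"
  "\<one>\<^bsub>scalars\<^esub> = (1 :: 'k)"
  "\<zero>\<^bsub>scalars\<^esub> = (0 :: 'k)"
  by (simp_all add: ring_of_type_algebra_def)

text \<open>Quotient spaces such as R_d and the graded pieces of the differentials are handled
  through a space \<open>U\<close> of polynomial representatives. \<open>T\<close> sends a
  representative to its class, so that \<open>V\<close> inherits the vector space axioms and a
  finite spanning set from \<open>U\<close>.\<close>

locale linear_cover =
  fixes sc :: "'k::field \<Rightarrow> 'u::ab_group_add \<Rightarrow> 'u"
    and U :: "'u set" and V :: "('k, 'v) module" and T :: "'u \<Rightarrow> 'v"
  assumes sc: "vector_space sc"
    and U_zero: "0 \<in> U"
    and U_add: "u \<in> U \<Longrightarrow> v \<in> U \<Longrightarrow> u + v \<in> U"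
    and U_sc: "u \<in> U \<Longrightarrow> sc c u \<in> U"
    and T_zero: "T 0 = \<zero>\<^bsub>V\<^esub>"
    and T_add: "u \<in> U \<Longrightarrow> v \<in> U \<Longrightarrow> T (u + v) = T u \<oplus>\<^bsub>V\<^esub> T v"
    and T_sc: "u \<in> U \<Longrightarrow> T (sc c u) = c \<odot>\<^bsub>V\<^esub> T u"
    and T_onto: "carrier V = T ` U"
    and U_fin: "\<exists>B. finite B \<and> B \<subseteq> U \<and> (\<forall>u\<in>U. \<exists>c. u = (\<Sum>b\<in>B. sc (c b) b))"
begin

interpretation S: vector_space sc by (rule sc)

lemma vectorspace: "vectorspace scalars V"
proof (rule vs_criteria)
  show "Ring.field (scalars :: 'k ring)" by (rule field_from_type_algebra)
  show "\<zero>\<^bsub>V\<^esub> \<in> carrier V"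
    using U_zero T_zero T_onto by (metis imageI)
  show "\<forall>v w. v \<in> carrier V \<and> w \<in> carrier V \<longrightarrow> v \<oplus>\<^bsub>V\<^esub> w \<in> carrier V"
    by (auto simp: T_onto T_add [symmetric] U_add)
  show "\<forall>v\<in>carrier V. \<exists>w\<in>carrier V. v \<oplus>\<^bsub>V\<^esub> w = \<zero>\<^bsub>V\<^esub>"
  proof
    fix v assume "v \<in> carrier V"
    then obtain u where u: "u \<in> U" "v = T u" by (auto simp: T_onto)
    \<comment> \<open>Closure of \<open>U\<close> is assumed for sums and multiples only, so the
      negative is formed as the multiple by -1.\<close>
    have "T u \<oplus>\<^bsub>V\<^esub> T (sc (-1) u) = T (u + sc (-1) u)"
      using u U_sc T_add by (simp del: S.scale_minus_left)
    also have "u + sc (-1) u = 0" by simp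
    finally show "\<exists>w\<in>carrier V. v \<oplus>\<^bsub>V\<^esub> w = \<zero>\<^bsub>V\<^esub>"
      using u U_sc T_zero T_onto by (auto simp del: S.scale_minus_left)
  qed
  show "\<forall>c v. c \<in> carrier scalars \<and> v \<in> carrier V \<longrightarrow> c \<odot>\<^bsub>V\<^esub> v \<in> carrier V"
    by (auto simp: T_onto T_sc [symmetric] U_sc)
  show "\<forall>v w. v \<in> carrier V \<and> w \<in> carrier V \<longrightarrow> v \<oplus>\<^bsub>V\<^esub> w = w \<oplus>\<^bsub>V\<^esub> v"
    by (auto simp: T_onto T_add [symmetric] add.commute)
  show "\<forall>v w x. v \<in> carrier V \<and> w \<in> carrier V \<and> x \<in> carrier V \<longrightarrow>
      v \<oplus>\<^bsub>V\<^esub> w \<oplus>\<^bsub>V\<^esub> x = v \<oplus>\<^bsub>V\<^esub> (w \<oplus>\<^bsub>V\<^esub> x)"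
    by (auto simp: T_onto T_add [symmetric] U_add add.assoc)
  show "\<forall>v\<in>carrier V. v \<oplus>\<^bsub>V\<^esub> \<zero>\<^bsub>V\<^esub> = v"
    by (auto simp: T_onto T_add [symmetric] T_zero [symmetric] U_zero)
  show "\<forall>a b v. a \<in> carrier scalars \<and> b \<in> carrier scalars \<and> v \<in> carrier V \<longrightarrow>
      (a \<otimes>\<^bsub>scalars\<^esub> b) \<odot>\<^bsub>V\<^esub> v = a \<odot>\<^bsub>V\<^esub> (b \<odot>\<^bsub>V\<^esub> v)"
    by (auto simp: T_onto T_sc [symmetric] U_sc)
  show "\<forall>v\<in>carrier V. \<one>\<^bsub>scalars\<^esub> \<odot>\<^bsub>V\<^esub> v = v"
    by (auto simp: T_onto T_sc [symmetric])
  show "\<forall>a b v. a \<in> carrier scalars \<and> b \<in> carrier scalars \<and> v \<in> carrier V \<longrightarrow>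
      (a \<oplus>\<^bsub>scalars\<^esub> b) \<odot>\<^bsub>V\<^esub> v = a \<odot>\<^bsub>V\<^esub> v \<oplus>\<^bsub>V\<^esub> b \<odot>\<^bsub>V\<^esub> v"
    by (auto simp: T_onto T_sc [symmetric] T_add [symmetric] U_sc S.scale_left_distrib)
  show "\<forall>a v w. a \<in> carrier scalars \<and> v \<in> carrier V \<and> w \<in> carrier V \<longrightarrow>
      a \<odot>\<^bsub>V\<^esub> (v \<oplus>\<^bsub>V\<^esub> w) = a \<odot>\<^bsub>V\<^esub> v \<oplus>\<^bsub>V\<^esub> a \<odot>\<^bsub>V\<^esub> w"
    by (auto simp: T_onto T_sc [symmetric] T_add [symmetric] U_sc U_add S.scale_right_distrib)
qed

lemma fin_dim: "vectorspace.fin_dim scalars V"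
proof -
  interpret V: vectorspace scalars V by (rule vectorspace)
  obtain B where B: "finite B" "B \<subseteq> U" "\<forall>u\<in>U. \<exists>c. u = (\<Sum>b\<in>B. sc (c b) b)"
    using U_fin by blast
  have sub: "T ` B \<subseteq> carrier V" using B T_onto by auto
  interpret W: submodule scalars "V.span (T ` B)" V by (rule V.span_is_submodule [OF sub])
  \<comment> \<open>Membership in \<open>U\<close> is carried along in the induction because
    \<open>T\<close> is additive only on \<open>U\<close>.\<close>
  have "(\<Sum>b\<in>C. sc (c b) b) \<in> U \<and> T (\<Sum>b\<in>C. sc (c b) b) \<in> V.span (T ` B)"
    if "C \<subseteq> B" for C c
    using finite_subset [OF that B(1)] that
  proof (induction C rule: finite_induct)
    case empty
    then show ?case by (simp add: U_zero T_zero)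
  next
    case (insert b C)
    moreover have "b \<in> U" "T b \<in> V.span (T ` B)"
      using insert B V.in_own_span [OF sub] by auto
    ultimately show ?case
      by (auto simp: U_add U_sc T_add T_sc)
  qed
  then have "T u \<in> V.span (T ` B)" if "u \<in> U" for u
    using B(3) that by (metis order_refl)
  then have "V.span (T ` B) = carrier V"
    using V.span_is_subset2 [OF sub] T_onto by auto
  then show ?thesis
    unfolding V.fin_dim_def using B(1) sub by blast
qed

end

text \<open>By \<open>ker\<close>, \<open>S\<close> factors through \<open>T\<close>, and the factor
  is a surjection from \<open>V\<close> onto \<open>W\<close>. In the applications \<open>T\<close>
  and \<open>S\<close> are two quotient maps of one space of representatives, and dimensions are
  compared through this factor.\<close>

locale linear_cover2 = V: linear_cover sc U V T + W: linear_cover sc U W S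
  for sc :: "'k::field \<Rightarrow> 'u::ab_group_add \<Rightarrow> 'u" and U and V :: "('k, 'v) module" and T
    and W :: "('k, 'w) module" and S +
  assumes ker: "u \<in> U \<Longrightarrow> T u = \<zero>\<^bsub>V\<^esub> \<Longrightarrow> S u = \<zero>\<^bsub>W\<^esub>"
begin

interpretation S: vector_space sc by (rule V.sc)
interpretation V': vectorspace scalars V by (rule V.vectorspace)
interpretation W': vectorspace scalars W by (rule W.vectorspace)

definition "induced v = S (SOME u. u \<in> U \<and> T u = v)"

text \<open>Two preimages of the same vector differ by an element of the kernel of \<open>T\<close>,
  which \<open>S\<close> kills; hence the choice made by \<open>SOME\<close> does not affect the
  value.\<close>

lemma induced: assumes "u \<in> U" shows "induced (T u) = S u"
proof -
  define w where "w = (SOME w. w \<in> U \<and> T w = T u)"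
  have w: "w \<in> U" "T w = T u"
    unfolding w_def by (rule someI2 [where a = u], use assms in auto)+
  define x where "x = w + sc (-1) u"
  have x: "x \<in> U" unfolding x_def using w assms by (simp add: V.U_add V.U_sc del: S.scale_minus_left)
  have "w = x + u" by (simp add: x_def)
  have "T x \<oplus>\<^bsub>V\<^esub> T u = T u" using V.T_add [OF x assms] w \<open>w = x + u\<close> by simp
  then have "T x = \<zero>\<^bsub>V\<^esub>"
    using x assms V.T_onto V'.add.r_cancel_one by auto
  then have "S x = \<zero>\<^bsub>W\<^esub>" by (rule ker [OF x])
  then have "S w = S u" using W.T_add [OF x assms] \<open>w = x + u\<close> W.T_onto assms by simp
  then show ?thesis by (simp add: induced_def w_def)
qed

lemma linear_map_induced: "linear_map scalars V W induced"
proof (unfold_locales)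
  show "induced \<in> module_hom scalars V W"
    unfolding module_hom_def
    by (auto simp: V.T_onto W.T_onto induced V.T_add [symmetric] V.T_sc [symmetric] V.U_add V.U_sc
        W.T_add W.T_sc)
qed

interpretation L: linear_map scalars V W induced by (rule linear_map_induced)

lemma im: "L.im = carrier W"
  by (auto simp: L.im_def V.T_onto W.T_onto induced image_image)

lemma dim_sum: "W'.dim + vectorspace.dim scalars (V\<lparr>carrier := L.ker\<rparr>) = V'.dim"
  using L.rank_nullity [OF V.fin_dim] by (simp add: im)

lemma dim_le: "vectorspace.dim scalars W \<le> vectorspace.dim scalars V"
  using dim_sum by simp

text \<open>A surjection between spaces of equal finite dimension has trivial kernel. If it killed a
  nonzero \<open>T u\<close>, this vector could be exchanged into a basis, and the images of the
  other vectors, one fewer than the dimension, would already span \<open>W\<close>.\<close>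

lemma dim_eq_imp_ker:
  assumes dim: "vectorspace.dim scalars W = vectorspace.dim scalars V"
    and u: "u \<in> U" "S u = \<zero>\<^bsub>W\<^esub>"
  shows "T u = \<zero>\<^bsub>V\<^esub>"
proof (rule ccontr)
  assume neq: "T u \<noteq> \<zero>\<^bsub>V\<^esub>"
  have Tu: "T u \<in> carrier V" using u V.T_onto by auto
  obtain B where B: "finite B" "V'.basis B"
    using V'.finite_basis_exists [OF V.fin_dim] by blast
  have dimB: "V'.dim = card B" by (rule V'.dim_basis [OF B])
  have B': "B \<subseteq> carrier V" "V'.span B = carrier V" using B by (auto simp: V'.basis_def)
  have "V'.lin_indpt {T u}"
    using V'.lin_dep_iff_in_span [of "{}" "T u"] Tu neq
    by (auto simp: V'.lin_dep_def [of "{}"] V'.span_empty)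
  from V'.replacement [OF _ B(1) B'(1) this]
  obtain C where C: "finite C" "C \<subseteq> carrier V" "int (card C) \<le> int (card B) - 1"
      "V'.span ({T u} \<union> C) = carrier V"
    using Tu B' by auto
  have sub: "induced ` C \<subseteq> carrier W" using C by auto
  interpret X: submodule scalars "W'.span (induced ` C)" W by (rule W'.span_is_submodule [OF sub])
  \<comment> \<open>The preimage of the span is a subspace. It contains \<open>C\<close> and, since
    \<open>S u\<close> is zero, also \<open>T u\<close>; hence it is all of
    \<open>V\<close>.\<close>
  have "submodule scalars {v \<in> carrier V. induced v \<in> W'.span (induced ` C)} V"
    by (unfold_locales) (auto simp: L.f_add L.f_smult)
  moreover have "induced (T u) \<in> W'.span (induced ` C)"
    using u by (simp add: induced)
  ultimately have "V'.span ({T u} \<union> C) \<subseteq> {v \<in> carrier V. induced v \<in> W'.span (induced ` C)}"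
    using Tu C(2) W'.in_own_span [OF sub] by (intro V'.span_is_subset) auto
  then have "carrier W \<subseteq> W'.span (induced ` C)"
    unfolding C(4) im [symmetric] L.im_def by blast
  then have "W'.span (induced ` C) = carrier W"
    using W'.span_is_subset2 [OF sub] by blast
  then have "W'.dim \<le> card (induced ` C)"
    using W'.gen_ge_dim [of "induced ` C"] C(1) sub by simp
  also have "\<dots> \<le> card C" using C(1) by (rule card_image_le)
  finally show False using dim dimB C(3) by simp
qed

end

subsection \<open>Graded polynomials\<close>

abbreviation mpolys :: "nat \<Rightarrow> 'k::field mpoly set"
  where "mpolys n \<equiv> carrier (mpoly_ring n)"

lemma mpoly_ring_simps [simp]:
  "p \<oplus>\<^bsub>mpoly_ring n\<^esub> q = p + q"
  "p \<otimes>\<^bsub>mpoly_ring n\<^esub> q = p * q"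
  "\<one>\<^bsub>mpoly_ring n\<^esub> = 1"
  "\<zero>\<^bsub>mpoly_ring n\<^esub> = 0"
  by (simp_all add: mpoly_ring_def)

lemma mpolys_iff: "p \<in> mpolys n \<longleftrightarrow> (\<forall>t\<in>Poly_Mapping.keys p. Poly_Mapping.keys t \<subseteq> {..n})"
  by (simp add: mpoly_ring_def)

lemma mpoly_eq_sum:
  "(f :: 'k::field mpoly) = (\<Sum>t\<in>Poly_Mapping.keys f. Poly_Mapping.single t (Poly_Mapping.lookup f t))"
  by (rule poly_mapping_eqI)
    (simp add: lookup_sum lookup_single when_def in_keys_iff)

text \<open>A polynomial is the sum of its terms. The case \<open>single\<close> admits any
  coefficient but only monomials of \<open>f\<close> itself, so bounds on degrees and variables of
  \<open>f\<close> remain available.\<close>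

lemma mpoly_induct [case_names zero single add]:
  assumes "Q 0" "\<And>t c. t \<in> Poly_Mapping.keys f \<Longrightarrow> Q (Poly_Mapping.single t c)"
    "\<And>g h. Q g \<Longrightarrow> Q h \<Longrightarrow> Q (g + h)"
  shows "Q (f :: 'k::field mpoly)"
proof -
  have "Q (\<Sum>t\<in>A. Poly_Mapping.single t (Poly_Mapping.lookup f t))"
    if "A \<subseteq> Poly_Mapping.keys f" for A
    using finite_subset [OF that finite_keys] that
    by (induction A rule: finite_induct) (use assms in auto)
  from this [OF order_refl] show ?thesis
    by (subst mpoly_eq_sum) auto
qed

lemma mpolys_zero [simp, intro]: "0 \<in> mpolys n"
  and mpolys_one [simp, intro]: "1 \<in> mpolys n"
  and mpolys_const [simp, intro]: "const c \<in> mpolys n"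
  by (auto simp: mpolys_iff const_def)

lemma mpolys_indet [simp, intro]: "i \<le> n \<Longrightarrow> indet i \<in> mpolys n"
  by (auto simp: mpolys_iff indet_def)

lemma mpolys_uminus [simp, intro]: "p \<in> mpolys n \<Longrightarrow> - p \<in> mpolys n"
  by (auto simp: mpolys_iff in_keys_iff)

lemma mpolys_add [simp, intro]: "p \<in> mpolys n \<Longrightarrow> q \<in> mpolys n \<Longrightarrow> p + q \<in> mpolys n"
  using Poly_Mapping.keys_add [of p q] unfolding mpolys_iff by blast

lemma keys_add_nat: "Poly_Mapping.keys (s + t :: nat \<Rightarrow>\<^sub>0 nat) = Poly_Mapping.keys s \<union> Poly_Mapping.keys t"
  by (auto simp: in_keys_iff lookup_add)

lemma mpolys_mult [simp, intro]:
  assumes "p \<in> mpolys n" "q \<in> mpolys n" shows "p * q \<in> mpolys n"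
  unfolding mpolys_iff
proof
  fix t assume "t \<in> Poly_Mapping.keys (p * q)"
  then obtain a b where "t = a + b" "a \<in> Poly_Mapping.keys p" "b \<in> Poly_Mapping.keys q"
    using keys_mult [of p q] by blast
  then show "Poly_Mapping.keys t \<subseteq> {..n}"
    using assms by (auto simp: mpolys_iff keys_add_nat)
qed

lemma mpolys_power [simp, intro]: "p \<in> mpolys n \<Longrightarrow> p ^ k \<in> mpolys n"
  by (induction k) auto

lemma mpolys_single: "Poly_Mapping.keys t \<subseteq> {..n} \<Longrightarrow> Poly_Mapping.single t c \<in> mpolys n"
  by (auto simp: mpolys_iff)

lemma mpoly_ring_cring: "cring (mpoly_ring n :: 'k::field mpoly ring)"
proof (rule cringI)
  show "abelian_group (mpoly_ring n :: 'k mpoly ring)"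
  proof (rule abelian_groupI)
    fix x :: "'k mpoly" assume "x \<in> mpolys n"
    then show "\<exists>y\<in>mpolys n. y \<oplus>\<^bsub>mpoly_ring n\<^esub> x = \<zero>\<^bsub>mpoly_ring n\<^esub>"
      by (intro bexI [of _ "- x"]) auto
  qed (auto simp: algebra_simps)
  show "comm_monoid (mpoly_ring n :: 'k mpoly ring)"
    by (rule comm_monoidI) (auto simp: algebra_simps)
qed (auto simp: algebra_simps)

lemma mpoly_ring_a_inv: "p \<in> mpolys n \<Longrightarrow> \<ominus>\<^bsub>mpoly_ring n\<^esub> p = - p"
proof -
  interpret cring "mpoly_ring n :: 'a mpoly ring" by (rule mpoly_ring_cring)
  show "p \<in> mpolys n \<Longrightarrow> \<ominus>\<^bsub>mpoly_ring n\<^esub> p = - p"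
    by (intro minus_equality) auto
qed

lemma mpoly_idealD:
  assumes "ideal I (mpoly_ring n :: 'k::field mpoly ring)"
  shows "p \<in> I \<Longrightarrow> p \<in> mpolys n" "0 \<in> I" "p \<in> I \<Longrightarrow> q \<in> I \<Longrightarrow> p + q \<in> I"
    "h \<in> mpolys n \<Longrightarrow> p \<in> I \<Longrightarrow> h * p \<in> I" "p \<in> I \<Longrightarrow> - p \<in> I" "p \<in> I \<Longrightarrow> q \<in> I \<Longrightarrow> p - q \<in> I"
proof -
  interpret ideal I "mpoly_ring n :: 'k mpoly ring" by (rule assms)
  show "p \<in> I \<Longrightarrow> p \<in> mpolys n" by (rule a_Hcarr)
  show "0 \<in> I" using additive_subgroup.zero_closed [OF is_additive_subgroup] by simp
  show add: "p \<in> I \<Longrightarrow> q \<in> I \<Longrightarrow> p + q \<in> I" for p q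
    using additive_subgroup.a_closed [OF is_additive_subgroup, of p q] by simp
  show mult: "h \<in> mpolys n \<Longrightarrow> p \<in> I \<Longrightarrow> h * p \<in> I" for h p using I_l_closed [of p h] by simp
  show neg: "p \<in> I \<Longrightarrow> - p \<in> I" for p
    using mult [OF mpolys_uminus [OF mpolys_one]] by simp
  show "p \<in> I \<Longrightarrow> q \<in> I \<Longrightarrow> p - q \<in> I" using add [OF _ neg] by simp
qed

lemma mpoly_idealI:
  fixes I :: "'k::field mpoly set"
  assumes "I \<subseteq> mpolys n" "0 \<in> I" "\<And>p q. p \<in> I \<Longrightarrow> q \<in> I \<Longrightarrow> p + q \<in> I"
    and mult: "\<And>h p. h \<in> mpolys n \<Longrightarrow> p \<in> I \<Longrightarrow> h * p \<in> I"
  shows "ideal I (mpoly_ring n)"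
proof -
  interpret cring "mpoly_ring n :: 'k mpoly ring" by (rule mpoly_ring_cring)
  show ?thesis
  proof (rule idealI)
    show "subgroup I (add_monoid (mpoly_ring n))"
    proof
      fix x assume "x \<in> I"
      then have "inv\<^bsub>add_monoid (mpoly_ring n)\<^esub> x = (- 1) * x"
        using mpoly_ring_a_inv [of x n] assms(1) by (auto simp: a_inv_def)
      then show "inv\<^bsub>add_monoid (mpoly_ring n)\<^esub> x \<in> I"
        using mult [OF mpolys_uminus [OF mpolys_one] \<open>x \<in> I\<close>] by simp
    qed (use assms in auto)
    show "a \<otimes>\<^bsub>mpoly_ring n\<^esub> x \<in> I" if "a \<in> I" "x \<in> mpolys n" for a x
      using mult [OF that(2,1)] by (simp add: mult.commute)
  qed (use mult in \<open>auto simp: ring_axioms\<close>)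
qed

lemma mpoly_ideal_sum:
  "ideal I (mpoly_ring n) \<Longrightarrow> (\<And>i. i \<in> A \<Longrightarrow> p i \<in> I) \<Longrightarrow> sum p A \<in> I"
  by (induction A rule: infinite_finite_induct) (auto intro: mpoly_idealD)

lemma mon_deg_eq_sum:
  assumes "finite A" "Poly_Mapping.keys t \<subseteq> A"
  shows "mon_deg t = (\<Sum>i\<in>A. Poly_Mapping.lookup t i)"
  unfolding mon_deg_def using assms by (intro sum.mono_neutral_left) (auto simp: in_keys_iff)

lemma mon_deg_add: "mon_deg (s + t) = mon_deg s + mon_deg t"
proof -
  let ?A = "Poly_Mapping.keys s \<union> Poly_Mapping.keys t"
  show ?thesis
    using mon_deg_eq_sum [of ?A "s + t"] mon_deg_eq_sum [of ?A s] mon_deg_eq_sum [of ?A t]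
    by (simp add: keys_add_nat lookup_add sum.distrib)
qed

lemma mon_deg_zero [simp]: "mon_deg 0 = 0"
  by (simp add: mon_deg_def)

lemma mon_deg_single [simp]: "mon_deg (Poly_Mapping.single i k) = k"
  by (simp add: mon_deg_def)

text \<open>Subtraction of exponents is truncated; the bound on the exponent turns it into a genuine
  division by X_j^k.\<close>

lemma monom_split:
  assumes "k \<le> Poly_Mapping.lookup t j"
  obtains s :: "nat \<Rightarrow>\<^sub>0 nat" where "t = s + Poly_Mapping.single j k"
proof
  show "t = (t - Poly_Mapping.single j k) + Poly_Mapping.single j k"
    by (rule poly_mapping_eqI)
      (use assms in \<open>auto simp: lookup_add lookup_minus lookup_single when_def\<close>)
qed

lemma formsD: "f \<in> forms n d \<Longrightarrow> f \<in> mpolys n"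
  by (simp add: forms_def)

lemma forms_zero [simp, intro]: "0 \<in> forms n d"
  by (simp add: forms_def)

lemma forms_add [intro]: "f \<in> forms n d \<Longrightarrow> g \<in> forms n d \<Longrightarrow> f + g \<in> forms n d"
  using Poly_Mapping.keys_add [of f g] by (fastforce simp: forms_def)

lemma forms_mult [intro]: "f \<in> forms n d \<Longrightarrow> g \<in> forms n e \<Longrightarrow> f * g \<in> forms n (d + e)"
  using keys_mult [of f g] by (fastforce simp: forms_def mon_deg_add)

lemma forms_const [simp, intro]: "const c \<in> forms n 0"
  by (auto simp: forms_def const_def mpolys_iff)

lemma forms_indet [intro]: "i \<le> n \<Longrightarrow> indet i \<in> forms n 1"
  by (auto simp: forms_def indet_def mpolys_iff)

lemma const_add: "const (a + b) = const a + const b"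
  by (simp add: const_def single_add)

lemma const_mult: "const (a * b) = const a * const b"
  by (simp add: const_def mult_single)

lemma const_one [simp]: "const 1 = 1"
  by (simp add: const_def)

lemma const_zero [simp]: "const 0 = 0"
  by (simp add: const_def)

lemma const_of_nat: "const (of_nat k) = of_nat k"
  by (simp add: const_def)

lemma const_mult_single: "const a * Poly_Mapping.single t b = Poly_Mapping.single t (a * b)"
  by (simp add: const_def mult_single)

lemma forms_const_mult [intro]: "f \<in> forms n d \<Longrightarrow> const c * f \<in> forms n d"
  using forms_mult [OF forms_const, of f n d c] by simp

lemma indet_power: "indet j ^ k = Poly_Mapping.single (Poly_Mapping.single j k) 1"
  by (induction k) (auto simp: indet_def mult_single single_add [symmetric])

lemma forms_indet_power [intro]: "i \<le> n \<Longrightarrow> indet i ^ k \<in> forms n k"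
  by (auto simp: forms_def indet_power mpolys_iff)

lemma lookup_hom_comp:
  "Poly_Mapping.lookup (hom_comp d f) t = (if mon_deg t = d then Poly_Mapping.lookup f t else 0)"
  by (auto simp: hom_comp_def lookup_sum lookup_single when_def in_keys_iff)

lemma hom_comp_zero [simp]: "hom_comp d 0 = 0"
  by (rule poly_mapping_eqI) (simp add: lookup_hom_comp)

lemma hom_comp_add: "hom_comp d (f + g) = hom_comp d f + hom_comp d g"
  by (rule poly_mapping_eqI) (simp add: lookup_hom_comp lookup_add)

lemma hom_comp_single:
  "hom_comp d (Poly_Mapping.single t c) = (if mon_deg t = d then Poly_Mapping.single t c else 0)"
  by (rule poly_mapping_eqI) (auto simp: lookup_hom_comp lookup_single when_def)

lemma hom_comp_forms [intro]: "f \<in> mpolys n \<Longrightarrow> hom_comp d f \<in> forms n d"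
  by (auto simp: forms_def mpolys_iff in_keys_iff lookup_hom_comp split: if_splits)

lemma hom_comp_of_form: "f \<in> forms n e \<Longrightarrow> hom_comp d f = (if d = e then f else 0)"
  by (rule poly_mapping_eqI) (auto simp: lookup_hom_comp forms_def in_keys_iff)

text \<open>Both sides are bilinear, so two monomials suffice; there only the index equal to the
  degree of the first one contributes.\<close>

lemma hom_comp_mult: "hom_comp d (f * g) = (\<Sum>i\<le>d. hom_comp i f * hom_comp (d - i) g)"
proof (induction f rule: mpoly_induct)
  case (single s a)
  show ?case
  proof (induction g rule: mpoly_induct)
    case (single t b)
    have "(\<Sum>i\<le>d. hom_comp i (Poly_Mapping.single s a) * hom_comp (d - i) (Poly_Mapping.single t b)) =
      (\<Sum>i\<le>d. if i = mon_deg s then (if mon_deg s + mon_deg t = d then Poly_Mapping.single (s + t) (a * b) else 0) else 0)"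
      by (intro sum.cong) (auto simp: hom_comp_single mult_single)
    then show ?case
      by (auto simp: mult_single hom_comp_single mon_deg_add)
  qed (auto simp: distrib_left hom_comp_add sum.distrib)
qed (auto simp: distrib_right hom_comp_add sum.distrib)

lemma sum_hom_comp: "\<exists>D. \<forall>d\<ge>D. f = (\<Sum>i\<le>d. hom_comp i f)"
proof (intro exI allI impI)
  \<comment> \<open>The highest degree of a monomial serves as bound. For \<open>f = 0\<close> the
    value \<open>Max {}\<close> is unspecified, but then there is no monomial to be bounded.\<close>
  fix d assume d: "Max (mon_deg ` Poly_Mapping.keys f) \<le> d"
  show "f = (\<Sum>i\<le>d. hom_comp i f)"
  proof (rule poly_mapping_eqI)
    fix t
    have "mon_deg t \<le> d" if "Poly_Mapping.lookup f t \<noteq> 0"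
      using that d by (meson Max_ge finite_imageI finite_keys image_eqI in_keys_iff order_trans)
    then show "Poly_Mapping.lookup f t = Poly_Mapping.lookup (\<Sum>i\<le>d. hom_comp i f) t"
      by (auto simp: lookup_sum lookup_hom_comp)
  qed
qed

text \<open>No exponent exceeds the total degree, so a monomial is recorded by a function from
  \<open>{..n}\<close> to \<open>{..d}\<close>.\<close>

lemma finite_monomials: "finite {t. Poly_Mapping.keys t \<subseteq> {..n} \<and> mon_deg t = d}"
proof (rule finite_subset)
  show "{t. Poly_Mapping.keys t \<subseteq> {..n} \<and> mon_deg t = d} \<subseteq>
    (\<lambda>f. \<Sum>i\<le>n. Poly_Mapping.single i (f i)) ` ({..n} \<rightarrow>\<^sub>E {..d})"
  proof
    fix t assume "t \<in> {t. Poly_Mapping.keys t \<subseteq> {..n} \<and> mon_deg t = d}"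
    then have t: "Poly_Mapping.keys t \<subseteq> {..n}" "mon_deg t = d" by auto
    have "Poly_Mapping.lookup t i \<le> d" if "i \<le> n" for i
      using that t mon_deg_eq_sum [of "{..n}" t] member_le_sum [of i "{..n}" "Poly_Mapping.lookup t"]
      by auto
    moreover have "t = (\<Sum>i\<le>n. Poly_Mapping.single i (Poly_Mapping.lookup t i))"
    proof (rule poly_mapping_eqI)
      fix i
      show "Poly_Mapping.lookup t i = Poly_Mapping.lookup (\<Sum>i\<le>n. Poly_Mapping.single i (Poly_Mapping.lookup t i)) i"
        using t by (auto simp: lookup_sum lookup_single when_def in_keys_iff)
    qed
    ultimately show "t \<in> (\<lambda>f. \<Sum>i\<le>n. Poly_Mapping.single i (f i)) ` ({..n} \<rightarrow>\<^sub>E {..d})"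
      by (intro image_eqI [where x = "restrict (Poly_Mapping.lookup t) {..n}"])
        (simp_all add: restrict_PiE_iff)
  qed
qed (auto intro: finite_PiE)

section \<open>Formal partial derivatives\<close>

definition partial :: "nat \<Rightarrow> 'k::field mpoly \<Rightarrow> 'k mpoly"
  where "partial j f = (\<Sum>t\<in>Poly_Mapping.keys f. Poly_Mapping.single (t - Poly_Mapping.single j 1)
    (of_nat (Poly_Mapping.lookup t j) * Poly_Mapping.lookup f t))"

text \<open>Sums over the supports of different polynomials can be added only over a common index
  set.\<close>

lemma partial_eq_sum:
  assumes "finite A" "Poly_Mapping.keys f \<subseteq> A"
  shows "partial j f = (\<Sum>t\<in>A. Poly_Mapping.single (t - Poly_Mapping.single j 1)
    (of_nat (Poly_Mapping.lookup t j) * Poly_Mapping.lookup f t))"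
  unfolding partial_def using assms by (intro sum.mono_neutral_left) (auto simp: in_keys_iff)

lemma partial_zero [simp]: "partial j 0 = 0"
  by (simp add: partial_def)

lemma partial_single: "partial j (Poly_Mapping.single t c) =
    Poly_Mapping.single (t - Poly_Mapping.single j 1) (of_nat (Poly_Mapping.lookup t j) * c)"
  by (simp add: partial_def)

lemma partial_add: "partial j (f + g) = partial j f + partial j g"
proof -
  let ?A = "Poly_Mapping.keys f \<union> Poly_Mapping.keys g"
  show ?thesis
    using partial_eq_sum [of ?A "f + g" j] partial_eq_sum [of ?A f j] partial_eq_sum [of ?A g j]
    by (simp add: Poly_Mapping.keys_add lookup_add distrib_left single_add sum.distrib)
qed

lemma partial_mult: "partial j (f * g) = f * partial j g + g * partial j f"
proof (induction f rule: mpoly_induct)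
  case (single s a)
  show ?case
  proof (induction g rule: mpoly_induct)
    case (single t b)
    let ?e = "Poly_Mapping.single j (1::nat)"
    \<comment> \<open>If X_j does not divide the monomial \<open>u\<close>, the truncated exponents
      may differ, but the coefficient is zero. Otherwise the subtraction can be carried out inside
      \<open>u\<close>.\<close>
    have *: "Poly_Mapping.single (u + v - ?e) (of_nat (Poly_Mapping.lookup u j) * c) =
        Poly_Mapping.single (v + (u - ?e)) (of_nat (Poly_Mapping.lookup u j) * c)" for u v and c :: 'a
    proof (cases "Poly_Mapping.lookup u j = 0")
      case False
      then have "u + v - ?e = v + (u - ?e)"
        by (intro poly_mapping_eqI) (auto simp: lookup_add lookup_minus lookup_single when_def)
      then show ?thesis by simp
    qed simp
    have "partial j (Poly_Mapping.single s a * Poly_Mapping.single t b) =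
        Poly_Mapping.single (s + t - ?e) (of_nat (Poly_Mapping.lookup s j) * (a * b)) +
        Poly_Mapping.single (t + s - ?e) (of_nat (Poly_Mapping.lookup t j) * (a * b))"
      by (simp add: mult_single partial_single lookup_add distrib_right single_add add.commute)
    also have "\<dots> = Poly_Mapping.single (t + (s - ?e)) (of_nat (Poly_Mapping.lookup s j) * (a * b)) +
        Poly_Mapping.single (s + (t - ?e)) (of_nat (Poly_Mapping.lookup t j) * (a * b))"
      by (simp only: *)
    also have "\<dots> = Poly_Mapping.single s a * partial j (Poly_Mapping.single t b) +
        Poly_Mapping.single t b * partial j (Poly_Mapping.single s a)"
      by (simp add: mult_single partial_single ac_simps)
    finally show ?case .
  qed (auto simp: distrib_left distrib_right partial_add add_ac)
qed (auto simp: distrib_left distrib_right partial_add add_ac)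

lemma partial_const [simp]: "partial j (const c) = 0"
  by (simp add: const_def partial_single)

lemma partial_indet: "partial j (indet i) = (if i = j then 1 else 0)"
  by (simp add: indet_def partial_single lookup_single when_def)

lemma partial_uminus: "partial j (- f) = - partial j f"
  using partial_add [of j f "- f"] by (metis add.right_inverse add_eq_0_iff partial_zero)

lemma partial_diff: "partial j (f - g) = partial j f - partial j g"
  using partial_add [of j f "- g"] by (simp add: partial_uminus)

lemma partial_mpolys [intro, simp]:
  assumes "f \<in> mpolys n" shows "partial j f \<in> mpolys n"
proof (rule mpoly_induct [where f = f])
  fix t :: "nat \<Rightarrow>\<^sub>0 nat" and c :: 'a assume "t \<in> Poly_Mapping.keys f"
  then have "Poly_Mapping.keys t \<subseteq> {..n}" using assms by (auto simp: mpolys_iff)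
  moreover have "Poly_Mapping.keys (t - Poly_Mapping.single j 1) \<subseteq> Poly_Mapping.keys t"
    by (auto simp: in_keys_iff lookup_minus)
  ultimately show "partial j (Poly_Mapping.single t c) \<in> mpolys n"
    unfolding partial_single by (intro mpolys_single) auto
qed (auto simp: partial_add)

text \<open>Vectors are indexed by all natural numbers and have to vanish beyond \<open>n\<close>;
  for gradients this is the reason.\<close>

lemma partial_beyond:
  assumes "f \<in> mpolys n" "n < j" shows "partial j f = 0"
  unfolding partial_def
proof (rule sum.neutral, rule ballI)
  fix t assume "t \<in> Poly_Mapping.keys f"
  then have "j \<notin> Poly_Mapping.keys t"
    using assms by (metis atMost_iff leD mpolys_iff subsetD)
  then show "Poly_Mapping.single (t - Poly_Mapping.single j 1)
      (of_nat (Poly_Mapping.lookup t j) * Poly_Mapping.lookup f t) = 0"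
    by (simp add: in_keys_iff)
qed

text \<open>These are the coefficients of dx_j in degree \<open>d\<close>: forms of degree d - 1, as
  dx_j has degree 1. The condition with \<open>Suc\<close> leaves only 0 for \<open>d = 0\<close>,
  where the truncated \<open>d - 1\<close> would admit constants.\<close>

definition shifted_forms :: "nat \<Rightarrow> nat \<Rightarrow> 'k::field mpoly set"
  where "shifted_forms n d = {f \<in> mpolys n. \<forall>t\<in>Poly_Mapping.keys f. Suc (mon_deg t) = d}"

text \<open>The projection onto \<open>shifted_forms\<close>. The case \<open>d = 0\<close> is
  separate because truncated subtraction would yield the constant term instead of 0.\<close>

definition shifted_comp :: "nat \<Rightarrow> 'k::field mpoly \<Rightarrow> 'k mpoly"
  where "shifted_comp d f = (if d = 0 then 0 else hom_comp (d - 1) f)"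

lemma shifted_forms_0 [simp]: "shifted_forms n 0 = {0}"
  by (auto simp: shifted_forms_def)

lemma shifted_forms_Suc [simp]: "shifted_forms n (Suc d) = forms n d"
  by (auto simp: shifted_forms_def forms_def)

lemma shifted_comp_of_form: "f \<in> shifted_forms n d \<Longrightarrow> shifted_comp d f = f"
  by (cases d) (auto simp: shifted_comp_def hom_comp_of_form)

lemma shifted_comp_add: "shifted_comp d (f + g) = shifted_comp d f + shifted_comp d g"
  by (auto simp: shifted_comp_def hom_comp_add)

lemma shifted_comp_zero [simp]: "shifted_comp d 0 = 0"
  by (auto simp: shifted_comp_def)

lemma shifted_comp_single: "shifted_comp d (Poly_Mapping.single t c) =
    (if Suc (mon_deg t) = d then Poly_Mapping.single t c else 0)"
  by (cases d) (auto simp: shifted_comp_def hom_comp_single)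

lemma partial_shifted_forms:
  assumes "f \<in> forms n d" shows "partial j f \<in> shifted_forms n d"
proof -
  have "Suc (mon_deg t) = d" if "t \<in> Poly_Mapping.keys (partial j f)" for t
  proof -
    \<comment> \<open>A key of the sum comes from a monomial \<open>s\<close> of \<open>f\<close>
      with nonzero coefficient. So X_j divides \<open>s\<close>, and the subtraction lowers the
      degree by exactly one.\<close>
    from subsetD [OF keys_sum that [unfolded partial_def]] obtain s where s: "s \<in> Poly_Mapping.keys f"
      "t \<in> Poly_Mapping.keys (Poly_Mapping.single (s - Poly_Mapping.single j 1)
        (of_nat (Poly_Mapping.lookup s j) * Poly_Mapping.lookup f s))"
      by (elim UN_E) blast
    then have "Poly_Mapping.lookup s j \<noteq> 0" and t: "t = s - Poly_Mapping.single j 1"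
      by (auto split: if_splits intro!: gr0I)
    then obtain u where u: "s = u + Poly_Mapping.single j 1"
      using monom_split [of 1 s j] by auto
    with t have "t = u" by simp
    with u s assms show ?thesis by (auto simp: forms_def mon_deg_add)
  qed
  then show ?thesis using assms by (auto simp: shifted_forms_def forms_def)
qed

lemma shifted_forms_mult:
  assumes "h \<in> forms n e" "f \<in> shifted_forms n d" shows "h * f \<in> shifted_forms n (e + d)"
proof (cases d)
  case 0
  then show ?thesis using assms by (auto simp: shifted_forms_def)
qed (use assms in auto)

text \<open>Differentiation lowers degrees by one, so the component of degree d - 1 pairs components
  of \<open>h\<close> and \<open>f\<close> of total degree \<open>d\<close>. Only components of
  \<open>f\<close> of degree at most \<open>d\<close> occur, which later allows ideals to be
  compared up to degree \<open>d\<close> only.\<close>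

lemma shifted_comp_mult_partial:
  "shifted_comp d (h * partial j f) = (\<Sum>k\<le>d. hom_comp (d - k) h * partial j (hom_comp k f))"
proof (induction f rule: mpoly_induct)
  case (single t b)
  show ?case
  proof (induction h rule: mpoly_induct)
    case (single s a)
    have "(\<Sum>k\<le>d. hom_comp (d - k) (Poly_Mapping.single s a) * partial j (hom_comp k (Poly_Mapping.single t b))) =
      (\<Sum>k\<le>d. if k = mon_deg t then (if mon_deg s + mon_deg t = d
        then Poly_Mapping.single s a * partial j (Poly_Mapping.single t b) else 0) else 0)"
      by (intro sum.cong) (auto simp: hom_comp_single)
    also have "\<dots> = (if mon_deg s + mon_deg t = d
        then Poly_Mapping.single s a * partial j (Poly_Mapping.single t b) else 0)"
      by auto
    also have "\<dots> = shifted_comp d (Poly_Mapping.single s a * partial j (Poly_Mapping.single t b))"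
    proof (cases "Poly_Mapping.lookup t j = 0")
      case False
      then obtain u where u: "t = u + Poly_Mapping.single j 1"
        using monom_split [of 1 t j] by auto
      then show ?thesis
        by (simp add: partial_single mult_single shifted_comp_single mon_deg_add)
    qed (simp add: partial_single)
    finally show ?case by simp
  qed (auto simp: distrib_right shifted_comp_add hom_comp_add sum.distrib)
qed (auto simp: distrib_left shifted_comp_add hom_comp_add partial_add sum.distrib)

text \<open>On a monomial, X_j times the derivative with respect to X_j multiplies by the exponent
  of X_j. Since only X_0, ..., X_n occur, these exponents add up to \<open>d\<close>.\<close>

lemma euler_formula:
  assumes "f \<in> forms n d"
  shows "(\<Sum>j\<le>n. indet j * partial j f) = of_nat d * f"
proof (rule mpoly_induct [where f = f])
  fix t :: "nat \<Rightarrow>\<^sub>0 nat" and c :: 'a assume "t \<in> Poly_Mapping.keys f"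
  then have t: "Poly_Mapping.keys t \<subseteq> {..n}" "mon_deg t = d" using assms by (auto simp: forms_def mpolys_iff)
  have "indet j * partial j (Poly_Mapping.single t c) =
      Poly_Mapping.single t (of_nat (Poly_Mapping.lookup t j) * c)" for j
  proof (cases "Poly_Mapping.lookup t j = 0")
    case False
    then obtain u where u: "t = u + Poly_Mapping.single j 1"
      using monom_split [of 1 t j] by auto
    then show ?thesis by (simp add: partial_single mult_single indet_def add.commute)
  qed (simp add: partial_single)
  then have "(\<Sum>j\<le>n. indet j * partial j (Poly_Mapping.single t c)) =
      (\<Sum>j\<le>n. const (of_nat (Poly_Mapping.lookup t j)) * Poly_Mapping.single t c)"
    by (simp add: const_mult_single)
  also have "\<dots> = of_nat (mon_deg t) * Poly_Mapping.single t c"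
    using mon_deg_eq_sum [of "{..n}" t] t(1)
    by (simp add: const_of_nat sum_distrib_right [symmetric])
  finally show "(\<Sum>j\<le>n. indet j * partial j (Poly_Mapping.single t c)) =
      of_nat d * Poly_Mapping.single t c" using t by simp
qed (auto simp: distrib_left partial_add sum.distrib)

subsection \<open>Homogeneous primes\<close>

lemma homogeneous_idealD:
  assumes "homogeneous_ideal n I"
  shows "ideal I (mpoly_ring n)" "f \<in> I \<Longrightarrow> hom_comp d f \<in> I"
  using assms by (auto simp: homogeneous_ideal_def)

lemma hom_comp_form_mult:
  assumes "f \<in> forms n e"
  shows "hom_comp d (f * g) = (if e \<le> d then f * hom_comp (d - e) g else 0)"
proof -
  have "hom_comp d (f * g) = (\<Sum>i\<le>d. if i = e then f * hom_comp (d - e) g else 0)"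
    unfolding hom_comp_mult by (intro sum.cong) (auto simp: hom_comp_of_form [OF assms])
  then show ?thesis by simp
qed

lemma ideal_Union_chain:
  fixes C :: "'k::field mpoly set set"
  assumes "C \<noteq> {}" "subset.chain UNIV C" "\<And>Q. Q \<in> C \<Longrightarrow> ideal Q (mpoly_ring n)"
  shows "ideal (\<Union>C) (mpoly_ring n)"
proof (rule mpoly_idealI)
  show "\<Union>C \<subseteq> mpolys n" using mpoly_idealD(1) [OF assms(3)] by auto
  show "0 \<in> \<Union>C" using assms(1) mpoly_idealD(2) [OF assms(3)] by auto
next
  fix p q assume "p \<in> \<Union>C" "q \<in> \<Union>C"
  then obtain P Q where *: "p \<in> P" "P \<in> C" "q \<in> Q" "Q \<in> C" by auto
  then have "P \<subseteq> Q \<or> Q \<subseteq> P" using assms(2) by (auto simp: subset_chain_def)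
  then have "p + q \<in> Q \<or> p + q \<in> P"
    using * mpoly_idealD(3) [OF assms(3) [OF *(2)]] mpoly_idealD(3) [OF assms(3) [OF *(4)]] by auto
  then show "p + q \<in> \<Union>C" using * by auto
next
  fix h p :: "'k mpoly" assume "h \<in> mpolys n" "p \<in> \<Union>C"
  then show "h * p \<in> \<Union>C" using mpoly_idealD(4) [OF assms(3)] by auto
qed

text \<open>Zorn's lemma yields an ideal \<open>M\<close> that is maximal among those containing
  \<open>A\<close> and missing all powers of \<open>x\<close>. If neither \<open>f\<close> nor
  \<open>g\<close> lies in \<open>M\<close>, then M + (f) and M + (g) both contain powers of
  \<open>x\<close>, and the product of these powers lies in M + (fg).\<close>

lemma maximal_ideal_avoiding_powers:
  fixes A :: "'k::field mpoly set"
  assumes A: "ideal A (mpoly_ring n)" and x: "x \<in> mpolys n" "\<And>k. x ^ k \<notin> A"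
  shows "\<exists>M. ideal M (mpoly_ring n) \<and> A \<subseteq> M \<and> (\<forall>k. x ^ k \<notin> M) \<and>
    (\<forall>f\<in>mpolys n. \<forall>g\<in>mpolys n. f * g \<in> M \<longrightarrow> f \<in> M \<or> g \<in> M)"
proof -
  define S where "S = {Q. ideal Q (mpoly_ring n) \<and> A \<subseteq> Q \<and> (\<forall>k. x ^ k \<notin> Q)}"
  have "\<exists>M\<in>S. (\<forall>Q\<in>S. M \<subseteq> Q \<longrightarrow> Q = M)"
  proof (rule subset_Zorn_nonempty)
    show "S \<noteq> {}" using A x by (auto simp: S_def)
  next
    fix C assume C: "C \<noteq> {}" "subset.chain S C"
    then have "C \<subseteq> S" "subset.chain UNIV C" by (auto simp: subset_chain_def)
    then show "\<Union>C \<in> S"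
      using ideal_Union_chain [of C n] C(1) unfolding S_def by blast
  qed
  then obtain M where "M \<in> S" and max: "\<And>Q. Q \<in> S \<Longrightarrow> M \<subseteq> Q \<Longrightarrow> Q = M"
    by meson
  then have M: "ideal M (mpoly_ring n)" "A \<subseteq> M" "\<And>k. x ^ k \<notin> M"
    by (auto simp: S_def)
  have key: "\<exists>k. (\<exists>q\<in>M. \<exists>h\<in>mpolys n. x ^ k = q + h * f)" if f: "f \<in> mpolys n" "f \<notin> M" for f
  proof (rule ccontr)
    assume *: "\<not> ?thesis"
    define J where "J = {q + h * f | q h. q \<in> M \<and> h \<in> mpolys n}"
    have "M \<subseteq> J" unfolding J_def using f by (force intro: exI [of _ 0])
    moreover have "ideal J (mpoly_ring n)"
    proof (rule mpoly_idealI)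
      show "J \<subseteq> mpolys n" using f mpoly_idealD(1) [OF M(1)] by (auto simp: J_def)
      show "0 \<in> J" using \<open>M \<subseteq> J\<close> mpoly_idealD(2) [OF M(1)] by blast
      show "p + q \<in> J" if pq: "p \<in> J" "q \<in> J" for p q
      proof -
        obtain a b c d where "p = a + b * f" "q = c + d * f" "a \<in> M" "c \<in> M" "b \<in> mpolys n" "d \<in> mpolys n"
          using pq unfolding J_def by blast
        then have "p + q = (a + c) + (b + d) * f" "a + c \<in> M" "b + d \<in> mpolys n"
          using mpoly_idealD(3) [OF M(1)] by (auto simp: algebra_simps)
        then show ?thesis unfolding J_def by blast
      qed
      show "h * p \<in> J" if hp: "h \<in> mpolys n" "p \<in> J" for h p
      proof -
        obtain a b where "p = a + b * f" "a \<in> M" "b \<in> mpolys n"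
          using hp unfolding J_def by blast
        then have "h * p = h * a + (h * b) * f" by (simp add: algebra_simps)
        moreover have "h * a \<in> M" "h * b \<in> mpolys n"
          using mpoly_idealD(4) [OF M(1) hp(1) \<open>a \<in> M\<close>] hp(1) \<open>b \<in> mpolys n\<close> by auto
        ultimately show ?thesis unfolding J_def by blast
      qed
    qed
    moreover have "x ^ k \<notin> J" for k using * unfolding J_def by blast
    ultimately have "J \<in> S" using M(2) by (auto simp: S_def)
    then have "J = M" using max \<open>M \<subseteq> J\<close> by blast
    moreover have "0 + 1 * f \<in> J" unfolding J_def using mpoly_idealD(2) [OF M(1)] by blast
    ultimately show False using f by simp
  qed
  have "f \<in> M \<or> g \<in> M" if fg: "f \<in> mpolys n" "g \<in> mpolys n" "f * g \<in> M" for f g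
  proof (rule ccontr)
    assume "\<not> (f \<in> M \<or> g \<in> M)"
    then have "f \<notin> M" "g \<notin> M" by auto
    obtain k q h where k: "x ^ k = q + h * f" "q \<in> M" "h \<in> mpolys n"
      using key [OF fg(1) \<open>f \<notin> M\<close>] by blast
    obtain l r j where l: "x ^ l = r + j * g" "r \<in> M" "j \<in> mpolys n"
      using key [OF fg(2) \<open>g \<notin> M\<close>] by blast
    have rg: "r + j * g \<in> mpolys n" and hf: "h * f \<in> mpolys n" and hj: "h * j \<in> mpolys n"
      using fg k(3) l mpoly_idealD(1) [OF M(1)] by blast+
    \<comment> \<open>Every summand has a factor \<open>q\<close>, \<open>r\<close> or
      \<open>f * g\<close> from \<open>M\<close>, so a power of \<open>x\<close> would lie in
      \<open>M\<close>.\<close>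
    have "x ^ (k + l) = (r + j * g) * q + ((h * f) * r + (h * j) * (f * g))"
      unfolding power_add k(1) l(1) by (simp add: algebra_simps)
    moreover have "(r + j * g) * q + ((h * f) * r + (h * j) * (f * g)) \<in> M"
      by (intro mpoly_idealD(3) [OF M(1)] mpoly_idealD(4) [OF M(1)] rg hf hj k(2) l(2) fg(3))
    ultimately have "x ^ (k + l) \<in> M" by simp
    then show False using M(3) by blast
  qed
  then show ?thesis using M by (intro exI [of _ M]) simp
qed

text \<open>The prime \<open>M\<close> that avoids the powers need not be homogeneous. The
  polynomials with all components in \<open>M\<close> form the largest homogeneous ideal inside
  \<open>M\<close>, and this ideal \<open>P\<close> is still prime.\<close>

lemma exists_homogeneous_prime:
  fixes A :: "'k::field mpoly set"
  assumes A: "homogeneous_ideal n A" and i: "i \<le> n" and pow: "\<And>k. indet i ^ k \<notin> A"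
  obtains P where "primeideal P (mpoly_ring n)" "homogeneous_ideal n P" "indet i \<notin> P" "A \<subseteq> P"
proof -
  obtain M where "ideal M (mpoly_ring n) \<and> A \<subseteq> M \<and> (\<forall>k. indet i ^ k \<notin> M) \<and>
      (\<forall>f\<in>mpolys n. \<forall>g\<in>mpolys n. f * g \<in> M \<longrightarrow> f \<in> M \<or> g \<in> M)"
    by (rule exE [OF maximal_ideal_avoiding_powers
          [OF homogeneous_idealD(1) [OF A] mpolys_indet [OF i] pow]])
  then have M: "ideal M (mpoly_ring n)" "A \<subseteq> M" "\<forall>k. indet i ^ k \<notin> M"
    and prime: "\<forall>f\<in>mpolys n. \<forall>g\<in>mpolys n. f * g \<in> M \<longrightarrow> f \<in> M \<or> g \<in> M"
    by simp_all
  note MD = mpoly_idealD [OF M(1)]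
  define P where "P = {f \<in> mpolys n. \<forall>d. hom_comp d f \<in> M}"
  have comp: "hom_comp d f \<in> mpolys n" if "f \<in> mpolys n" for d and f :: "'k mpoly"
    using that by (auto intro: formsD)
  have idl: "ideal P (mpoly_ring n)"
  proof (rule mpoly_idealI)
    show "h * p \<in> P" if hp: "h \<in> mpolys n" "p \<in> P" for h p
    proof -
      have "hom_comp d (h * p) \<in> M" for d
        unfolding hom_comp_mult
        by (intro mpoly_ideal_sum [OF M(1)] MD(4)) (use hp comp in \<open>auto simp: P_def\<close>)
      then show ?thesis using hp by (auto simp: P_def)
    qed
  next
    show "p + q \<in> P" if "p \<in> P" "q \<in> P" for p q
      using that MD(3) by (simp add: P_def hom_comp_add)
  qed (auto simp: P_def MD(2))
  have "hom_comp e (hom_comp d f) = (if e = d then hom_comp d f else 0)" if "f \<in> mpolys n" for d e and f :: "'k mpoly"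
    using hom_comp_of_form [OF hom_comp_forms [OF that]] by simp
  then have hom: "homogeneous_ideal n P"
    unfolding homogeneous_ideal_def using idl by (simp add: P_def comp MD(2))
  have "hom_comp 1 (indet i :: 'k mpoly) = indet i"
    using hom_comp_of_form [OF forms_indet [OF i], of 1] by simp
  then have nin: "indet i \<notin> P" using M(3) [rule_format, of 1] by (auto simp: P_def intro!: exI [of _ 1])
  have sub: "A \<subseteq> P"
    using M(2) A mpoly_idealD(1) [OF homogeneous_idealD(1) [OF A]]
    by (auto simp: P_def homogeneous_ideal_def)
  have "primeideal P (mpoly_ring n)"
  proof (rule primeidealI)
    show "mpolys n \<noteq> P" using nin i by blast
    fix f g assume "f \<in> mpolys n" "g \<in> mpolys n" "f \<otimes>\<^bsub>mpoly_ring n\<^esub> g \<in> P"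
    then have fg: "f \<in> mpolys n" "g \<in> mpolys n" "f * g \<in> P" by auto
    show "f \<in> P \<or> g \<in> P"
    proof (rule ccontr)
      assume "\<not> (f \<in> P \<or> g \<in> P)"
      then have ex: "\<exists>d. hom_comp d f \<notin> M" "\<exists>d. hom_comp d g \<notin> M"
        using fg by (auto simp: P_def)
      \<comment> \<open>The lowest degrees in which \<open>f\<close> and \<open>g\<close> have
        components outside \<open>M\<close>.\<close>
      define d e where "d = (LEAST d. hom_comp d f \<notin> M)" and "e = (LEAST e. hom_comp e g \<notin> M)"
      have d1: "hom_comp d f \<notin> M" and e1: "hom_comp e g \<notin> M"
        unfolding d_def e_def by (rule LeastI_ex [OF ex(1)], rule LeastI_ex [OF ex(2)])
      have d2: "hom_comp i f \<in> M" if "i < d" for i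
        using not_less_Least [OF that [unfolded d_def]] by simp
      have e2: "hom_comp i g \<in> M" if "i < e" for i
        using not_less_Least [OF that [unfolded e_def]] by simp
      let ?F = "\<lambda>i. hom_comp i f * hom_comp (d + e - i) g"
      have "hom_comp (d + e) (f * g) = ?F d + (\<Sum>i\<in> {..d + e} - {d}. ?F i)"
        unfolding hom_comp_mult by (subst sum.remove [of _ d]) auto
      moreover have "(\<Sum>i\<in> {..d + e} - {d}. ?F i) \<in> M"
      proof (rule mpoly_ideal_sum [OF M(1)])
        fix i assume "i \<in> {..d + e} - {d}"
        \<comment> \<open>Every product in degree d + e except the one of the two lowest components
          has a factor below the minimal degree, hence in \<open>M\<close>. So the remaining product
          is in \<open>M\<close> too, against primality.\<close>
        then consider "i < d" | "d + e - i < e" by fastforce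
        then show "?F i \<in> M"
          proof cases
          case 1
          then show ?thesis
            using MD(4) [OF comp [OF fg(2), of "d + e - i"] d2 [of i]] by (simp add: mult.commute)
        next
          case 2
          then show ?thesis by (intro MD(4) comp fg e2)
        qed
      qed
      moreover have "hom_comp (d + e) (f * g) \<in> M" using fg by (simp add: P_def)
      moreover have "?F d = hom_comp (d + e) (f * g) - (\<Sum>i\<in> {..d + e} - {d}. ?F i)"
        using calculation(1) by simp
      ultimately have "?F d \<in> M" by (simp only: MD(6))
      then show False using prime d1 e1 comp [OF fg(1)] comp [OF fg(2)] by auto
    qed
  qed (auto simp: idl mpoly_ring_cring)
  then show ?thesis by (rule that [OF _ hom nin sub])
qed

text \<open>By the pigeonhole principle, a monomial of sufficiently high degree is divisible by one
  of the powers X_i^(k_i) in \<open>A\<close>.\<close>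

lemma forms_in_ideal_of_powers:
  fixes A :: "'k::field mpoly set"
  assumes A: "ideal A (mpoly_ring n)" and pow: "\<And>i. i \<le> n \<Longrightarrow> \<exists>k. indet i ^ k \<in> A"
  obtains N where "\<And>d. N \<le> d \<Longrightarrow> forms n d \<subseteq> A"
proof -
  obtain k where k: "\<And>i. i \<le> n \<Longrightarrow> indet i ^ k i \<in> A" using pow by metis
  \<comment> \<open>A degree above the sum of the \<open>k i\<close> excludes that every exponent is
    below its \<open>k i\<close>.\<close>
  define N where "N = Suc (\<Sum>i\<le>n. k i)"
  have "f \<in> A" if f: "f \<in> forms n d" and d: "N \<le> d" for f d
  proof (rule mpoly_induct [where f = f])
    fix t :: "nat \<Rightarrow>\<^sub>0 nat" and c :: 'k assume "t \<in> Poly_Mapping.keys f"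
    then have t: "Poly_Mapping.keys t \<subseteq> {..n}" "mon_deg t = d" using f by (auto simp: forms_def mpolys_iff)
    have "\<exists>i\<le>n. k i \<le> Poly_Mapping.lookup t i"
    proof (rule ccontr)
      assume "\<not> ?thesis"
      then have "(\<Sum>i\<le>n. Poly_Mapping.lookup t i) \<le> (\<Sum>i\<le>n. k i)"
        by (intro sum_mono) (meson atMost_iff less_imp_le not_le)
      then show False using d t mon_deg_eq_sum [of "{..n}" t] by (simp add: N_def)
    qed
    then obtain i where i: "i \<le> n" "k i \<le> Poly_Mapping.lookup t i" by blast
    then obtain s where s: "t = s + Poly_Mapping.single i (k i)" using monom_split by blast
    then have "Poly_Mapping.single t c = Poly_Mapping.single s c * indet i ^ k i"
      by (simp add: indet_power mult_single)
    moreover have "Poly_Mapping.single s c \<in> mpolys n"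
      using t s by (intro mpolys_single) (auto simp: keys_add_nat)
    ultimately show "Poly_Mapping.single t c \<in> A"
      using k [OF i(1)] mpoly_idealD(4) [OF A] by simp
  qed (use mpoly_idealD [OF A] in auto)
  then show ?thesis using that by blast
qed

text \<open>Let A = I + (X_0). If \<open>A\<close> contained no power of some X_i, a homogeneous
  prime over \<open>A\<close> without X_i would be a point of the support on X_0 = 0. So
  \<open>A\<close> contains all forms of high degree: multiplication by x_0 is onto there.\<close>

lemma forms_mod_indet_0:
  fixes I :: "'k::field mpoly set"
  assumes I: "homogeneous_ideal n I" and supp: "\<forall>P\<in>support n I. indet 0 \<notin> P"
  obtains N where "\<And>d f. N \<le> d \<Longrightarrow> f \<in> forms n (Suc d) \<Longrightarrow> \<exists>q\<in>forms n d. f - indet 0 * q \<in> I"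
proof -
  note ID = mpoly_idealD [OF homogeneous_idealD(1) [OF I]]
  define A :: "'k mpoly set" where "A = {p + indet 0 * q | p q. p \<in> I \<and> q \<in> mpolys n}"
  have x0: "(indet 0 :: 'k mpoly) \<in> forms n 1" by (rule forms_indet) simp
  have AI: "p + indet 0 * q \<in> A" if "p \<in> I" "q \<in> mpolys n" for p q using that A_def by blast
  have idl: "ideal A (mpoly_ring n)"
  proof (rule mpoly_idealI)
    show "A \<subseteq> mpolys n" using ID(1) by (auto simp: A_def)
    show "0 \<in> A" using AI [of 0 0] ID(2) by simp
    show "p + q \<in> A" if pq: "p \<in> A" "q \<in> A" for p q
    proof -
      obtain a b c d where *: "p = a + indet 0 * b" "q = c + indet 0 * d" "a \<in> I" "c \<in> I" "b \<in> mpolys n" "d \<in> mpolys n"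
        using pq unfolding A_def by blast
      then show ?thesis using AI [of "a + c" "b + d"] ID(3) by (simp add: algebra_simps)
    qed
    show "h * p \<in> A" if hp: "h \<in> mpolys n" "p \<in> A" for h p
    proof -
      obtain a b where "p = a + indet 0 * b" "a \<in> I" "b \<in> mpolys n"
        using hp unfolding A_def by blast
      then show ?thesis using AI [of "h * a" "h * b"] ID(4) [of h a] hp by (simp add: algebra_simps)
    qed
  qed
  \<comment> \<open>This serves twice: it makes \<open>A\<close> homogeneous, and it yields a
    cofactor of X_0 that is itself a form of degree d - 1.\<close>
  have comp: "\<exists>p\<in>I. \<exists>q\<in>mpolys n. (d \<noteq> 0 \<longrightarrow> q \<in> forms n (d - 1)) \<and> hom_comp d f = p + indet 0 * q"
    if f: "f \<in> A" for d f
  proof -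
    obtain p q where pq: "f = p + indet 0 * q" "p \<in> I" "q \<in> mpolys n"
      using f A_def by blast
    have "hom_comp d f = hom_comp d p + indet 0 * (if 1 \<le> d then hom_comp (d - 1) q else 0)"
      using hom_comp_form_mult [OF x0, of d q] by (simp add: pq hom_comp_add)
    then show ?thesis
      using pq homogeneous_idealD(2) [OF I] formsD [OF hom_comp_forms [OF pq(3)]]
      by (intro bexI [of _ "hom_comp d p"] bexI [of _ "if 1 \<le> d then hom_comp (d - 1) q else 0"]) auto
  qed
  have hom: "homogeneous_ideal n A"
    unfolding homogeneous_ideal_def using idl comp AI by metis
  have "\<exists>k. indet i ^ k \<in> A" if i: "i \<le> n" for i
  proof (rule ccontr)
    assume "\<not> ?thesis"
    then have nin: "indet i ^ k \<notin> A" for k by simp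
    obtain P where P: "primeideal P (mpoly_ring n)" "homogeneous_ideal n P" "indet i \<notin> P" "A \<subseteq> P"
      by (rule exists_homogeneous_prime [OF hom i nin])
    have "I \<subseteq> A" using AI [of _ 0] by auto
    then have "P \<in> support n I" using P i by (auto simp: support_def)
    moreover have "indet 0 \<in> P" using AI [of 0 1] ID(2) P(4) by auto
    ultimately show False using supp by blast
  qed
  then obtain N where N: "\<And>d. N \<le> d \<Longrightarrow> forms n d \<subseteq> A"
    using forms_in_ideal_of_powers [OF idl] by blast
  have "\<exists>q\<in>forms n d. f - indet 0 * q \<in> I" if "N \<le> d" "f \<in> forms n (Suc d)" for d f
  proof -
    have "f \<in> A" using N [of "Suc d"] that by auto
    from comp [OF this, of "Suc d"] obtain p q where "p \<in> I" "q \<in> forms n d" "hom_comp (Suc d) f = p + indet 0 * q"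
      by auto
    then have "f - indet 0 * q \<in> I" using hom_comp_of_form [OF that(2), of "Suc d"] by simp
    then show ?thesis using \<open>q \<in> forms n d\<close> by blast
  qed
  then show ?thesis using that by blast
qed

subsection \<open>Hilbert functions\<close>

lemma (in vectorspace) dim_subset_le:
  assumes "vectorspace K (V\<lparr>carrier := W\<rparr>)" "W \<subseteq> carrier V" "fin_dim"
    "vectorspace.fin_dim K (V\<lparr>carrier := W\<rparr>)"
  shows "vectorspace.dim K (V\<lparr>carrier := W\<rparr>) \<le> dim"
proof -
  interpret W: vectorspace K "V\<lparr>carrier := W\<rparr>" by (rule assms(1))
  have "subspace K W V"
    unfolding subspace_def
    using W.M.add.m_closed W.M.zero_closed W.smult_closed assms(2)
    by (auto intro!: submodule.intro vectorspace_axioms module_axioms)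
  then show ?thesis using subspace_dim assms by simp
qed

abbreviation residue :: "nat \<Rightarrow> 'k::field mpoly set \<Rightarrow> 'k mpoly \<Rightarrow> 'k mpoly set"
  where "residue n I f \<equiv> I +>\<^bsub>mpoly_ring n\<^esub> f"

lemma residue_eq_iff:
  fixes I :: "'k::field mpoly set"
  assumes I: "ideal I (mpoly_ring n)"
  shows "residue n I f = residue n I g \<longleftrightarrow> f - g \<in> I"
proof -
  note D = mpoly_idealD [OF I]
  have eq: "residue n I f = {h + f | h. h \<in> I}" for f
    by (auto simp: a_r_coset_def')
  show ?thesis
  proof
    assume "residue n I f = residue n I g"
    moreover have "f \<in> residue n I f" using D(2) unfolding eq by force
    ultimately show "f - g \<in> I" unfolding eq by auto
  next
    have sub: "residue n I f \<subseteq> residue n I g" if fg: "f - g \<in> I" for f g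
    proof
      fix x assume "x \<in> residue n I f"
      then obtain h where h: "h \<in> I" "x = h + f" unfolding eq by auto
      then have "x = (h + (f - g)) + g" by simp
      then show "x \<in> residue n I g" unfolding eq using D(3) [OF h(1) fg] by blast
    qed
    assume "f - g \<in> I"
    moreover from this have "g - f \<in> I" using D(5) [of "f - g"] by simp
    ultimately show "residue n I f = residue n I g" using sub by blast
  qed
qed

lemma residue_zero:
  assumes I: "ideal I (mpoly_ring n)"
  shows "residue n I 0 = I"
  by (auto simp: a_r_coset_def')

lemma residue_eq_zero_iff:
  assumes I: "ideal I (mpoly_ring n)"
  shows "residue n I f = I \<longleftrightarrow> f \<in> I"
  using residue_eq_iff [OF I, of f 0] residue_zero [OF I] by simp

lemma coord_ring_simps:
  fixes I :: "'k::field mpoly set"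
  assumes I: "ideal I (mpoly_ring n)"
  shows "carrier (coord_ring n I) = residue n I ` mpolys n"
    "\<zero>\<^bsub>coord_ring n I\<^esub> = I"
    "\<one>\<^bsub>coord_ring n I\<^esub> = residue n I 1"
    "f \<in> mpolys n \<Longrightarrow> g \<in> mpolys n \<Longrightarrow>
      residue n I f \<oplus>\<^bsub>coord_ring n I\<^esub> residue n I g = residue n I (f + g)"
    "f \<in> mpolys n \<Longrightarrow> g \<in> mpolys n \<Longrightarrow>
      residue n I f \<otimes>\<^bsub>coord_ring n I\<^esub> residue n I g = residue n I (f * g)"
proof -
  interpret ideal I "mpoly_ring n :: 'k mpoly ring" by (rule I)
  show "carrier (coord_ring n I) = residue n I ` mpolys n"
    by (auto simp: coord_ring_def FactRing_def A_RCOSETS_def')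
  show "\<zero>\<^bsub>coord_ring n I\<^esub> = I" "\<one>\<^bsub>coord_ring n I\<^esub> = residue n I 1"
    by (simp_all add: coord_ring_def FactRing_def)
  show "residue n I f \<oplus>\<^bsub>coord_ring n I\<^esub> residue n I g = residue n I (f + g)"
    if "f \<in> mpolys n" "g \<in> mpolys n"
    using a_rcos_sum [OF that] by (simp add: coord_ring_def FactRing_def)
  show "residue n I f \<otimes>\<^bsub>coord_ring n I\<^esub> residue n I g = residue n I (f * g)"
    if "f \<in> mpolys n" "g \<in> mpolys n"
    using rcoset_mult_add [OF that] by (simp add: coord_ring_def FactRing_def)
qed

lemma cring_coord_ring:
  assumes "ideal I (mpoly_ring n)" shows "cring (coord_ring n I)"
  unfolding coord_ring_def using ideal.quotient_is_cring [OF assms mpoly_ring_cring] .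

lemma vector_space_mpoly: "vector_space (\<lambda>c (f :: 'k::field mpoly). const c * f)"
  by unfold_locales (simp_all add: algebra_simps const_add const_mult)

text \<open>Natural generators come as an indexed family. Injectivity of the indexing lets the
  coefficients be carried over to the set of its values.\<close>

lemma finite_family_generates:
  assumes "finite A" "inj_on b A" "b ` A \<subseteq> U" "\<And>u. u \<in> U \<Longrightarrow> \<exists>c. u = (\<Sum>a\<in>A. sc (c a) (b a))"
  shows "\<exists>B. finite B \<and> B \<subseteq> U \<and> (\<forall>u\<in>U. \<exists>c. u = (\<Sum>x\<in>B. sc (c x) x))"
proof (rule exI [of _ "b ` A"], intro conjI ballI)
  fix u assume "u \<in> U"
  then obtain c where "u = (\<Sum>a\<in>A. sc (c a) (b a))" using assms(4) by blast
  also have "\<dots> = (\<Sum>x\<in>b ` A. sc (c (inv_into A b x)) x)"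
    using assms(2) by (simp add: sum.reindex)
  finally show "\<exists>c. u = (\<Sum>x\<in>b ` A. sc (c x) x)"
    by (intro exI [of _ "\<lambda>x. c (inv_into A b x)"])
qed (use assms in auto)

lemma form_eq_sum:
  assumes "f \<in> forms n d"
  shows "f = (\<Sum>t | Poly_Mapping.keys t \<subseteq> {..n} \<and> mon_deg t = d.
    const (Poly_Mapping.lookup f t) * Poly_Mapping.single t 1)"
proof -
  have "Poly_Mapping.keys f \<subseteq> {t. Poly_Mapping.keys t \<subseteq> {..n} \<and> mon_deg t = d}"
    using assms by (auto simp: forms_def mpolys_iff)
  then have "(\<Sum>t\<in>Poly_Mapping.keys f. Poly_Mapping.single t (Poly_Mapping.lookup f t)) =
    (\<Sum>t | Poly_Mapping.keys t \<subseteq> {..n} \<and> mon_deg t = d. Poly_Mapping.single t (Poly_Mapping.lookup f t))"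
    using finite_monomials by (intro sum.mono_neutral_left) (auto simp: in_keys_iff)
  then show ?thesis by (subst mpoly_eq_sum) (simp add: const_mult_single)
qed

lemma inj_monomial: "inj (\<lambda>t. Poly_Mapping.single t (1 :: 'k::field))"
proof
  fix s t :: 'a assume "Poly_Mapping.single s (1 :: 'k) = Poly_Mapping.single t 1"
  then have "Poly_Mapping.keys (Poly_Mapping.single s (1 :: 'k)) = Poly_Mapping.keys (Poly_Mapping.single t (1::'k))"
    by simp
  then show "s = t" by simp
qed

lemma forms_generated:
  fixes n d :: nat
  defines "U \<equiv> forms n d :: 'k::field mpoly set"
  shows "\<exists>B. finite B \<and> B \<subseteq> U \<and> (\<forall>u\<in>U. \<exists>c. u = (\<Sum>x\<in>B. const (c x) * x))"
  unfolding U_def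
proof (rule finite_family_generates [OF finite_monomials])
  show "inj_on (\<lambda>t. Poly_Mapping.single t (1 :: 'k)) {t. Poly_Mapping.keys t \<subseteq> {..n} \<and> mon_deg t = d}"
    by (rule inj_on_subset [OF inj_monomial subset_UNIV])
  show "(\<lambda>t. Poly_Mapping.single t (1 :: 'k)) ` {t. Poly_Mapping.keys t \<subseteq> {..n} \<and> mon_deg t = d} \<subseteq> forms n d"
    by (auto simp: forms_def mpolys_iff)
  fix u :: "'k mpoly" assume "u \<in> forms n d"
  then show "\<exists>c. u = (\<Sum>t | Poly_Mapping.keys t \<subseteq> {..n} \<and> mon_deg t = d. const (c t) * Poly_Mapping.single t 1)"
    by (intro exI [of _ "Poly_Mapping.lookup u"] form_eq_sum)
qed

definition comp_space :: "nat \<Rightarrow> 'k::field mpoly set \<Rightarrow> nat \<Rightarrow> ('k, 'k mpoly set) module"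
  where "comp_space n I i =
    (restrict_scalars (coord_const n I) (regular_module (coord_ring n I)))\<lparr>carrier := coord_comp n I i\<rparr>"

lemma HF_eq: "HF n I i = vectorspace.dim scalars (comp_space n I i)"
  by (simp add: HF_def subspace_dim_def comp_space_def)

lemma comp_space_simps:
  "carrier (comp_space n I i) = residue n I ` forms n i"
  "\<zero>\<^bsub>comp_space n I i\<^esub> = \<zero>\<^bsub>coord_ring n I\<^esub>"
  "A \<oplus>\<^bsub>comp_space n I i\<^esub> B = A \<oplus>\<^bsub>coord_ring n I\<^esub> B"
  "c \<odot>\<^bsub>comp_space n I i\<^esub> A = residue n I (const c) \<otimes>\<^bsub>coord_ring n I\<^esub> A"
  by (simp_all add: comp_space_def restrict_scalars_def regular_module_def coord_comp_def coord_const_def)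

text \<open>With \<open>h = 1\<close> this presents R_i, and with \<open>h = indet 0\<close> the
  image of multiplication by x_0. Overwriting the carrier keeps the operations of R, which are the
  same in all degrees.\<close>

lemma linear_cover_forms_mult:
  fixes I :: "'k::field mpoly set"
  assumes I: "ideal I (mpoly_ring n)" and h: "h \<in> mpolys n"
  shows "linear_cover (\<lambda>c f. const c * f) (forms n i)
    ((comp_space n I j)\<lparr>carrier := (\<lambda>f. residue n I (h * f)) ` forms n i\<rparr>) (\<lambda>f. residue n I (h * f))"
proof (rule linear_cover.intro)
  have hf: "h * f \<in> mpolys n" if "f \<in> forms n i" for f using that h formsD by blast
  show "residue n I (h * (u + v)) =
      residue n I (h * u) \<oplus>\<^bsub>(comp_space n I j)\<lparr>carrier := (\<lambda>f. residue n I (h * f)) ` forms n i\<rparr>\<^esub> residue n I (h * v)"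
    if "u \<in> forms n i" "v \<in> forms n i" for u v
    using that hf by (simp add: comp_space_simps coord_ring_simps [OF I] distrib_left)
  show "residue n I (h * (const c * u)) =
      c \<odot>\<^bsub>(comp_space n I j)\<lparr>carrier := (\<lambda>f. residue n I (h * f)) ` forms n i\<rparr>\<^esub> residue n I (h * u)"
    if "u \<in> forms n i" for c u
    using that hf by (simp add: comp_space_simps coord_ring_simps [OF I] mult.left_commute)
qed (auto simp: vector_space_mpoly comp_space_simps coord_ring_simps [OF I] residue_zero [OF I] forms_generated)

lemma linear_cover_forms:
  assumes I: "ideal I (mpoly_ring n)"
  shows "linear_cover (\<lambda>c f. const c * f) (forms n i) (comp_space n I i) (residue n I)"
proof -
  have "(comp_space n I i)\<lparr>carrier := residue n I ` forms n i\<rparr> = comp_space n I i"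
    by (simp add: comp_space_def coord_comp_def)
  then show ?thesis using linear_cover_forms_mult [OF I mpolys_one, of i i] by simp
qed

text \<open>The residue classes modulo \<open>J\<close> are a quotient of those modulo
  \<open>I\<close>. If the dimensions agree in degree \<open>d\<close>, the quotient map is
  injective there, which gives the second claim.\<close>

lemma HF_antimono:
  assumes I: "ideal I (mpoly_ring n)" and J: "ideal J (mpoly_ring n)" and IJ: "I \<subseteq> J"
  shows "HF n J d \<le> HF n I d"
    and "HF n J d = HF n I d \<Longrightarrow> f \<in> forms n d \<Longrightarrow> f \<in> J \<Longrightarrow> f \<in> I"
proof -
  interpret linear_cover2 "\<lambda>c f. const c * f" "forms n d" "comp_space n I d" "residue n I"
      "comp_space n J d" "residue n J"
    by (intro linear_cover2.intro linear_cover_forms I J linear_cover2_axioms.intro)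
      (use IJ in \<open>auto simp: comp_space_simps coord_ring_simps I J residue_eq_zero_iff\<close>)
  show "HF n J d \<le> HF n I d" using dim_le by (simp add: HF_eq)
  show "HF n J d = HF n I d \<Longrightarrow> f \<in> forms n d \<Longrightarrow> f \<in> J \<Longrightarrow> f \<in> I"
    using dim_eq_imp_ker [of f] by (simp add: HF_eq comp_space_simps coord_ring_simps I J residue_eq_zero_iff)
qed

context
  fixes n d :: nat and I :: "'k::field mpoly set"
  assumes I: "ideal I (mpoly_ring n)"
begin

definition indet_0_image :: "('k, 'k mpoly set) module"
  where "indet_0_image = (comp_space n I (Suc d))\<lparr>carrier := (\<lambda>f. residue n I (indet 0 * f)) ` forms n d\<rparr>"

lemma linear_cover_indet_0:
  "linear_cover (\<lambda>c f. const c * f) (forms n d) indet_0_image (\<lambda>f. residue n I (indet 0 * f))"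
  unfolding indet_0_image_def by (rule linear_cover_forms_mult [OF I]) auto

lemma indet_0_image_zero: "\<zero>\<^bsub>indet_0_image\<^esub> = I"
  by (simp add: indet_0_image_def comp_space_simps coord_ring_simps [OF I])

text \<open>By \<open>gen\<close>, multiplication by x_0 maps R_d onto R_(d+1). So the dimension
  cannot grow, and if it stays the same the multiplication is injective.\<close>

lemma HF_Suc_le:
  assumes gen: "\<And>f. f \<in> forms n (Suc d) \<Longrightarrow> \<exists>q\<in>forms n d. f - indet 0 * q \<in> I"
  shows "HF n I (Suc d) \<le> HF n I d"
    and "HF n I (Suc d) = HF n I d \<Longrightarrow> f \<in> forms n d \<Longrightarrow> indet 0 * f \<in> I \<Longrightarrow> f \<in> I"
proof -
  have "(\<lambda>f. residue n I (indet 0 * f)) ` forms n d = residue n I ` forms n (Suc d)"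
  proof (intro equalityI subsetI)
    fix x assume "x \<in> residue n I ` forms n (Suc d)"
    then obtain f where f: "f \<in> forms n (Suc d)" "x = residue n I f" by blast
    with gen obtain q where "q \<in> forms n d" "f - indet 0 * q \<in> I" by blast
    then show "x \<in> (\<lambda>f. residue n I (indet 0 * f)) ` forms n d"
      using f residue_eq_iff [OF I, of f "indet 0 * q"] by blast
  next
    fix x assume "x \<in> (\<lambda>f. residue n I (indet 0 * f)) ` forms n d"
    then show "x \<in> residue n I ` forms n (Suc d)"
      using forms_mult [OF forms_indet, of 0 n] by auto
  qed
  then have eq: "indet_0_image = comp_space n I (Suc d)"
    by (simp add: indet_0_image_def comp_space_def coord_comp_def)
  interpret linear_cover2 "\<lambda>c f. const c * f" "forms n d" "comp_space n I d" "residue n I"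
      indet_0_image "\<lambda>f. residue n I (indet 0 * f)"
    by (intro linear_cover2.intro linear_cover_forms linear_cover_indet_0 I linear_cover2_axioms.intro)
      (use mpoly_idealD(4) [OF I] in
        \<open>auto simp: comp_space_simps coord_ring_simps I residue_eq_zero_iff indet_0_image_zero\<close>)
  show "HF n I (Suc d) \<le> HF n I d" using dim_le by (simp add: HF_eq eq)
  show "HF n I (Suc d) = HF n I d \<Longrightarrow> f \<in> forms n d \<Longrightarrow> indet 0 * f \<in> I \<Longrightarrow> f \<in> I"
    using dim_eq_imp_ker [of f] indet_0_image_zero
    by (simp add: HF_eq comp_space_simps coord_ring_simps I residue_eq_zero_iff eq)
qed

text \<open>If multiplication by x_0 is injective on R_d, its image is a subspace of R_(d+1) at
  least as large as R_d.\<close>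

lemma HF_le_Suc:
  assumes nzd: "\<And>f. f \<in> forms n d \<Longrightarrow> indet 0 * f \<in> I \<Longrightarrow> f \<in> I"
  shows "HF n I d \<le> HF n I (Suc d)"
proof -
  \<comment> \<open>The covers are used in the opposite direction here: injectivity makes the
    assignment of f to x_0 f invertible, giving a surjection from x_0 R_d onto R_d.\<close>
  interpret linear_cover2 "\<lambda>c f. const c * f" "forms n d" indet_0_image "\<lambda>f. residue n I (indet 0 * f)"
      "comp_space n I d" "residue n I"
    by (intro linear_cover2.intro linear_cover_forms linear_cover_indet_0 I linear_cover2_axioms.intro)
      (use nzd in \<open>auto simp: comp_space_simps coord_ring_simps I residue_eq_zero_iff indet_0_image_zero\<close>)
  interpret C: linear_cover "\<lambda>c f. const c * f" "forms n (Suc d)" "comp_space n I (Suc d)" "residue n I"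
    by (rule linear_cover_forms [OF I])
  have "(\<lambda>f. residue n I (indet 0 * f)) ` forms n d \<subseteq> carrier (comp_space n I (Suc d))"
    using forms_mult [OF forms_indet, of 0 n] by (auto simp: comp_space_simps)
  then have "vectorspace.dim scalars indet_0_image \<le> vectorspace.dim scalars (comp_space n I (Suc d))"
    using vectorspace.dim_subset_le [OF C.vectorspace _ _ C.fin_dim] V.vectorspace V.fin_dim
    unfolding indet_0_image_def by blast
  with dim_le show ?thesis by (simp add: HF_eq)
qed

end

section \<open>Schemes away from the hyperplane X_0 = 0\<close>

locale indet_0_avoiding =
  fixes n :: nat and I :: "'k::field mpoly set"
  assumes closed: "closed_subscheme n I" and avoids: "\<forall>P\<in>support n I. indet 0 \<notin> P"
begin

lemma homogeneous: "homogeneous_ideal n I" and saturated: "saturated n I"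
  using closed by (auto simp: closed_subscheme_def)

lemmas is_ideal = homogeneous_idealD(1) [OF homogeneous]
lemmas idealD = mpoly_idealD [OF is_ideal]

text \<open>Where multiplication by x_0 is onto, the Hilbert function does not increase. Being a
  sequence of natural numbers it becomes constant, and from then on the surjections are
  injective.\<close>

lemma eventually_injective:
  "\<exists>N. (\<forall>i\<ge>N. HF n I i = HF n I N) \<and> (\<forall>i\<ge>N. \<forall>f\<in>forms n i. indet 0 * f \<in> I \<longrightarrow> f \<in> I)"
proof -
  obtain M where M: "\<And>d f. M \<le> d \<Longrightarrow> f \<in> forms n (Suc d) \<Longrightarrow> \<exists>q\<in>forms n d. f - indet 0 * q \<in> I"
    using forms_mod_indet_0 [OF homogeneous avoids] by metis
  \<comment> \<open>The least value from \<open>M\<close> on. Once reached, at \<open>N\<close>, it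
    cannot be left, as the function neither rises nor falls below it.\<close>
  define m where "m = (LEAST m. \<exists>i\<ge>M. HF n I i = m)"
  have "\<exists>i\<ge>M. HF n I i = m" unfolding m_def by (rule LeastI_ex) blast
  then obtain N where N: "N \<ge> M" "HF n I N = m" by blast
  have min: "m \<le> HF n I i" if "i \<ge> M" for i
    unfolding m_def by (rule Least_le) (use that in blast)
  have const: "HF n I i = HF n I N" if "N \<le> i" for i
    using that
  proof (induction i rule: dec_induct)
    case (step i)
    then have "HF n I (Suc i) \<le> HF n I i" using N M by (intro HF_Suc_le is_ideal) auto
    then show ?case using step N min [of "Suc i"] by simp
  qed simp
  have "f \<in> I" if "N \<le> i" "f \<in> forms n i" "indet 0 * f \<in> I" for i f
  proof (rule HF_Suc_le(2) [OF is_ideal, of i])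
    show "HF n I (Suc i) = HF n I i" using const [of i] const [of "Suc i"] that by simp
  qed (use that N M in auto)
  with const show ?thesis by (intro exI [of _ N] conjI allI impI ballI)
qed

text \<open>If x_0 kills the class of \<open>f\<close>, it kills the class of \<open>g * f\<close>
  for every form \<open>g\<close> of degree \<open>N\<close>. These products lie in degrees where
  x_0 acts injectively, so they are in \<open>I\<close>, and saturation puts \<open>f\<close> into
  \<open>I\<close>.\<close>

lemma indet_0_mult_in_iff:
  assumes "f \<in> forms n d" shows "indet 0 * f \<in> I \<longleftrightarrow> f \<in> I"
proof
  assume in_I: "indet 0 * f \<in> I"
  obtain N where N: "\<And>i f. N \<le> i \<Longrightarrow> f \<in> forms n i \<Longrightarrow> indet 0 * f \<in> I \<Longrightarrow> f \<in> I"
    using eventually_injective by blast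
  have "g * f \<in> I" if g: "g \<in> forms n N" for g
  proof (rule N)
    show "g * f \<in> forms n (N + d)" using g assms by (rule forms_mult)
    show "indet 0 * (g * f) \<in> I"
      using idealD(4) [OF formsD [OF g] in_I] by (simp add: mult.left_commute)
  qed simp
  then show "f \<in> I" using saturated formsD [OF assms] unfolding saturated_def by blast
qed (rule idealD(4), auto)

lemma indet_0_power_mult_in_iff:
  assumes "f \<in> forms n d" shows "indet 0 ^ k * f \<in> I \<longleftrightarrow> f \<in> I"
proof (induction k)
  case (Suc k)
  have "indet 0 ^ k * f \<in> forms n (k + d)" using assms by (intro forms_mult forms_indet_power) auto
  then show ?case using Suc by (simp add: indet_0_mult_in_iff mult.assoc)
qed simp

lemma HF_mono: "i \<le> j \<Longrightarrow> HF n I i \<le> HF n I j"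
proof (induction j rule: dec_induct)
  case (step j)
  then show ?case using HF_le_Suc [OF is_ideal, of j] indet_0_mult_in_iff by (meson order_trans)
qed simp

text \<open>An eventual value of a sequence is unique, so \<open>THE\<close> in the definition of
  the degree denotes the constant that the Hilbert function reaches.\<close>

lemma scheme_degree_ev: "\<exists>N. \<forall>i\<ge>N. HF n I i = scheme_degree n I"
proof -
  obtain N where N: "\<forall>i\<ge>N. HF n I i = HF n I N"
    using eventually_injective by auto
  then have ev: "eventually (\<lambda>i. HF n I i = HF n I N) sequentially"
    unfolding eventually_sequentially by blast
  have "scheme_degree n I = HF n I N"
    unfolding scheme_degree_def
  proof (rule the_equality)
    show "eventually (\<lambda>i. HF n I i = HF n I N) sequentially" by (rule ev)
    fix c assume "eventually (\<lambda>i. HF n I i = c) sequentially"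
    with ev have "eventually (\<lambda>i. c = HF n I N) sequentially" by eventually_elim simp
    then show "c = HF n I N" by simp
  qed
  with N show ?thesis by metis
qed

lemma HF_le_scheme_degree: "HF n I i \<le> scheme_degree n I"
  using scheme_degree_ev HF_mono by (metis nat_le_linear)

lemma HF_eq_scheme_degree: "regularity_index n I \<le> i \<Longrightarrow> HF n I i = scheme_degree n I"
  using LeastI_ex [OF scheme_degree_ev] unfolding regularity_index_def by blast

text \<open>Points of a subscheme are points of the scheme and avoid the hyperplane as well. The
  empty subscheme, given by the unit ideal, is included.\<close>

lemma subscheme: "subscheme_of n J I \<Longrightarrow> indet_0_avoiding n J"
  using avoids by unfold_locales (auto simp: subscheme_of_def support_def)

end

subsection \<open>Jacobian relations\<close>

text \<open>For an ideal \<open>I\<close> of P this is the submodule generated by I e_j for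
  \<open>j \<le> n\<close> and by the gradients of elements of \<open>I\<close>, built up one
  generator at a time. Only gradients carry a multiplier \<open>h\<close>, since \<open>I\<close>
  absorbs multiplication. It turns out to be the kernel of the map sending x to the sum of the x_j
  dx_j.\<close>

inductive_set jacobian_relations :: "nat \<Rightarrow> 'k::field mpoly set \<Rightarrow> (nat \<Rightarrow> 'k mpoly) set"
  for n I where
  zero: "(\<lambda>i. 0) \<in> jacobian_relations n I"
| ideal: "x \<in> jacobian_relations n I \<Longrightarrow> f \<in> I \<Longrightarrow> j \<le> n \<Longrightarrow>
    (\<lambda>i. (if i = j then f else 0) + x i) \<in> jacobian_relations n I"
| grad: "x \<in> jacobian_relations n I \<Longrightarrow> f \<in> I \<Longrightarrow> h \<in> mpolys n \<Longrightarrow>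
    (\<lambda>i. h * partial i f + x i) \<in> jacobian_relations n I"

lemma jacobian_relations_mono:
  assumes "I \<subseteq> J" "x \<in> jacobian_relations n I" shows "x \<in> jacobian_relations n J"
  using assms(2) by induction (use assms(1) in \<open>auto intro: jacobian_relations.intros\<close>)

context
  fixes n :: nat and I :: "'k::field mpoly set"
  assumes I: "ideal I (mpoly_ring n)"
begin

lemma jacobian_relations_add:
  assumes "x \<in> jacobian_relations n I" "y \<in> jacobian_relations n I"
  shows "(\<lambda>i. x i + y i) \<in> jacobian_relations n I"
  using assms
proof induction
  case (ideal x f j)
  then show ?case
    using jacobian_relations.ideal [of "\<lambda>i. x i + y i" n I f j] by (simp add: add.assoc)
next
  case (grad x f h)
  then show ?case
    using jacobian_relations.grad [of "\<lambda>i. x i + y i" n I f h] by (simp add: add.assoc)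
qed simp

lemma jacobian_relations_mult:
  assumes "x \<in> jacobian_relations n I" "g \<in> mpolys n"
  shows "(\<lambda>i. g * x i) \<in> jacobian_relations n I"
  using assms
proof induction
  case zero
  then show ?case by (simp add: jacobian_relations.zero)
next
  case (ideal x f j)
  have "(\<lambda>i. g * ((if i = j then f else 0) + x i)) = (\<lambda>i. (if i = j then g * f else 0) + g * x i)"
    by (auto simp: distrib_left)
  then show ?case
    using jacobian_relations.ideal [of "\<lambda>i. g * x i" n I "g * f" j] ideal mpoly_idealD(4) [OF I] by simp
next
  case (grad x f h)
  then show ?case
    using jacobian_relations.grad [of "\<lambda>i. g * x i" n I f "g * h"]
    by (simp add: distrib_left mult.assoc)
qed

lemma jacobian_relations_diff:
  assumes "x \<in> jacobian_relations n I" "y \<in> jacobian_relations n I"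
  shows "(\<lambda>i. x i - y i) \<in> jacobian_relations n I"
  using jacobian_relations_add [OF assms(1) jacobian_relations_mult [OF assms(2), of "- 1"]] by simp

lemma jacobian_relations_sum:
  assumes "\<And>a. a \<in> S \<Longrightarrow> x a \<in> jacobian_relations n I"
  shows "(\<lambda>i. \<Sum>a\<in>S. x a i) \<in> jacobian_relations n I"
  using assms
  by (induction S rule: infinite_finite_induct)
    (auto simp: jacobian_relations.zero intro: jacobian_relations_add)

lemma jacobian_relations_grad:
  assumes "f \<in> I" shows "(\<lambda>i. partial i f) \<in> jacobian_relations n I"
  using jacobian_relations.grad [OF jacobian_relations.zero assms mpolys_one] by simp

lemma jacobian_relations_vector:
  assumes "\<And>i. i \<le> n \<Longrightarrow> x i \<in> I" "\<And>i. n < i \<Longrightarrow> x i = 0"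
  shows "x \<in> jacobian_relations n I"
proof -
  have "(\<lambda>i. \<Sum>j\<le>n. if i = j then x j else 0) \<in> jacobian_relations n I"
  proof (rule jacobian_relations_sum)
    fix j assume "j \<in> {..n}"
    then show "(\<lambda>i. if i = j then x j else 0) \<in> jacobian_relations n I"
      using jacobian_relations.ideal [OF jacobian_relations.zero assms(1), of j j] by simp
  qed
  also have "(\<lambda>i. \<Sum>j\<le>n. if i = j then x j else 0) = x"
    using assms(2) by (auto simp: not_le)
  finally show ?thesis .
qed

end

lemma partial_sum: "partial j (sum f A) = (\<Sum>a\<in>A. partial j (f a))"
  by (induction A rule: infinite_finite_induct) (auto simp: partial_add)

text \<open>The contraction with the Euler vector field sends \<open>df\<close> to \<open>deg f \<cdot> f\<close>.\<close>

lemma jacobian_relations_euler: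
  assumes I: "homogeneous_ideal n I" and x: "x \<in> jacobian_relations n I"
  shows "(\<Sum>j\<le>n. indet j * x j) \<in> I"
proof -
  note D = mpoly_idealD [OF homogeneous_idealD(1) [OF I]]
  have grad: "(\<Sum>j\<le>n. indet j * partial j f) \<in> I" if f: "f \<in> I" for f
  proof -
    \<comment> \<open>Euler's formula applies to forms only. The components of \<open>f\<close>
      remain in \<open>I\<close> by homogeneity, so the contraction of its gradient is a combination
      of elements of \<open>I\<close>.\<close>
    obtain D where f_eq: "f = (\<Sum>i\<le>D. hom_comp i f)" using sum_hom_comp by blast
    have "(\<Sum>j\<le>n. indet j * partial j f) = (\<Sum>j\<le>n. \<Sum>i\<le>D. indet j * partial j (hom_comp i f))"
      by (subst f_eq) (simp add: partial_sum sum_distrib_left)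
    also have "\<dots> = (\<Sum>i\<le>D. \<Sum>j\<le>n. indet j * partial j (hom_comp i f))"
      by (rule sum.swap)
    also have "\<dots> = (\<Sum>i\<le>D. const (of_nat i) * hom_comp i f)"
      using euler_formula [OF hom_comp_forms [OF D(1) [OF f]]] by (simp add: const_of_nat)
    also have "\<dots> \<in> I"
      by (intro mpoly_ideal_sum [OF homogeneous_idealD(1) [OF I]] D(4) homogeneous_idealD(2) [OF I] f mpolys_const)
    finally show ?thesis .
  qed
  from x show ?thesis
  proof induction
    case zero
    then show ?case by (simp add: D(2))
  next
    case (ideal x f j)
    have "(\<Sum>i\<le>n. indet i * ((if i = j then f else 0) + x i)) =
        (\<Sum>i\<le>n. if i = j then indet j * f else 0) + (\<Sum>i\<le>n. indet i * x i)"
      unfolding sum.distrib [symmetric] by (intro sum.cong) (auto simp: distrib_left)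
    also have "\<dots> = indet j * f + (\<Sum>i\<le>n. indet i * x i)" using ideal by simp
    finally show ?case using ideal by (simp add: D(3,4))
  next
    case (grad x f h)
    have "(\<Sum>i\<le>n. indet i * (h * partial i f + x i)) =
        h * (\<Sum>i\<le>n. indet i * partial i f) + (\<Sum>i\<le>n. indet i * x i)"
      by (simp add: distrib_left sum.distrib sum_distrib_left mult.left_commute)
    then show ?case using grad \<open>\<And>f. f \<in> I \<Longrightarrow> (\<Sum>j\<le>n. indet j * partial j f) \<in> I\<close> by (simp add: D(3,4))
  qed
qed

text \<open>With e_j in degree 1, the part of a relation in degree \<open>d\<close> involves only
  components of elements of \<open>J\<close> of degree at most \<open>d\<close>, and these lie in
  \<open>I\<close>.\<close>

lemma jacobian_relations_shifted_comp:
  assumes I: "homogeneous_ideal n I" and J: "homogeneous_ideal n J"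
    and IJ: "\<And>k f. k \<le> d \<Longrightarrow> f \<in> forms n k \<Longrightarrow> f \<in> J \<Longrightarrow> f \<in> I"
    and x: "x \<in> jacobian_relations n J"
  shows "(\<lambda>i. shifted_comp d (x i)) \<in> jacobian_relations n I"
proof -
  note JD = mpoly_idealD [OF homogeneous_idealD(1) [OF J]]
  note I' = homogeneous_idealD(1) [OF I]
  have comp: "hom_comp k f \<in> I" if "k \<le> d" "f \<in> J" for k f
    using IJ [OF that(1) hom_comp_forms [OF JD(1) [OF that(2)]] homogeneous_idealD(2) [OF J that(2)]] .
  from x show ?thesis
  proof induction
    case zero
    then show ?case by (simp add: jacobian_relations.zero)
  next
    case (ideal x f j)
    \<comment> \<open>The generator f e_j contributes the component of \<open>f\<close> of degree d
      - 1, or nothing if d = 0.\<close>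
    have "shifted_comp d f \<in> I"
      using comp [of "d - 1" f] ideal mpoly_idealD(2) [OF I'] by (simp add: shifted_comp_def)
    then have "(\<lambda>i. (if i = j then shifted_comp d f else 0) + shifted_comp d (x i)) \<in> jacobian_relations n I"
      using ideal by (intro jacobian_relations.ideal)
    moreover have "shifted_comp d ((if i = j then f else 0) + x i) =
        (if i = j then shifted_comp d f else 0) + shifted_comp d (x i)" for i
      by (simp add: shifted_comp_add)
    ultimately show ?case by simp
  next
    case (grad x f h)
    \<comment> \<open>Up to degree \<open>d\<close> the multiple of the gradient is a combination of
      gradients of components of \<open>f\<close>, each of which lies in \<open>I\<close>.\<close>
    have "(\<lambda>i. \<Sum>k\<le>d. hom_comp (d - k) h * partial i (hom_comp k f)) \<in> jacobian_relations n I"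
      using grad comp
      by (intro jacobian_relations_sum [OF I'] jacobian_relations_mult [OF I'] jacobian_relations_grad [OF I'])
        (auto intro: formsD)
    with grad show ?case
      by (simp add: shifted_comp_add shifted_comp_mult_partial jacobian_relations_add [OF I'])
  qed
qed

subsection \<open>Quotient modules and Kaehler differentials\<close>

text \<open>\<open>quot_module\<close> is a bare record; the lemmas of this locale supply
  computation with representatives of cosets and the module axioms.\<close>

locale quotient_of_module = module R M
  for R :: "'a ring" and M :: "('a, 'm) module" (structure) +
  fixes N :: "'m set"
  assumes submodule: "submodule R N M"
begin

interpretation N: submodule R N M by (rule submodule)

lemma abelian_subgroup: "abelian_subgroup N M"
proof (intro abelian_subgroupI3 additive_subgroupI)
  show "subgroup N (add_monoid M)"
  proof
    fix x assume x: "x \<in> N"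
    then have "\<ominus> x = (\<ominus>\<^bsub>R\<^esub> \<one>\<^bsub>R\<^esub>) \<odot> x"
      using N.subset by (intro smult_minus_1 [symmetric]) blast
    then have "\<ominus> x \<in> N" using x by simp
    then show "inv\<^bsub>add_monoid M\<^esub> x \<in> N" by (simp add: a_inv_def)
  qed (use N.subset in auto)
qed (rule M.abelian_group_axioms)

interpretation S: abelian_subgroup N M by (rule abelian_subgroup)

lemma coset_eq_iff:
  assumes "x \<in> carrier M" "y \<in> carrier M"
  shows "N +> x = N +> y \<longleftrightarrow> x \<ominus> y \<in> N"
proof -
  have "N +> x = N +> y \<longleftrightarrow> x \<in> N +> y"
    using S.a_repr_independence' S.a_repr_independenceD assms by metis
  also have "\<dots> \<longleftrightarrow> x \<ominus> y \<in> N"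
    using S.a_rcos_module assms by (simp add: a_minus_def)
  finally show ?thesis .
qed

lemma coset_eq_zero_iff: "x \<in> carrier M \<Longrightarrow> N +> x = N \<longleftrightarrow> x \<in> N"
  using S.a_rcos_self S.a_rcos_const by metis

lemma quot_carrier: "carrier (quot_module M N) = (\<lambda>x. N +> x) ` carrier M"
  by (auto simp: quot_module_def A_RCOSETS_def')

lemma quot_zero: "\<zero>\<^bsub>quot_module M N\<^esub> = N"
  by (simp add: quot_module_def)

lemma quot_add:
  "x \<in> carrier M \<Longrightarrow> y \<in> carrier M \<Longrightarrow>
    (N +> x) \<oplus>\<^bsub>quot_module M N\<^esub> (N +> y) = N +> (x \<oplus> y)"
  using S.a_rcos_sum by (simp add: quot_module_def)

text \<open>The definition takes a union over the coset. For y and x in the same coset, a(y - x)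
  lies in \<open>N\<close>, so the union is over equal cosets and has the value obtained from any
  one representative.\<close>

lemma quot_smult:
  assumes a: "a \<in> carrier R" and x: "x \<in> carrier M"
  shows "a \<odot>\<^bsub>quot_module M N\<^esub> (N +> x) = N +> (a \<odot> x)"
proof -
  have "N +> (a \<odot> y) = N +> (a \<odot> x)" if y: "y \<in> N +> x" for y
  proof -
    have yc: "y \<in> carrier M" using S.a_elemrcos_carrier [OF x y] .
    have "y \<ominus> x \<in> N" using y S.a_rcos_module [OF x yc] by (simp add: a_minus_def)
    then have "a \<odot> (y \<ominus> x) \<in> N" using a by simp
    moreover have "a \<odot> (y \<ominus> x) = a \<odot> y \<ominus> a \<odot> x"
      using a x yc by (simp add: a_minus_def smult_r_distr smult_r_minus)
    ultimately show ?thesis using a x yc by (simp add: coset_eq_iff)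
  qed
  moreover have "N +> x \<noteq> {}" using S.a_rcos_self [OF x] by auto
  ultimately have "(\<Union>y\<in>N +> x. N +> (a \<odot> y)) = N +> (a \<odot> x)"
    by (intro SUP_eq_const)
  then show ?thesis by (simp add: quot_module_def)
qed

lemma module_quot: "module R (quot_module M N)"
proof (rule module_criteria)
  show "\<forall>v\<in>carrier (quot_module M N). \<exists>w\<in>carrier (quot_module M N).
      v \<oplus>\<^bsub>quot_module M N\<^esub> w = \<zero>\<^bsub>quot_module M N\<^esub>"
  proof
    fix v assume "v \<in> carrier (quot_module M N)"
    then obtain x where x: "x \<in> carrier M" "v = N +> x" by (auto simp: quot_carrier)
    then have "v \<oplus>\<^bsub>quot_module M N\<^esub> (N +> (\<ominus> x)) = \<zero>\<^bsub>quot_module M N\<^esub>"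
      by (simp add: quot_add quot_zero coset_eq_zero_iff M.r_neg)
    with x show "\<exists>w\<in>carrier (quot_module M N). v \<oplus>\<^bsub>quot_module M N\<^esub> w = \<zero>\<^bsub>quot_module M N\<^esub>"
      by (auto simp: quot_carrier)
  qed
  have zero: "\<zero>\<^bsub>quot_module M N\<^esub> = N +> \<zero>"
    unfolding quot_zero by (rule coset_eq_zero_iff [THEN iffD2, symmetric]) auto
  then show "\<zero>\<^bsub>quot_module M N\<^esub> \<in> carrier (quot_module M N)"
    by (simp add: quot_carrier)
  show "\<forall>v\<in>carrier (quot_module M N). v \<oplus>\<^bsub>quot_module M N\<^esub> \<zero>\<^bsub>quot_module M N\<^esub> = v"
    unfolding zero by (auto simp: quot_carrier quot_add)
qed (auto simp: R.cring_axioms quot_carrier quot_add quot_smult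
    M.a_ac smult_assoc1 smult_l_distr smult_r_distr R.is_cring)

end

text \<open>The functions of finite support form a submodule of all functions, because the support
  of a sum lies in the union of the supports and scaling cannot enlarge a support.\<close>

lemma module_free_module:
  assumes "cring A" shows "module A (free_module A S)"
proof -
  interpret A: cring A by (rule assms)
  let ?N = "{f \<in> S \<rightarrow>\<^sub>E carrier A. finite {s \<in> S. f s \<noteq> \<zero>\<^bsub>A\<^esub>}}"
  interpret F: module A "A.func_space S" by (rule A.func_space_is_module)
  have "submodule A ?N (A.func_space S)"
  proof (rule submodule.intro)
    show "module A (A.func_space S)" by (rule A.func_space_is_module)
    show "?N \<subseteq> carrier (A.func_space S)" by (auto simp: A.func_space_def)
    show "\<zero>\<^bsub>A.func_space S\<^esub> \<in> ?N" by (auto simp: A.func_space_def)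
    fix v w assume vw: "v \<in> ?N" "w \<in> ?N"
    then have "finite {s \<in> S. v s \<oplus>\<^bsub>A\<^esub> w s \<noteq> \<zero>\<^bsub>A\<^esub>}"
      by (rule_tac finite_subset [of _ "{s \<in> S. v s \<noteq> \<zero>\<^bsub>A\<^esub>} \<union> {s \<in> S. w s \<noteq> \<zero>\<^bsub>A\<^esub>}"]) auto
    moreover have "{s \<in> S. (\<lambda>v'\<in>S. v v' \<oplus>\<^bsub>A\<^esub> w v') s \<noteq> \<zero>\<^bsub>A\<^esub>} = {s \<in> S. v s \<oplus>\<^bsub>A\<^esub> w s \<noteq> \<zero>\<^bsub>A\<^esub>}"
      by auto
    ultimately show "v \<oplus>\<^bsub>A.func_space S\<^esub> w \<in> ?N"
      using vw by (auto simp: A.func_space_def PiE_mem2)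
  next
    fix c v assume cv: "c \<in> carrier A" "v \<in> ?N"
    then have "finite {s \<in> S. c \<otimes>\<^bsub>A\<^esub> v s \<noteq> \<zero>\<^bsub>A\<^esub>}"
      by (rule_tac finite_subset [of _ "{s \<in> S. v s \<noteq> \<zero>\<^bsub>A\<^esub>}"]) auto
    moreover have "{s \<in> S. (\<lambda>v'\<in>S. c \<otimes>\<^bsub>A\<^esub> v v') s \<noteq> \<zero>\<^bsub>A\<^esub>} = {s \<in> S. c \<otimes>\<^bsub>A\<^esub> v s \<noteq> \<zero>\<^bsub>A\<^esub>}"
      by auto
    ultimately show "c \<odot>\<^bsub>A.func_space S\<^esub> v \<in> ?N"
      using cv by (auto simp: A.func_space_def PiE_mem2)
  qed
  then show ?thesis
    unfolding free_module_def using F.submodule_is_module by blast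
qed

lemma free_module_simps:
  assumes "cring A"
  shows "carrier (free_module A S) = {f \<in> S \<rightarrow>\<^sub>E carrier A. finite {s \<in> S. f s \<noteq> \<zero>\<^bsub>A\<^esub>}}"
    and "\<zero>\<^bsub>free_module A S\<^esub> = (\<lambda>s\<in>S. \<zero>\<^bsub>A\<^esub>)"
    and "f \<oplus>\<^bsub>free_module A S\<^esub> g = (\<lambda>s\<in>S. f s \<oplus>\<^bsub>A\<^esub> g s)"
    and "c \<odot>\<^bsub>free_module A S\<^esub> f = (\<lambda>s\<in>S. c \<otimes>\<^bsub>A\<^esub> f s)"
proof -
  interpret A: cring A by (rule assms)
  show "carrier (free_module A S) = {f \<in> S \<rightarrow>\<^sub>E carrier A. finite {s \<in> S. f s \<noteq> \<zero>\<^bsub>A\<^esub>}}"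
    "\<zero>\<^bsub>free_module A S\<^esub> = (\<lambda>s\<in>S. \<zero>\<^bsub>A\<^esub>)"
    "f \<oplus>\<^bsub>free_module A S\<^esub> g = (\<lambda>s\<in>S. f s \<oplus>\<^bsub>A\<^esub> g s)"
    "c \<odot>\<^bsub>free_module A S\<^esub> f = (\<lambda>s\<in>S. c \<otimes>\<^bsub>A\<^esub> f s)"
    by (simp_all add: free_module_def A.func_space_def)
qed

lemma free_gen_closed:
  assumes "cring A" "s \<in> S" shows "free_gen A S s \<in> carrier (free_module A S)"
proof -
  interpret A: cring A by (rule assms)
  have "{t \<in> S. free_gen A S s t \<noteq> \<zero>\<^bsub>A\<^esub>} \<subseteq> {s}" by (auto simp: free_gen_def)
  then have "finite {t \<in> S. free_gen A S s t \<noteq> \<zero>\<^bsub>A\<^esub>}" by (rule finite_subset) simp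
  then show ?thesis by (auto simp: free_module_simps [OF assms(1)] free_gen_def)
qed

locale kaehler_differentials = cring A for A :: "'a ring" (structure) +
  fixes \<kappa> :: "'k \<Rightarrow> 'a"
  assumes \<kappa>_closed: "\<kappa> c \<in> carrier A"
begin

abbreviation "F \<equiv> free_module A (carrier A)"
abbreviation "D \<equiv> free_gen A (carrier A)"
abbreviation "\<Omega> \<equiv> kaehler A \<kappa>"
abbreviation "d \<equiv> kaehler_d A \<kappa>"

sublocale F: module A F
  by (rule module_free_module) (rule cring_axioms)

lemma D_closed [simp, intro]: "a \<in> carrier A \<Longrightarrow> D a \<in> carrier F"
  by (rule free_gen_closed) (rule cring_axioms)

lemma relations_closed: "kaehler_relations A \<kappa> \<subseteq> carrier F"
  by (auto simp: kaehler_relations_def Let_def \<kappa>_closed)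

lemma submodule: "submodule A (kaehler_submodule A \<kappa>) F"
  unfolding kaehler_submodule_def by (rule F.span_is_submodule [OF relations_closed])

sublocale Q: quotient_of_module A F "kaehler_submodule A \<kappa>"
  by (rule quotient_of_module.intro [OF module_free_module [OF cring_axioms]
        quotient_of_module_axioms.intro [OF submodule]])

lemma relation_in: "x \<in> kaehler_relations A \<kappa> \<Longrightarrow> x \<in> kaehler_submodule A \<kappa>"
  unfolding kaehler_submodule_def by (rule subsetD [OF F.in_own_span [OF relations_closed]])

sublocale \<Omega>: module A \<Omega>
  unfolding kaehler_def by (rule Q.module_quot)

lemma d_closed [simp, intro]: "a \<in> carrier A \<Longrightarrow> d a \<in> carrier \<Omega>"
  by (auto simp: kaehler_def kaehler_d_def Q.quot_carrier)

lemma d_add: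
  assumes ab: "a \<in> carrier A" "b \<in> carrier A" shows "d (a \<oplus> b) = d a \<oplus>\<^bsub>\<Omega>\<^esub> d b"
proof -
  have "D (a \<oplus> b) \<ominus>\<^bsub>F\<^esub> (D a \<oplus>\<^bsub>F\<^esub> D b) \<in> kaehler_submodule A \<kappa>"
    by (rule relation_in) (use ab in \<open>auto simp: kaehler_relations_def Let_def\<close>)
  then show ?thesis
    using ab by (simp add: kaehler_def kaehler_d_def Q.quot_add Q.coset_eq_iff)
qed

lemma d_mult:
  assumes ab: "a \<in> carrier A" "b \<in> carrier A"
  shows "d (a \<otimes> b) = a \<odot>\<^bsub>\<Omega>\<^esub> d b \<oplus>\<^bsub>\<Omega>\<^esub> b \<odot>\<^bsub>\<Omega>\<^esub> d a"
proof -
  have "D (a \<otimes> b) \<ominus>\<^bsub>F\<^esub> (a \<odot>\<^bsub>F\<^esub> D b \<oplus>\<^bsub>F\<^esub> b \<odot>\<^bsub>F\<^esub> D a) \<in> kaehler_submodule A \<kappa>"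
    by (rule relation_in) (use ab in \<open>auto simp: kaehler_relations_def Let_def\<close>)
  then show ?thesis
    using ab by (simp add: kaehler_def kaehler_d_def Q.quot_add Q.quot_smult Q.coset_eq_iff)
qed

lemma d_const: "d (\<kappa> c) = \<zero>\<^bsub>\<Omega>\<^esub>"
proof -
  have "D (\<kappa> c) \<in> kaehler_submodule A \<kappa>"
    by (rule relation_in) (auto simp: kaehler_relations_def Let_def)
  then show ?thesis
    by (simp add: kaehler_def kaehler_d_def Q.quot_zero Q.coset_eq_zero_iff \<kappa>_closed)
qed

end

subsection \<open>Differentials of the coordinate ring\<close>

text \<open>Suited to derivations, which are determined by their values on constants and
  indeterminates through sums and products.\<close>

lemma mpolys_ring_induct [consumes 1, case_names const indet add mult]:
  fixes f :: "'k::field mpoly"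
  assumes f: "f \<in> mpolys n"
    and const: "\<And>c. Q (const c)" and indet: "\<And>i. i \<le> n \<Longrightarrow> Q (indet i)"
    and add: "\<And>g h. g \<in> mpolys n \<Longrightarrow> h \<in> mpolys n \<Longrightarrow> Q g \<Longrightarrow> Q h \<Longrightarrow> Q (g + h)"
    and mult: "\<And>g h. g \<in> mpolys n \<Longrightarrow> h \<in> mpolys n \<Longrightarrow> Q g \<Longrightarrow> Q h \<Longrightarrow> Q (g * h)"
  shows "Q f"
proof -
  have mono: "Q (Poly_Mapping.single t c)" if "Poly_Mapping.keys t \<subseteq> {..n}" for t c
    \<comment> \<open>Monomials are built up from a constant, one indeterminate at a time, by
      induction on the degree.\<close>
    using that
  proof (induction "mon_deg t" arbitrary: t)
    case 0
    have "Poly_Mapping.lookup t i = 0" for i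
    proof (rule ccontr)
      assume "Poly_Mapping.lookup t i \<noteq> 0"
      then obtain s where "t = s + Poly_Mapping.single i 1" using monom_split [of 1 t i] by auto
      then show False using 0 by (simp add: mon_deg_add)
    qed
    then have "t = 0" by (intro poly_mapping_eqI) simp
    then show ?case using const [of c] by (simp add: const_def)
  next
    case (Suc e)
    then have "t \<noteq> 0" by auto
    then obtain i where "Poly_Mapping.lookup t i \<noteq> 0" by (metis lookup_zero poly_mapping_eqI)
    then obtain s where s: "t = s + Poly_Mapping.single i 1" using monom_split [of 1 t i] by auto
    then have "Poly_Mapping.keys s \<subseteq> {..n}" "i \<le> n" "e = mon_deg s"
      using Suc by (auto simp: keys_add_nat mon_deg_add)
    moreover have "Poly_Mapping.single t c = Poly_Mapping.single s c * indet i"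
      by (simp add: s indet_def mult_single)
    ultimately show ?case using Suc.hyps(1) by (auto intro!: mult indet mpolys_single)
  qed
  have "f \<in> mpolys n \<and> Q f"
  proof (rule mpoly_induct [where f = f])
    show "0 \<in> mpolys n \<and> Q 0" using const [of 0] by simp
    fix t :: "nat \<Rightarrow>\<^sub>0 nat" and c :: 'k assume "t \<in> Poly_Mapping.keys f"
    then have "Poly_Mapping.keys t \<subseteq> {..n}" using f by (auto simp: mpolys_iff)
    then show "Poly_Mapping.single t c \<in> mpolys n \<and> Q (Poly_Mapping.single t c)"
      using mono mpolys_single by blast
  qed (use add in auto)
  then show ?thesis ..
qed

locale coord_kaehler =
  fixes n :: nat and I :: "'k::field mpoly set"
  assumes I: "ideal I (mpoly_ring n)"
begin

abbreviation "A \<equiv> coord_ring n I"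
abbreviation "\<kappa> \<equiv> coord_const n I"
abbreviation "res \<equiv> residue n I"

lemmas ID = mpoly_idealD [OF I]

lemma res_closed [simp, intro]: "f \<in> mpolys n \<Longrightarrow> res f \<in> carrier A"
  by (simp add: coord_ring_simps [OF I])

lemma res_zero: "res 0 = \<zero>\<^bsub>A\<^esub>" and res_one: "res 1 = \<one>\<^bsub>A\<^esub>"
  using residue_zero [OF I] by (simp_all add: coord_ring_simps(2,3) [OF I])

lemma kappa_eq: "\<kappa> c = res (const c)"
  by (simp add: coord_const_def)

sublocale kaehler_differentials A \<kappa>
proof (rule kaehler_differentials.intro [OF cring_coord_ring [OF I]])
  show "kaehler_differentials_axioms A \<kappa>"
    by unfold_locales (simp add: kappa_eq)
qed

text \<open>A differential form is meant here, not a homogeneous polynomial. This is the map from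
  vectors of polynomials to \<Omega> whose kernel has to be determined.\<close>

definition form :: "(nat \<Rightarrow> 'k mpoly) \<Rightarrow> (('k mpoly set \<Rightarrow> 'k mpoly set) set)"
  where "form x = (\<Oplus>\<^bsub>\<Omega>\<^esub>j\<in>{..n}. res (x j) \<odot>\<^bsub>\<Omega>\<^esub> d (res (indet j)))"

lemma summand_closed: "x j \<in> mpolys n \<Longrightarrow> j \<le> n \<Longrightarrow> res (x j) \<odot>\<^bsub>\<Omega>\<^esub> d (res (indet j)) \<in> carrier \<Omega>"
  by (intro \<Omega>.smult_closed d_closed res_closed mpolys_indet)

lemma form_closed: "(\<And>j. x j \<in> mpolys n) \<Longrightarrow> form x \<in> carrier \<Omega>"
  unfolding form_def by (rule \<Omega>.M.finsum_closed) (auto intro: summand_closed)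

lemma form_add:
  assumes "\<And>j. x j \<in> mpolys n" "\<And>j. y j \<in> mpolys n"
  shows "form (\<lambda>i. x i + y i) = form x \<oplus>\<^bsub>\<Omega>\<^esub> form y"
proof -
  have "form (\<lambda>i. x i + y i) = (\<Oplus>\<^bsub>\<Omega>\<^esub>j\<in>{..n}.
      res (x j) \<odot>\<^bsub>\<Omega>\<^esub> d (res (indet j)) \<oplus>\<^bsub>\<Omega>\<^esub> res (y j) \<odot>\<^bsub>\<Omega>\<^esub> d (res (indet j)))"
    unfolding form_def
  proof (rule \<Omega>.M.finsum_cong')
    fix j assume "j \<in> {..n}"
    then show "res (x j + y j) \<odot>\<^bsub>\<Omega>\<^esub> d (res (indet j)) =
        res (x j) \<odot>\<^bsub>\<Omega>\<^esub> d (res (indet j)) \<oplus>\<^bsub>\<Omega>\<^esub> res (y j) \<odot>\<^bsub>\<Omega>\<^esub> d (res (indet j))"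
      using assms by (simp add: coord_ring_simps(4) [OF I, symmetric] \<Omega>.smult_l_distr)
  qed (use assms in \<open>auto intro!: summand_closed\<close>)
  also have "\<dots> = form x \<oplus>\<^bsub>\<Omega>\<^esub> form y"
    unfolding form_def by (rule \<Omega>.M.finsum_addf) (use assms in \<open>auto intro!: summand_closed\<close>)
  finally show ?thesis .
qed

lemma form_mult:
  assumes "\<And>j. x j \<in> mpolys n" "h \<in> mpolys n"
  shows "form (\<lambda>i. h * x i) = res h \<odot>\<^bsub>\<Omega>\<^esub> form x"
proof -
  have "form (\<lambda>i. h * x i) = (\<Oplus>\<^bsub>\<Omega>\<^esub>j\<in>{..n}. res h \<odot>\<^bsub>\<Omega>\<^esub> (res (x j) \<odot>\<^bsub>\<Omega>\<^esub> d (res (indet j))))"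
    unfolding form_def
  proof (rule \<Omega>.M.finsum_cong')
    fix j assume "j \<in> {..n}"
    then show "res (h * x j) \<odot>\<^bsub>\<Omega>\<^esub> d (res (indet j)) = res h \<odot>\<^bsub>\<Omega>\<^esub> (res (x j) \<odot>\<^bsub>\<Omega>\<^esub> d (res (indet j)))"
      using assms by (simp add: coord_ring_simps(5) [OF I, symmetric] \<Omega>.smult_assoc1)
  qed (use assms in \<open>auto intro!: summand_closed\<close>)
  also have "\<dots> = res h \<odot>\<^bsub>\<Omega>\<^esub> form x"
    unfolding form_def
    by (rule \<Omega>.finsum_smult [symmetric]) (use assms in \<open>auto intro!: summand_closed\<close>)
  finally show ?thesis .
qed

lemma form_zero:
  assumes "\<And>j. j \<le> n \<Longrightarrow> x j \<in> I" shows "form x = \<zero>\<^bsub>\<Omega>\<^esub>"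
proof -
  have "form x = (\<Oplus>\<^bsub>\<Omega>\<^esub>j\<in>{..n}. \<zero>\<^bsub>\<Omega>\<^esub>)"
    unfolding form_def
  proof (rule \<Omega>.M.finsum_cong')
    fix j assume "j \<in> {..n}"
    then have "res (x j) = \<zero>\<^bsub>A\<^esub>" using assms residue_eq_zero_iff [OF I] by (simp add: coord_ring_simps(2) [OF I])
    then show "res (x j) \<odot>\<^bsub>\<Omega>\<^esub> d (res (indet j)) = \<zero>\<^bsub>\<Omega>\<^esub>"
      using \<open>j \<in> {..n}\<close> by simp
  qed auto
  then show ?thesis by simp
qed

text \<open>This is the chain rule: both sides are derivations in \<open>f\<close>, vanish on
  constants and agree on the indeterminates.\<close>

lemma form_grad: "f \<in> mpolys n \<Longrightarrow> form (\<lambda>i. partial i f) = d (res f)"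
proof (induction rule: mpolys_ring_induct)
  case (const c)
  have "form (\<lambda>i. partial i (const c)) = \<zero>\<^bsub>\<Omega>\<^esub>" by (rule form_zero) (simp add: ID(2))
  then show ?case using d_const [of c] by (simp add: kappa_eq [symmetric])
next
  case (indet i)
  have "form (\<lambda>j. partial j (indet i)) =
      (\<Oplus>\<^bsub>\<Omega>\<^esub>j\<in>{..n}. if i = j then d (res (indet j)) else \<zero>\<^bsub>\<Omega>\<^esub>)"
    unfolding form_def
  proof (rule \<Omega>.M.finsum_cong')
    fix j assume "j \<in> {..n}"
    then show "res (partial j (indet i)) \<odot>\<^bsub>\<Omega>\<^esub> d (res (indet j)) = (if i = j then d (res (indet j)) else \<zero>\<^bsub>\<Omega>\<^esub>)"
      by (simp add: partial_indet res_zero res_one)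
  qed auto
  also have "\<dots> = d (res (indet i))"
    by (rule \<Omega>.M.add.finprod_singleton) (use indet in auto)
  finally show ?case .
next
  case (add g h)
  then show ?case
    by (simp add: partial_add form_add d_add [symmetric] coord_ring_simps(4) [OF I])
next
  case (mult g h)
  then show ?case
    by (simp add: partial_mult form_add form_mult coord_ring_simps(5) [OF I, symmetric] d_mult)
qed

text \<open>A generator f e_j has coefficient zero in R, and the gradient of \<open>f\<close> is
  mapped to d applied to the class of \<open>f\<close>, that is, to d 0 = 0.\<close>

lemma relations_imp_form_zero:
  assumes "x \<in> jacobian_relations n I"
  shows "(\<forall>i. x i \<in> mpolys n) \<and> form x = \<zero>\<^bsub>\<Omega>\<^esub>"
  using assms
proof induction
  case zero
  then show ?case using form_zero [of "\<lambda>i. 0"] by (simp add: ID(2))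
next
  case (ideal x f j)
  then have "form (\<lambda>i. if i = j then f else 0) = \<zero>\<^bsub>\<Omega>\<^esub>" by (intro form_zero) (auto simp: ID(2))
  then show ?case using ideal ID(1) by (simp add: form_add)
next
  case (grad x f h)
  then have f: "f \<in> mpolys n" using ID(1) by blast
  have "res f = \<kappa> 0"
    using grad residue_eq_iff [OF I, of f 0] by (simp add: kappa_eq)
  then have "form (\<lambda>i. h * partial i f) = \<zero>\<^bsub>\<Omega>\<^esub>"
    using grad f d_const [of 0] by (simp add: form_mult form_grad)
  then show ?case using grad f by (simp add: form_add)
qed

section \<open>The inverse map, from differentials to vectors modulo relations\<close>

abbreviation relations where "relations \<equiv> jacobian_relations n I"

definition rep :: "'k mpoly set \<Rightarrow> 'k mpoly"
  where "rep r = (SOME f. f \<in> mpolys n \<and> res f = r)"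

lemma rep:
  assumes "r \<in> carrier A" shows "rep r \<in> mpolys n" "res (rep r) = r"
proof -
  have "\<exists>f. f \<in> mpolys n \<and> res f = r" using assms by (auto simp: coord_ring_simps(1) [OF I])
  then have "rep r \<in> mpolys n \<and> res (rep r) = r" unfolding rep_def by (rule someI_ex)
  then show "rep r \<in> mpolys n" "res (rep r) = r" by auto
qed

text \<open>\<open>lift_form\<close> induces the inverse of \<open>form\<close>, from \<open>\<Omega>\<close> to the cokernel of the Jacobian relations.
  It is only well-defined and linear modulo \<open>relations\<close>.\<close>

definition lift_form :: "('k mpoly set \<Rightarrow> 'k mpoly set) \<Rightarrow> nat \<Rightarrow> 'k mpoly"
  where "lift_form \<delta> i = (\<Sum>r | r \<in> carrier A \<and> \<delta> r \<noteq> \<zero>\<^bsub>A\<^esub>. rep (\<delta> r) * partial i (rep r))"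

definition cong_rel :: "(nat \<Rightarrow> 'k mpoly) \<Rightarrow> (nat \<Rightarrow> 'k mpoly) \<Rightarrow> bool"
  where "cong_rel x y \<longleftrightarrow> (\<lambda>i. x i - y i) \<in> relations"

lemma cong_refl: "cong_rel x x"
  by (simp add: cong_rel_def jacobian_relations.zero)

lemma cong_sym: "cong_rel x y \<Longrightarrow> cong_rel y x"
  unfolding cong_rel_def
  using jacobian_relations_diff [OF I jacobian_relations.zero, of "\<lambda>i. x i - y i"] by simp

lemma cong_trans [trans]: "cong_rel x y \<Longrightarrow> cong_rel y z \<Longrightarrow> cong_rel x z"
  unfolding cong_rel_def
  using jacobian_relations_add [OF I, of "\<lambda>i. x i - y i" "\<lambda>i. y i - z i"] by simp

lemma cong_add: "cong_rel x y \<Longrightarrow> cong_rel z w \<Longrightarrow> cong_rel (\<lambda>i. x i + z i) (\<lambda>i. y i + w i)"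
  unfolding cong_rel_def
  using jacobian_relations_add [OF I, of "\<lambda>i. x i - y i" "\<lambda>i. z i - w i"] by (simp add: algebra_simps)

lemma cong_mult: "cong_rel x y \<Longrightarrow> h \<in> mpolys n \<Longrightarrow> cong_rel (\<lambda>i. h * x i) (\<lambda>i. h * y i)"
  unfolding cong_rel_def
  using jacobian_relations_mult [OF I, of "\<lambda>i. x i - y i" h] by (simp add: algebra_simps)

lemma cong_in: "cong_rel x y \<Longrightarrow> y \<in> relations \<Longrightarrow> x \<in> relations"
  unfolding cong_rel_def
  using jacobian_relations_add [OF I, of "\<lambda>i. x i - y i" y] by simp

text \<open>Another choice of lifts \<open>c r\<close> changes each coefficient by an element of
  \<open>I\<close>. So the difference of the two vectors has all its entries in \<open>I\<close> and
  is a relation. Passing to a larger finite set \<open>S\<close> only adds zero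
  coefficients.\<close>

lemma lift_form_cong:
  assumes S: "finite S" "S \<subseteq> carrier A" and \<delta>: "\<And>r. r \<in> carrier A \<Longrightarrow> r \<notin> S \<Longrightarrow> \<delta> r = \<zero>\<^bsub>A\<^esub>"
    and c: "\<And>r. r \<in> S \<Longrightarrow> c r \<in> mpolys n" "\<And>r. r \<in> S \<Longrightarrow> res (c r) = \<delta> r"
  shows "cong_rel (lift_form \<delta>) (\<lambda>i. \<Sum>r\<in>S. c r * partial i (rep r))"
proof -
  \<comment> \<open>These coefficients extend the sum in \<open>lift_form\<close> from the support
    of \<open>\<delta>\<close> to \<open>S\<close>; the chosen representative of the zero class
    might be a nonzero element of \<open>I\<close>.\<close>
  define c' where "c' r = (if \<delta> r = \<zero>\<^bsub>A\<^esub> then 0 else rep (\<delta> r))" for r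
  have "lift_form \<delta> i = (\<Sum>r\<in>S. c' r * partial i (rep r))" for i
    unfolding lift_form_def
  proof (rule sum.mono_neutral_cong_left [OF S(1)])
    show "{r. r \<in> carrier A \<and> \<delta> r \<noteq> \<zero>\<^bsub>A\<^esub>} \<subseteq> S" using \<delta> by auto
    show "\<forall>r\<in>S - {r. r \<in> carrier A \<and> \<delta> r \<noteq> \<zero>\<^bsub>A\<^esub>}. c' r * partial i (rep r) = 0"
      using S(2) by (auto simp: c'_def)
    show "rep (\<delta> r) * partial i (rep r) = c' r * partial i (rep r)"
      if "r \<in> {r. r \<in> carrier A \<and> \<delta> r \<noteq> \<zero>\<^bsub>A\<^esub>}" for r
      using that by (simp add: c'_def)
  qed
  then have eq: "lift_form \<delta> i - (\<Sum>r\<in>S. c r * partial i (rep r)) = (\<Sum>r\<in>S. (c' r - c r) * partial i (rep r))" for i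
    by (simp add: sum_subtractf left_diff_distrib)
  have diff: "c' r - c r \<in> I" if r: "r \<in> S" for r
  proof -
    have "\<delta> r \<in> carrier A" using c [OF r] res_closed by metis
    then have "res (c' r) = \<delta> r"
      using rep residue_zero [OF I] by (simp add: c'_def coord_ring_simps(2) [OF I])
    then show ?thesis using c(2) [OF r] residue_eq_iff [OF I, of "c' r" "c r"] by simp
  qed
  show ?thesis
    unfolding cong_rel_def eq
  proof (rule jacobian_relations_vector [OF I])
    show "(\<Sum>r\<in>S. (c' r - c r) * partial i (rep r)) \<in> I" for i
    proof (rule mpoly_ideal_sum [OF I])
      fix r assume r: "r \<in> S"
      have "partial i (rep r) \<in> mpolys n" using rep S(2) r by blast
      then show "(c' r - c r) * partial i (rep r) \<in> I"
        using ID(4) [OF _ diff [OF r], of "partial i (rep r)"] by (simp add: mult.commute)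
    qed
    show "(\<Sum>r\<in>S. (c' r - c r) * partial i (rep r)) = 0" if "n < i" for i
      using that S(2) by (intro sum.neutral) (auto simp: partial_beyond [OF rep(1)])
  qed
qed

lemma carrier_F: "\<delta> \<in> carrier F \<longleftrightarrow> \<delta> \<in> carrier A \<rightarrow>\<^sub>E carrier A \<and> finite {r \<in> carrier A. \<delta> r \<noteq> \<zero>\<^bsub>A\<^esub>}"
  by (simp add: free_module_simps [OF cring_axioms])

lemmas F_simps = free_module_simps [OF cring_axioms]

lemma lift_form_add:
  assumes "x \<in> carrier F" "y \<in> carrier F"
  shows "cong_rel (lift_form (x \<oplus>\<^bsub>F\<^esub> y)) (\<lambda>i. lift_form x i + lift_form y i)"
proof -
  \<comment> \<open>The union of the supports is an index set common to both summands and to the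
    sum.\<close>
  let ?S = "{r \<in> carrier A. x r \<noteq> \<zero>\<^bsub>A\<^esub>} \<union> {r \<in> carrier A. y r \<noteq> \<zero>\<^bsub>A\<^esub>}"
  have S: "finite ?S" "?S \<subseteq> carrier A" using assms by (auto simp: carrier_F)
  have val: "x r \<in> carrier A" "y r \<in> carrier A" if "r \<in> carrier A" for r
    using assms that by (auto simp: carrier_F)
  have 1: "cong_rel (lift_form x) (\<lambda>i. \<Sum>r\<in>?S. rep (x r) * partial i (rep r))"
    by (rule lift_form_cong [OF S]) (use val rep in auto)
  have 2: "cong_rel (lift_form y) (\<lambda>i. \<Sum>r\<in>?S. rep (y r) * partial i (rep r))"
    by (rule lift_form_cong [OF S]) (use val rep in auto)
  have "cong_rel (lift_form (x \<oplus>\<^bsub>F\<^esub> y)) (\<lambda>i. \<Sum>r\<in>?S. (rep (x r) + rep (y r)) * partial i (rep r))"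
    by (rule lift_form_cong [OF S])
      (use val rep in \<open>auto simp: F_simps coord_ring_simps(4) [OF I, symmetric]\<close>)
  also have "(\<lambda>i. \<Sum>r\<in>?S. (rep (x r) + rep (y r)) * partial i (rep r)) =
      (\<lambda>i. (\<Sum>r\<in>?S. rep (x r) * partial i (rep r)) + (\<Sum>r\<in>?S. rep (y r) * partial i (rep r)))"
    by (simp add: distrib_right sum.distrib)
  also have "cong_rel \<dots> (\<lambda>i. lift_form x i + lift_form y i)"
    by (rule cong_sym [OF cong_add [OF 1 2]])
  finally show ?thesis .
qed

lemma lift_form_smult:
  assumes "a \<in> carrier A" "x \<in> carrier F"
  shows "cong_rel (lift_form (a \<odot>\<^bsub>F\<^esub> x)) (\<lambda>i. rep a * lift_form x i)"
proof -
  let ?S = "{r \<in> carrier A. x r \<noteq> \<zero>\<^bsub>A\<^esub>}"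
  have S: "finite ?S" "?S \<subseteq> carrier A" using assms by (auto simp: carrier_F)
  have val: "x r \<in> carrier A" if "r \<in> carrier A" for r
    using assms that by (auto simp: carrier_F)
  have "cong_rel (lift_form (a \<odot>\<^bsub>F\<^esub> x)) (\<lambda>i. \<Sum>r\<in>?S. (rep a * rep (x r)) * partial i (rep r))"
    by (rule lift_form_cong [OF S])
      (use assms(1) val rep in \<open>auto simp: F_simps coord_ring_simps(5) [OF I, symmetric]\<close>)
  also have "(\<lambda>i. \<Sum>r\<in>?S. (rep a * rep (x r)) * partial i (rep r)) = (\<lambda>i. rep a * lift_form x i)"
    by (simp add: lift_form_def sum_distrib_left mult.assoc)
  finally show ?thesis .
qed

lemma lift_form_gen:
  assumes h: "h \<in> mpolys n" and f: "f \<in> mpolys n"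
  shows "cong_rel (lift_form (res h \<odot>\<^bsub>F\<^esub> D (res f))) (\<lambda>i. h * partial i f)"
proof -
  have "cong_rel (lift_form (res h \<odot>\<^bsub>F\<^esub> D (res f))) (\<lambda>i. \<Sum>r\<in>{res f}. h * partial i (rep r))"
    by (rule lift_form_cong) (use h f in \<open>auto simp: F_simps free_gen_def\<close>)
  also have "(\<lambda>i. \<Sum>r\<in>{res f}. h * partial i (rep r)) = (\<lambda>i. h * partial i (rep (res f)))" by simp
  also have "cong_rel \<dots> (\<lambda>i. h * partial i f)"
  proof (rule cong_mult [OF _ h])
    \<comment> \<open>Two representatives of a class differ by an element of \<open>I\<close>, so
      their gradients differ by a relation.\<close>
    have "rep (res f) - f \<in> I"
      using rep(2) [OF res_closed [OF f]] residue_eq_iff [OF I, of "rep (res f)" f] by simp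
    then show "cong_rel (\<lambda>i. partial i (rep (res f))) (\<lambda>i. partial i f)"
      using jacobian_relations_grad [OF I] by (simp add: cong_rel_def partial_diff [symmetric])
  qed
  finally show ?thesis .
qed

lemma lift_form_D:
  assumes f: "f \<in> mpolys n"
  shows "cong_rel (lift_form (D (res f))) (\<lambda>i. partial i f)"
  using lift_form_gen [OF mpolys_one f] f by (simp add: coord_ring_simps(3) [OF I, symmetric])

lemma lift_form_zero: "lift_form \<zero>\<^bsub>F\<^esub> = (\<lambda>i. 0)"
  by (auto simp: lift_form_def F_simps intro!: sum.neutral)

text \<open>\<open>lift_form\<close> is additive only modulo relations, so the difference is treated
  through x = (x - y) + y.\<close>

lemma lift_form_minus:
  assumes x: "x \<in> carrier F" and y: "y \<in> carrier F"
    and 1: "cong_rel (lift_form x) z" and 2: "cong_rel (lift_form y) z"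
  shows "lift_form (x \<ominus>\<^bsub>F\<^esub> y) \<in> relations"
proof -
  have xy: "x \<ominus>\<^bsub>F\<^esub> y \<in> carrier F" using x y by (rule F.M.minus_closed)
  have "x = (x \<ominus>\<^bsub>F\<^esub> y) \<oplus>\<^bsub>F\<^esub> y"
    using x y by (simp add: a_minus_def F.M.a_assoc F.M.l_neg)
  then have "cong_rel (lift_form x) (\<lambda>i. lift_form (x \<ominus>\<^bsub>F\<^esub> y) i + lift_form y i)"
    using lift_form_add [OF xy y] by metis
  moreover have "cong_rel (lift_form y) (lift_form x)"
    by (rule cong_trans [OF 2 cong_sym [OF 1]])
  ultimately have "cong_rel (lift_form y) (\<lambda>i. lift_form (x \<ominus>\<^bsub>F\<^esub> y) i + lift_form y i)"
    by (rule cong_trans [rotated])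
  then show ?thesis using cong_sym unfolding cong_rel_def by fastforce
qed

text \<open>It thus suffices to inspect the generators of the submodule that defines \<Omega>, and
  no induction over their linear combinations is needed.\<close>

lemma submodule_lift_form: "submodule A {x \<in> carrier F. lift_form x \<in> relations} F"
proof (rule submodule.intro)
  show "module A F" by (rule module_free_module [OF cring_axioms])
  show "\<zero>\<^bsub>F\<^esub> \<in> {x \<in> carrier F. lift_form x \<in> relations}"
    by (simp add: lift_form_zero jacobian_relations.zero)
  show "x \<oplus>\<^bsub>F\<^esub> y \<in> {x \<in> carrier F. lift_form x \<in> relations}"
    if "x \<in> {x \<in> carrier F. lift_form x \<in> relations}" "y \<in> {x \<in> carrier F. lift_form x \<in> relations}" for x y
    using that cong_in [OF lift_form_add [of x y] jacobian_relations_add [OF I]] by simp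
  show "a \<odot>\<^bsub>F\<^esub> x \<in> {x \<in> carrier F. lift_form x \<in> relations}"
    if "a \<in> carrier A" "x \<in> {x \<in> carrier F. lift_form x \<in> relations}" for a x
    using that cong_in [OF lift_form_smult [of a x] jacobian_relations_mult [OF I _ rep(1)]] by simp
qed auto

text \<open>The three kinds of defining relations correspond to three facts on gradients:
  additivity, the product rule, and vanishing on constants.\<close>

lemma lift_form_kaehler_relation:
  assumes "x \<in> kaehler_relations A \<kappa>" shows "lift_form x \<in> relations"
proof -
  consider f g where "f \<in> mpolys n" "g \<in> mpolys n" "x = D (res f \<oplus>\<^bsub>A\<^esub> res g) \<ominus>\<^bsub>F\<^esub> (D (res f) \<oplus>\<^bsub>F\<^esub> D (res g))"
    | f g where "f \<in> mpolys n" "g \<in> mpolys n"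
      "x = D (res f \<otimes>\<^bsub>A\<^esub> res g) \<ominus>\<^bsub>F\<^esub> (res f \<odot>\<^bsub>F\<^esub> D (res g) \<oplus>\<^bsub>F\<^esub> res g \<odot>\<^bsub>F\<^esub> D (res f))"
    | c where "x = D (\<kappa> c)"
    using assms unfolding kaehler_relations_def Let_def coord_ring_simps(1) [OF I] by auto
  then show ?thesis
  proof cases
    case 1
    show ?thesis
      unfolding 1(3)
    proof (rule lift_form_minus)
      have "cong_rel (lift_form (D (res f) \<oplus>\<^bsub>F\<^esub> D (res g))) (\<lambda>i. lift_form (D (res f)) i + lift_form (D (res g)) i)"
        using 1 by (intro lift_form_add D_closed res_closed)
      also have "cong_rel \<dots> (\<lambda>i. partial i f + partial i g)"
        using 1 by (intro cong_add lift_form_D)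
      finally show "cong_rel (lift_form (D (res f) \<oplus>\<^bsub>F\<^esub> D (res g))) (\<lambda>i. partial i f + partial i g)" .
      show "cong_rel (lift_form (D (res f \<oplus>\<^bsub>A\<^esub> res g))) (\<lambda>i. partial i f + partial i g)"
        using lift_form_D [of "f + g"] 1 by (simp add: coord_ring_simps(4) [OF I] partial_add)
    qed (use 1 in auto)
  next
    case 2
    show ?thesis
      unfolding 2(3)
    proof (rule lift_form_minus)
      have "cong_rel (lift_form (res f \<odot>\<^bsub>F\<^esub> D (res g) \<oplus>\<^bsub>F\<^esub> res g \<odot>\<^bsub>F\<^esub> D (res f)))
          (\<lambda>i. lift_form (res f \<odot>\<^bsub>F\<^esub> D (res g)) i + lift_form (res g \<odot>\<^bsub>F\<^esub> D (res f)) i)"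
        using 2 by (intro lift_form_add F.smult_closed D_closed res_closed)
      also have "cong_rel \<dots> (\<lambda>i. f * partial i g + g * partial i f)"
        using 2 by (intro cong_add lift_form_gen)
      finally show "cong_rel (lift_form (res f \<odot>\<^bsub>F\<^esub> D (res g) \<oplus>\<^bsub>F\<^esub> res g \<odot>\<^bsub>F\<^esub> D (res f)))
          (\<lambda>i. f * partial i g + g * partial i f)" .
      show "cong_rel (lift_form (D (res f \<otimes>\<^bsub>A\<^esub> res g))) (\<lambda>i. f * partial i g + g * partial i f)"
        using lift_form_D [of "f * g"] 2 by (simp add: coord_ring_simps(5) [OF I] partial_mult)
    qed (use 2 in auto)
  next
    case 3
    then show ?thesis
      using cong_in [OF lift_form_D [OF mpolys_const, of c]]
      by (simp add: kappa_eq jacobian_relations.zero)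
  qed
qed

lemma lift_form_kaehler_submodule:
  assumes "x \<in> kaehler_submodule A \<kappa>" shows "lift_form x \<in> relations"
proof -
  have "kaehler_submodule A \<kappa> \<subseteq> {x \<in> carrier F. lift_form x \<in> relations}"
    unfolding kaehler_submodule_def
    using relations_closed lift_form_kaehler_relation
    by (intro F.span_is_subset submodule_lift_form) auto
  then show ?thesis using assms by auto
qed

lemma lift_form_finsum:
  assumes "finite S" "\<And>j. j \<in> S \<Longrightarrow> x j \<in> carrier F" "\<And>j. j \<in> S \<Longrightarrow> cong_rel (lift_form (x j)) (y j)"
  shows "cong_rel (lift_form (\<Oplus>\<^bsub>F\<^esub>j\<in>S. x j)) (\<lambda>i. \<Sum>j\<in>S. y j i)"
  using assms
proof (induction S rule: finite_induct)
  case empty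
  then show ?case by (simp add: lift_form_zero cong_refl)
next
  case (insert k S)
  have cl: "x \<in> S \<rightarrow> carrier F" "x k \<in> carrier F" using insert by auto
  then have "(\<Oplus>\<^bsub>F\<^esub>j\<in>insert k S. x j) = x k \<oplus>\<^bsub>F\<^esub> (\<Oplus>\<^bsub>F\<^esub>j\<in>S. x j)"
    using insert by (intro F.M.finsum_insert)
  then have "cong_rel (lift_form (\<Oplus>\<^bsub>F\<^esub>j\<in>insert k S. x j))
      (\<lambda>i. lift_form (x k) i + lift_form (\<Oplus>\<^bsub>F\<^esub>j\<in>S. x j) i)"
    using lift_form_add [OF cl(2) F.M.finsum_closed [OF cl(1)]] by simp
  also have "cong_rel \<dots> (\<lambda>i. y k i + (\<Sum>j\<in>S. y j i))"
    using insert by (intro cong_add) auto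
  finally show ?case using insert by simp
qed

lemma coset_finsum:
  assumes "finite S" "\<And>j. j \<in> S \<Longrightarrow> x j \<in> carrier F"
  shows "(\<Oplus>\<^bsub>\<Omega>\<^esub>j\<in>S. kaehler_submodule A \<kappa> +>\<^bsub>F\<^esub> x j) = kaehler_submodule A \<kappa> +>\<^bsub>F\<^esub> (\<Oplus>\<^bsub>F\<^esub>j\<in>S. x j)"
  using assms
proof (induction S rule: finite_induct)
  case empty
  have "kaehler_submodule A \<kappa> +>\<^bsub>F\<^esub> \<zero>\<^bsub>F\<^esub> = kaehler_submodule A \<kappa>"
    using Q.coset_eq_zero_iff [of "\<zero>\<^bsub>F\<^esub>"] submodule.zero_closed [OF submodule] by simp
  moreover have "\<zero>\<^bsub>\<Omega>\<^esub> = kaehler_submodule A \<kappa>" by (simp add: kaehler_def Q.quot_zero)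
  ultimately show ?case by simp
next
  case (insert k S)
  have cl: "x \<in> S \<rightarrow> carrier F" "x k \<in> carrier F" using insert by auto
  have cl': "kaehler_submodule A \<kappa> +>\<^bsub>F\<^esub> y \<in> carrier \<Omega>" if "y \<in> carrier F" for y
    using that by (simp add: kaehler_def Q.quot_carrier)
  have "(\<Oplus>\<^bsub>\<Omega>\<^esub>j\<in>insert k S. kaehler_submodule A \<kappa> +>\<^bsub>F\<^esub> x j) =
      (kaehler_submodule A \<kappa> +>\<^bsub>F\<^esub> x k) \<oplus>\<^bsub>\<Omega>\<^esub> (\<Oplus>\<^bsub>\<Omega>\<^esub>j\<in>S. kaehler_submodule A \<kappa> +>\<^bsub>F\<^esub> x j)"
    using insert cl' by (intro \<Omega>.M.finsum_insert) auto
  also have "\<dots> = kaehler_submodule A \<kappa> +>\<^bsub>F\<^esub> (x k \<oplus>\<^bsub>F\<^esub> (\<Oplus>\<^bsub>F\<^esub>j\<in>S. x j))"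
    using insert cl by (simp add: kaehler_def Q.quot_add)
  also have "x k \<oplus>\<^bsub>F\<^esub> (\<Oplus>\<^bsub>F\<^esub>j\<in>S. x j) = (\<Oplus>\<^bsub>F\<^esub>j\<in>insert k S. x j)"
    using insert cl by (intro F.M.finsum_insert [symmetric])
  finally show ?case .
qed

text \<open>\<open>form x\<close> is the class of the sum of x_j D(X_j) in the free module, and
  \<open>lift_form\<close> takes this sum back to \<open>x\<close> modulo relations. If the class is
  zero, the sum lies in the submodule that defines \<Omega>, whose elements are lifted to
  relations.\<close>

lemma form_eq_zero_iff:
  assumes x: "\<And>i. x i \<in> mpolys n" "\<And>i. n < i \<Longrightarrow> x i = 0"
  shows "form x = \<zero>\<^bsub>\<Omega>\<^esub> \<longleftrightarrow> x \<in> relations"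
proof
  let ?y = "\<lambda>j. res (x j) \<odot>\<^bsub>F\<^esub> D (res (indet j))"
  have cl: "?y j \<in> carrier F" if "j \<in> {..n}" for j
    using that x(1) by (intro F.smult_closed D_closed res_closed) auto
  have "form x = (\<Oplus>\<^bsub>\<Omega>\<^esub>j\<in>{..n}. kaehler_submodule A \<kappa> +>\<^bsub>F\<^esub> ?y j)"
    unfolding form_def
  proof (rule \<Omega>.M.finsum_cong')
    show "res (x j) \<odot>\<^bsub>\<Omega>\<^esub> d (res (indet j)) = kaehler_submodule A \<kappa> +>\<^bsub>F\<^esub> ?y j" if "j \<in> {..n}" for j
      using that x(1) by (simp add: kaehler_def kaehler_d_def Q.quot_smult)
    show "(\<lambda>j. kaehler_submodule A \<kappa> +>\<^bsub>F\<^esub> ?y j) \<in> {..n} \<rightarrow> carrier \<Omega>"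
      using cl by (auto simp: kaehler_def Q.quot_carrier)
  qed simp
  also have "\<dots> = kaehler_submodule A \<kappa> +>\<^bsub>F\<^esub> (\<Oplus>\<^bsub>F\<^esub>j\<in>{..n}. ?y j)"
    using cl by (intro coset_finsum) auto
  finally have eq: "form x = kaehler_submodule A \<kappa> +>\<^bsub>F\<^esub> (\<Oplus>\<^bsub>F\<^esub>j\<in>{..n}. ?y j)" .
  have "cong_rel (lift_form (\<Oplus>\<^bsub>F\<^esub>j\<in>{..n}. ?y j)) (\<lambda>i. \<Sum>j\<in>{..n}. x j * partial i (indet j))"
    by (rule lift_form_finsum) (use cl x(1) in \<open>auto intro!: lift_form_gen\<close>)
  also have "(\<lambda>i. \<Sum>j\<in>{..n}. x j * partial i (indet j)) = x"
  proof
    fix i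
    have "(\<Sum>j\<in>{..n}. x j * partial i (indet j)) = (\<Sum>j\<in>{..n}. if j = i then x i else 0)"
      by (intro sum.cong) (auto simp: partial_indet)
    then show "(\<Sum>j\<in>{..n}. x j * partial i (indet j)) = x i" using x(2) by (simp add: not_le)
  qed
  finally have cong: "cong_rel (lift_form (\<Oplus>\<^bsub>F\<^esub>j\<in>{..n}. ?y j)) x" .
  assume "form x = \<zero>\<^bsub>\<Omega>\<^esub>"
  then have "(\<Oplus>\<^bsub>F\<^esub>j\<in>{..n}. ?y j) \<in> kaehler_submodule A \<kappa>"
    using eq cl F.M.finsum_closed [of ?y "{..n}"] Q.coset_eq_zero_iff by (simp add: kaehler_def Q.quot_zero Pi_def)
  then show "x \<in> relations"
    using lift_form_kaehler_submodule cong_in [OF cong_sym [OF cong]] by blast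
qed (use relations_imp_form_zero in blast)

end

section \<open>Graded pieces of the module of differentials\<close>

context coord_kaehler
begin

lemma kappa_closed: "\<kappa> c \<in> carrier A"
  by (rule \<kappa>_closed)

lemma kappa_add: "\<kappa> (a + b) = \<kappa> a \<oplus>\<^bsub>A\<^esub> \<kappa> b"
  by (simp add: kappa_eq const_add coord_ring_simps(4) [OF I])

lemma kappa_mult: "\<kappa> (a * b) = \<kappa> a \<otimes>\<^bsub>A\<^esub> \<kappa> b"
  by (simp add: kappa_eq const_mult coord_ring_simps(5) [OF I])

lemma kappa_one: "\<kappa> 1 = \<one>\<^bsub>A\<^esub>"
  by (simp add: kappa_eq coord_ring_simps(3) [OF I])

abbreviation "\<Omega>\<^sub>K \<equiv> restrict_scalars \<kappa> \<Omega>"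

lemma restrict_simps:
  "carrier \<Omega>\<^sub>K = carrier \<Omega>" "x \<oplus>\<^bsub>\<Omega>\<^sub>K\<^esub> y = x \<oplus>\<^bsub>\<Omega>\<^esub> y" "\<zero>\<^bsub>\<Omega>\<^sub>K\<^esub> = \<zero>\<^bsub>\<Omega>\<^esub>" "c \<odot>\<^bsub>\<Omega>\<^sub>K\<^esub> x = \<kappa> c \<odot>\<^bsub>\<Omega>\<^esub> x"
  by (simp_all add: restrict_scalars_def)

lemma module_restrict: "module scalars \<Omega>\<^sub>K"
proof (rule module_criteria)
  show "cring (scalars :: 'k ring)" by (rule cring_from_type_algebra)
  show "\<forall>v\<in>carrier \<Omega>\<^sub>K. \<exists>w\<in>carrier \<Omega>\<^sub>K. v \<oplus>\<^bsub>\<Omega>\<^sub>K\<^esub> w = \<zero>\<^bsub>\<Omega>\<^sub>K\<^esub>"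
    using \<Omega>.M.r_neg \<Omega>.M.a_inv_closed by (auto simp: restrict_simps)
qed (auto simp: restrict_simps kappa_closed kappa_add kappa_mult kappa_one
    \<Omega>.M.a_ac \<Omega>.smult_l_distr \<Omega>.smult_r_distr \<Omega>.smult_assoc1)

end

text \<open>The part of degree \<open>d\<close> of the free module on e_0, ..., e_n with each e_j in
  degree 1.\<close>

definition shifted_vectors :: "nat \<Rightarrow> nat \<Rightarrow> (nat \<Rightarrow> 'k::field mpoly) set"
  where "shifted_vectors n d = {x. (\<forall>i. x i \<in> shifted_forms n d) \<and> (\<forall>i>n. x i = 0)}"

lemma shifted_formsD: "f \<in> shifted_forms n d \<Longrightarrow> f \<in> mpolys n"
  by (simp add: shifted_forms_def)

lemma shifted_forms_zero: "0 \<in> shifted_forms n d"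
  by (simp add: shifted_forms_def)

lemma shifted_forms_add: "f \<in> shifted_forms n d \<Longrightarrow> g \<in> shifted_forms n d \<Longrightarrow> f + g \<in> shifted_forms n d"
  by (cases d) (auto simp: forms_add)

lemma shifted_forms_const_mult: "f \<in> shifted_forms n d \<Longrightarrow> const c * f \<in> shifted_forms n d"
  by (cases d) (auto simp: forms_const_mult)

lemma vector_space_vectors: "vector_space (\<lambda>c (x :: nat \<Rightarrow> 'k::field mpoly) i. const c * x i)"
  by unfold_locales (simp_all add: plus_fun_def algebra_simps const_add const_mult)

lemma sum_fun_apply: "(\<Sum>a\<in>A. f a) i = (\<Sum>a\<in>A. f a i)"
  by (induction A rule: infinite_finite_induct) auto

lemma shifted_vectors_generated:
  fixes n d :: nat
  defines "U \<equiv> shifted_vectors n d :: (nat \<Rightarrow> 'k::field mpoly) set"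
  shows "\<exists>B. finite B \<and> B \<subseteq> U \<and> (\<forall>u\<in>U. \<exists>c. u = (\<Sum>x\<in>B. (\<lambda>i. const (c x) * x i)))"
  unfolding U_def
proof -
  let ?M = "{t. Poly_Mapping.keys t \<subseteq> {..n} \<and> Suc (mon_deg t) = d}"
  \<comment> \<open>The spanning vectors are the monomials of degree d - 1 times the unit vectors
    e_j.\<close>
  let ?b = "\<lambda>(j, t) i. if i = j then Poly_Mapping.single t (1 :: 'k) else 0"
  have fin: "finite ({..n} \<times> ?M)"
    by (intro finite_cartesian_product finite_atMost finite_subset [OF _ finite_monomials [of n "d - 1"]]) auto
  show "\<exists>B. finite B \<and> B \<subseteq> shifted_vectors n d \<and>
    (\<forall>u\<in>shifted_vectors n d. \<exists>c. u = (\<Sum>x\<in>B. (\<lambda>i. const (c x :: 'k) * x i)))"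
  proof (rule finite_family_generates [OF fin, where sc = "\<lambda>c x i. const c * x i"])
    show "inj_on ?b ({..n} \<times> ?M)"
    proof (rule inj_onI)
      fix a b assume eq: "?b a = ?b b"
      obtain i s j t where ab: "a = (i, s)" "b = (j, t)" by (cases a, cases b)
      have "Poly_Mapping.single s (1 :: 'k) = (if i = j then Poly_Mapping.single t 1 else 0)"
        using fun_cong [OF eq, of i] by (simp add: ab)
      then have "Poly_Mapping.keys (Poly_Mapping.single s (1 :: 'k)) =
          Poly_Mapping.keys (if i = j then Poly_Mapping.single t (1 :: 'k) else 0)" by simp
      then show "a = b" by (auto simp: ab split: if_splits)
    qed
    show "?b ` ({..n} \<times> ?M) \<subseteq> shifted_vectors n d"
      by (auto simp: shifted_vectors_def shifted_forms_def mpolys_iff split: if_splits)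
    fix u :: "nat \<Rightarrow> 'k mpoly" assume u: "u \<in> shifted_vectors n d"
    have ui: "u i = (\<Sum>t\<in>?M. const (Poly_Mapping.lookup (u i) t) * Poly_Mapping.single t 1)" for i
    proof (cases d)
      case 0
      then show ?thesis using u by (simp add: shifted_vectors_def)
    next
      case (Suc e)
      then have "u i \<in> forms n e" using u by (simp add: shifted_vectors_def)
      then show ?thesis using form_eq_sum [of "u i" n e] Suc by simp
    qed
    show "\<exists>c. u = (\<Sum>a\<in>{..n} \<times> ?M. (\<lambda>i. const (c a) * ?b a i))"
    proof (rule exI [of _ "\<lambda>(j, t). Poly_Mapping.lookup (u j) t"], rule ext)
      fix i
      have "(\<Sum>a\<in>{..n} \<times> ?M. (\<lambda>i. const ((\<lambda>(j, t). Poly_Mapping.lookup (u j) t) a) * ?b a i)) i =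
          (\<Sum>j\<le>n. \<Sum>t\<in>?M. const (Poly_Mapping.lookup (u j) t) * (if i = j then Poly_Mapping.single t 1 else 0))"
        by (simp add: sum_fun_apply sum.cartesian_product case_prod_unfold)
      also have "\<dots> = (\<Sum>j\<le>n. if j = i then u i else 0)"
        using ui by (intro sum.cong) auto
      also have "\<dots> = u i" using u by (auto simp: shifted_vectors_def)
      finally show "u i = (\<Sum>a\<in>{..n} \<times> ?M. (\<lambda>i. const ((\<lambda>(j, t). Poly_Mapping.lookup (u j) t) a) * ?b a i)) i"
        by simp
    qed
  qed
qed

context coord_kaehler
begin

lemma vectorsD: "x \<in> shifted_vectors n i \<Longrightarrow> x j \<in> mpolys n"
  by (auto simp: shifted_vectors_def intro: shifted_formsD)

lemma form_const_mult:
  assumes "\<And>j. x j \<in> mpolys n" shows "form (\<lambda>i. const c * x i) = \<kappa> c \<odot>\<^bsub>\<Omega>\<^esub> form x"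
  using form_mult [OF assms mpolys_const] by (simp add: kappa_eq [symmetric])

text \<open>By the chain rule f dg is the sum of f times the j-th derivative of g times dx_j, with
  coefficients of degree one less than f dg. Conversely each x_j dx_j is itself one of the spanning
  elements.\<close>

lemma kaehler_comp_eq: "kaehler_comp A \<kappa> (coord_comp n I) i = form ` shifted_vectors n i"
proof -
  interpret R: module scalars \<Omega>\<^sub>K by (rule module_restrict)
  define G where "G = {a \<odot>\<^bsub>\<Omega>\<^esub> d b | a b j k. a \<in> coord_comp n I j \<and> b \<in> coord_comp n I k \<and> j + k = i}"
  have G: "\<exists>f g j k. f \<in> forms n j \<and> g \<in> forms n k \<and> j + k = i \<and> x = res f \<odot>\<^bsub>\<Omega>\<^esub> d (res g)" if "x \<in> G" for x
    using that unfolding G_def coord_comp_def by blast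
  have G_closed: "G \<subseteq> carrier \<Omega>\<^sub>K"
    using G by (fastforce simp: restrict_simps dest: formsD)
  have eq: "kaehler_comp A \<kappa> (coord_comp n I) i = R.span G"
    by (simp add: kaehler_comp_def G_def)
  interpret S: submodule scalars "R.span G" \<Omega>\<^sub>K by (rule R.span_is_submodule [OF G_closed])
  have "R.span G \<subseteq> form ` shifted_vectors n i"
  proof (rule R.span_is_subset)
    show "G \<subseteq> form ` shifted_vectors n i"
    proof
      fix x assume "x \<in> G"
      then obtain f g j k where fg: "f \<in> forms n j" "g \<in> forms n k" "j + k = i" "x = res f \<odot>\<^bsub>\<Omega>\<^esub> d (res g)"
        using G by metis
      have "x = form (\<lambda>i. f * partial i g)"
        using form_mult [of "\<lambda>i. partial i g" f] form_grad [of g]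
          formsD [OF fg(1)] formsD [OF fg(2)] fg(4) by simp
      moreover have "(\<lambda>i. f * partial i g) \<in> shifted_vectors n i"
        using fg shifted_forms_mult [OF fg(1) partial_shifted_forms [OF fg(2)]] partial_beyond [OF formsD [OF fg(2)]]
        by (simp add: shifted_vectors_def)
      ultimately show "x \<in> form ` shifted_vectors n i" by blast
    qed
    show "submodule scalars (form ` shifted_vectors n i) \<Omega>\<^sub>K"
    proof (rule submodule.intro [OF module_restrict])
      show "form ` shifted_vectors n i \<subseteq> carrier \<Omega>\<^sub>K"
        by (auto simp: restrict_simps intro!: form_closed vectorsD)
      have "form (\<lambda>i. 0) = \<zero>\<^bsub>\<Omega>\<^esub>" by (rule form_zero) (rule ID(2))
      then show "\<zero>\<^bsub>\<Omega>\<^sub>K\<^esub> \<in> form ` shifted_vectors n i"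
        by (auto simp: restrict_simps shifted_vectors_def shifted_forms_zero intro!: image_eqI [where x = "\<lambda>i. 0"])
      show "v \<oplus>\<^bsub>\<Omega>\<^sub>K\<^esub> w \<in> form ` shifted_vectors n i"
        if vw: "v \<in> form ` shifted_vectors n i" "w \<in> form ` shifted_vectors n i" for v w
      proof -
        obtain x y where xy: "x \<in> shifted_vectors n i" "v = form x" "y \<in> shifted_vectors n i" "w = form y"
          using vw by blast
        then have "v \<oplus>\<^bsub>\<Omega>\<^sub>K\<^esub> w = form (\<lambda>i. x i + y i)"
          by (simp add: restrict_simps form_add vectorsD)
        moreover have "(\<lambda>i. x i + y i) \<in> shifted_vectors n i"
          using xy by (simp add: shifted_vectors_def shifted_forms_add)
        ultimately show ?thesis by blast
      qed
      show "c \<odot>\<^bsub>\<Omega>\<^sub>K\<^esub> v \<in> form ` shifted_vectors n i" if v: "v \<in> form ` shifted_vectors n i" for c v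
      proof -
        obtain x where x: "x \<in> shifted_vectors n i" "v = form x" using v by blast
        then have "c \<odot>\<^bsub>\<Omega>\<^sub>K\<^esub> v = form (\<lambda>i. const c * x i)"
          by (simp add: restrict_simps form_const_mult vectorsD)
        moreover have "(\<lambda>i. const c * x i) \<in> shifted_vectors n i"
          using x by (simp add: shifted_vectors_def shifted_forms_const_mult)
        ultimately show ?thesis by blast
      qed
    qed
  qed
  moreover have "form x \<in> R.span G" if x: "x \<in> shifted_vectors n i" for x
  proof -
    have term_in: "res (x j) \<odot>\<^bsub>\<Omega>\<^esub> d (res (indet j)) \<in> R.span G" if j: "j \<le> n" for j
    proof (cases i)
      case 0
      then have "x j = 0" using x by (simp add: shifted_vectors_def)
      then have "res (x j) \<odot>\<^bsub>\<Omega>\<^esub> d (res (indet j)) = \<zero>\<^bsub>\<Omega>\<^sub>K\<^esub>"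
        using j by (simp add: res_zero restrict_simps)
      then show ?thesis using S.zero_closed by simp
    next
      case (Suc e)
      then have "res (x j) \<odot>\<^bsub>\<Omega>\<^esub> d (res (indet j)) \<in> G"
        using x forms_indet [OF j] unfolding G_def coord_comp_def
        \<comment> \<open>The degree splits as e + 1, with e for the coefficient and 1 for the
          indeterminate.\<close>
        by (intro CollectI exI [of _ "res (x j)"] exI [of _ "res (indet j)"] exI [of _ e] exI [of _ 1])
          (auto simp: shifted_vectors_def)
      then show ?thesis using R.in_own_span [OF G_closed] by blast
    qed
    have "(\<Oplus>\<^bsub>\<Omega>\<^esub>j\<in>S. res (x j) \<odot>\<^bsub>\<Omega>\<^esub> d (res (indet j))) \<in> R.span G" if "finite S" "S \<subseteq> {..n}" for S
      using that
    proof (induction S rule: finite_induct)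
      case empty
      then show ?case using S.zero_closed by (simp add: restrict_simps)
    next
      case (insert k S)
      have "(\<Oplus>\<^bsub>\<Omega>\<^esub>j\<in>insert k S. res (x j) \<odot>\<^bsub>\<Omega>\<^esub> d (res (indet j))) =
          res (x k) \<odot>\<^bsub>\<Omega>\<^esub> d (res (indet k)) \<oplus>\<^bsub>\<Omega>\<^esub> (\<Oplus>\<^bsub>\<Omega>\<^esub>j\<in>S. res (x j) \<odot>\<^bsub>\<Omega>\<^esub> d (res (indet j)))"
        using insert vectorsD [OF x] by (intro \<Omega>.M.finsum_insert) (auto intro!: summand_closed)
      then show ?case
        using S.m_closed [OF term_in [of k] insert.IH] insert.prems by (simp add: restrict_simps)
    qed
    then show ?thesis unfolding form_def by simp
  qed
  ultimately show ?thesis unfolding eq by blast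
qed

definition kaehler_space :: "nat \<Rightarrow> ('k, ('k mpoly set \<Rightarrow> 'k mpoly set) set) module"
  where "kaehler_space i = \<Omega>\<^sub>K\<lparr>carrier := form ` shifted_vectors n i\<rparr>"

lemma HF_kaehler_eq: "HF_kaehler n I i = vectorspace.dim scalars (kaehler_space i)"
  by (simp add: HF_kaehler_def subspace_dim_def kaehler_space_def kaehler_comp_eq)

lemma kaehler_space_zero: "\<zero>\<^bsub>kaehler_space i\<^esub> = \<zero>\<^bsub>\<Omega>\<^esub>"
  by (simp add: kaehler_space_def restrict_simps)

lemma linear_cover_kaehler:
  "linear_cover (\<lambda>c x i. const c * x i) (shifted_vectors n i) (kaehler_space i) form"
proof (rule linear_cover.intro)
  show "vector_space (\<lambda>c (x :: nat \<Rightarrow> 'k mpoly) i. const c * x i)" by (rule vector_space_vectors)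
  show "0 \<in> shifted_vectors n i" by (simp add: shifted_vectors_def shifted_forms_zero)
  have "form (\<lambda>i. 0) = \<zero>\<^bsub>\<Omega>\<^esub>" by (rule form_zero) (rule ID(2))
  then show "form 0 = \<zero>\<^bsub>kaehler_space i\<^esub>" by (simp add: kaehler_space_zero zero_fun_def)
  fix x y :: "nat \<Rightarrow> 'k mpoly" and c assume x: "x \<in> shifted_vectors n i"
  show "(\<lambda>i. const c * x i) \<in> shifted_vectors n i"
    using x by (simp add: shifted_vectors_def shifted_forms_const_mult)
  show "form (\<lambda>i. const c * x i) = c \<odot>\<^bsub>kaehler_space i\<^esub> form x"
    using form_const_mult vectorsD [OF x] by (simp add: kaehler_space_def restrict_simps)
  assume y: "y \<in> shifted_vectors n i"
  show "x + y \<in> shifted_vectors n i"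
    using x y by (simp add: shifted_vectors_def shifted_forms_add)
  show "form (x + y) = form x \<oplus>\<^bsub>kaehler_space i\<^esub> form y"
    using form_add vectorsD [OF x] vectorsD [OF y] by (simp add: kaehler_space_def restrict_simps plus_fun_def)
qed (simp_all add: kaehler_space_def shifted_vectors_generated)

lemma form_in_kaehler_space_zero_iff:
  "x \<in> shifted_vectors n i \<Longrightarrow> form x = \<zero>\<^bsub>kaehler_space i\<^esub> \<longleftrightarrow> x \<in> relations"
  unfolding kaehler_space_zero
  by (rule form_eq_zero_iff) (auto simp: vectorsD, simp add: shifted_vectors_def)

end

text \<open>Both graded pieces are quotients of the same space of vectors, by the relations of
  \<open>I\<close> and of \<open>J\<close>. The former are contained in the latter, so equal
  dimensions mean equal kernels.\<close>

lemma HF_kaehler_eq_iff: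
  assumes I: "ideal I (mpoly_ring n)" and J: "ideal J (mpoly_ring n)" and IJ: "I \<subseteq> J"
  shows "HF_kaehler n I d = HF_kaehler n J d \<longleftrightarrow>
    shifted_vectors n d \<inter> jacobian_relations n J \<subseteq> jacobian_relations n I"
proof
  interpret A: coord_kaehler n I by (rule coord_kaehler.intro [OF I])
  interpret B: coord_kaehler n J by (rule coord_kaehler.intro [OF J])
  note zero_iff = A.form_in_kaehler_space_zero_iff B.form_in_kaehler_space_zero_iff
  have AB: "linear_cover2 (\<lambda>c x i. const c * x i) (shifted_vectors n d)
      (A.kaehler_space d) A.form (B.kaehler_space d) B.form"
    by (intro linear_cover2.intro A.linear_cover_kaehler B.linear_cover_kaehler linear_cover2_axioms.intro)
      (simp add: zero_iff jacobian_relations_mono [OF IJ])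
  {
    assume "HF_kaehler n I d = HF_kaehler n J d"
    then show "shifted_vectors n d \<inter> jacobian_relations n J \<subseteq> jacobian_relations n I"
      using linear_cover2.dim_eq_imp_ker [OF AB] by (auto simp: A.HF_kaehler_eq B.HF_kaehler_eq zero_iff)
  next
    assume sub: "shifted_vectors n d \<inter> jacobian_relations n J \<subseteq> jacobian_relations n I"
    have BA: "linear_cover2 (\<lambda>c x i. const c * x i) (shifted_vectors n d)
        (B.kaehler_space d) B.form (A.kaehler_space d) A.form"
      by (intro linear_cover2.intro A.linear_cover_kaehler B.linear_cover_kaehler linear_cover2_axioms.intro)
        (use sub in \<open>auto simp: zero_iff\<close>)
    show "HF_kaehler n I d = HF_kaehler n J d"
      using linear_cover2.dim_le [OF AB] linear_cover2.dim_le [OF BA]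
      by (simp add: A.HF_kaehler_eq B.HF_kaehler_eq)
  }
qed

text \<open>If \<open>I\<close> and \<open>J\<close> have the same forms of degree \<open>d\<close>,
  there are surjections between the two quotients in both directions.\<close>

lemma HF_eqI:
  assumes I: "ideal I (mpoly_ring n)" and J: "ideal J (mpoly_ring n)" and IJ: "I \<subseteq> J"
    and JI: "forms n d \<inter> J \<subseteq> I"
  shows "HF n J d = HF n I d"
proof (rule antisym)
  interpret linear_cover2 "\<lambda>c f. const c * f" "forms n d" "comp_space n J d" "residue n J"
      "comp_space n I d" "residue n I"
    by (intro linear_cover2.intro linear_cover_forms I J linear_cover2_axioms.intro)
      (use JI in \<open>auto simp: comp_space_simps coord_ring_simps I J residue_eq_zero_iff\<close>)
  show "HF n I d \<le> HF n J d" using dim_le by (simp add: HF_eq)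
qed (rule HF_antimono(1) [OF I J IJ])

section \<open>The two implications\<close>

context indet_0_avoiding
begin

lemma subscheme_ideal:
  assumes "subscheme_of n J I"
  shows "homogeneous_ideal n J" "ideal J (mpoly_ring n)" "I \<subseteq> J"
  using assms by (auto simp: subscheme_of_def closed_subscheme_def homogeneous_ideal_def)

text \<open>The zero form defines no hypersurface and has to be treated apart.\<close>

lemma CBPD:
  assumes "CBP n I d" "subscheme_of n J I" "scheme_degree n J + 1 = scheme_degree n I"
    and "f \<in> forms n d" "f \<in> J" "d > 0"
  shows "f \<in> I"
proof (cases "f = 0")
  case False
  then have "is_hypersurface n d f" using assms(4,6) by (simp add: is_hypersurface_def)
  then show ?thesis using assms(1,2,3,5) by (simp add: CBP_def)
qed (simp add: idealD(2))

lemma CBP_imp_HF_kaehler_eq: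
  assumes CBP: "CBP n I d" and J: "subscheme_of n J I" "scheme_degree n J + 1 = scheme_degree n I"
  shows "HF_kaehler n I d = HF_kaehler n J d"
proof -
  note J' = subscheme_ideal [OF J(1)]
  have "x \<in> jacobian_relations n I" if x: "x \<in> shifted_vectors n d" "x \<in> jacobian_relations n J" for x
  \<comment> \<open>There are no hypersurfaces of degree 0, so the property says nothing for
    \<open>d = 0\<close>; but then the only vector of degree \<open>d\<close> is zero.\<close>
  proof (cases "d = 0")
    case True
    then have "x = (\<lambda>i. 0)" using x(1) by (auto simp: shifted_vectors_def)
    then show ?thesis by (simp add: jacobian_relations.zero)
  next
    case False
    have "f \<in> I" if f: "k \<le> d" "f \<in> forms n k" "f \<in> J" for k f
    proof -
      \<comment> \<open>A power of X_0 raises the degree of \<open>f\<close> to exactly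
        \<open>d\<close>, where the property applies. Since x_0 is a nonzerodivisor, the factor can
        be removed again.\<close>
      let ?g = "indet 0 ^ (d - k) * f"
      have "?g \<in> forms n d"
        using forms_mult [OF forms_indet_power f(2), of 0 "d - k"] f(1) by simp
      moreover have "?g \<in> J" using mpoly_idealD(4) [OF J'(2) _ f(3)] by simp
      ultimately have "?g \<in> I"
        by (rule CBPD [OF CBP J])  (use False in simp)
      then show ?thesis using indet_0_power_mult_in_iff [OF f(2)] by blast
    qed
    then have "(\<lambda>i. shifted_comp d (x i)) \<in> jacobian_relations n I"
      using jacobian_relations_shifted_comp [OF homogeneous J'(1) _ x(2)] by blast
    \<comment> \<open>\<open>x\<close> is already homogeneous, so taking the component does not
      change it.\<close>
    moreover have "(\<lambda>i. shifted_comp d (x i)) = x"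
      using x(1) shifted_comp_of_form unfolding shifted_vectors_def by (intro ext) auto
    ultimately show ?thesis by simp
  qed
  then show ?thesis
    using HF_kaehler_eq_iff [OF is_ideal J'(2,3)] by blast
qed

lemma HF_kaehler_eq_imp_mem:
  assumes char: "CHAR('k) = 0 \<or> CHAR('k) > regularity_index n I"
    and J: "subscheme_of n J I" "scheme_degree n J + 1 = scheme_degree n I"
    and eq: "HF_kaehler n I d = HF_kaehler n J d"
    and f: "f \<in> forms n d" "f \<in> J" and d: "d > 0"
  shows "f \<in> I"
proof (rule ccontr)
  assume nin: "f \<notin> I"
  note J' = subscheme_ideal [OF J(1)]
  interpret J: indet_0_avoiding n J by (rule subscheme [OF J(1)])
  \<comment> \<open>Equality of the Hilbert functions turns relations of \<open>J\<close> in degree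
    \<open>d\<close> into relations of \<open>I\<close>, whose contraction with the Euler field lies
    in \<open>I\<close>.\<close>
  have euler: "(\<Sum>j\<le>n. indet j * x j) \<in> I"
    if "x \<in> shifted_vectors n d" "x \<in> jacobian_relations n J" for x
    using that eq HF_kaehler_eq_iff [OF is_ideal J'(2,3), of d] jacobian_relations_euler [OF homogeneous]
    by blast
  have low: "g \<in> I" if g: "g \<in> forms n a" "g \<in> J" "a < d" for g a
  proof -
    \<comment> \<open>The exponent makes \<open>h\<close> a form of degree d - 1, so that h e_0 has
      degree \<open>d\<close>. Its contraction X_0 h is \<open>g\<close> times a power of X_0, from
      which \<open>g\<close> is recovered.\<close>
    define h where "h = indet 0 ^ (d - 1 - a) * g"
    define x where "x = (\<lambda>i :: nat. if i = 0 then h else 0)"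
    have "h \<in> J" using mpoly_idealD(4) [OF J'(2) _ g(2)] by (simp add: h_def)
    then have "x \<in> jacobian_relations n J"
      using jacobian_relations.ideal [OF jacobian_relations.zero, of h J 0 n] by (simp add: x_def)
    moreover have "h \<in> shifted_forms n d"
      using forms_mult [OF forms_indet_power g(1), of 0 "d - 1 - a"] g(3) by (cases d) (simp_all add: h_def)
    then have "x \<in> shifted_vectors n d" by (simp add: x_def shifted_vectors_def shifted_forms_zero)
    ultimately have "(\<Sum>j\<le>n. indet j * x j) \<in> I" by (intro euler)
    have da: "d - a = Suc (d - 1 - a)" using g(3) by simp
    note \<open>(\<Sum>j\<le>n. indet j * x j) \<in> I\<close>
    also have "(\<Sum>j\<le>n. indet j * x j) = (\<Sum>j\<le>n. if j = 0 then indet 0 * h else 0)"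
      by (intro sum.cong) (auto simp: x_def)
    also have "\<dots> = indet 0 ^ (d - a) * g"
      unfolding h_def da by (simp add: mult.assoc)
    finally show ?thesis using indet_0_power_mult_in_iff [OF g(1)] by blast
  qed
  \<comment> \<open>Otherwise \<open>I\<close> and \<open>J\<close> agree in the degree of the
    regularity index. There the Hilbert function for \<open>I\<close> has reached its degree, while
    the one for \<open>J\<close> is bounded by a degree smaller by one.\<close>
  have le: "d \<le> regularity_index n I"
  proof (rule ccontr)
    let ?r = "regularity_index n I"
    assume "\<not> d \<le> ?r"
    then have "HF n J ?r = HF n I ?r"
      using low by (intro HF_eqI is_ideal J'(2,3)) auto
    then show False
      using HF_eq_scheme_degree [of ?r] J.HF_le_scheme_degree [of ?r] J(2) by simp
  qed
  \<comment> \<open>A positive characteristic exceeds the regularity index, hence also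
    \<open>d\<close>, and cannot divide the positive number \<open>d\<close>.\<close>
  have "(of_nat d :: 'k) \<noteq> 0"
    using char d le by (auto simp: of_nat_eq_0_iff_char_dvd dest: dvd_imp_le)
  moreover have "(\<lambda>i. partial i f) \<in> shifted_vectors n d"
    using partial_shifted_forms [OF f(1)] partial_beyond [OF formsD [OF f(1)]]
    by (simp add: shifted_vectors_def)
  then have "(\<Sum>j\<le>n. indet j * partial j f) \<in> I"
    by (intro euler jacobian_relations_grad J'(2) f(2))
  then have "const (of_nat d) * f \<in> I"
    using euler_formula [OF f(1)] by (simp add: const_of_nat)
  \<comment> \<open>The contraction of the gradient of \<open>f\<close> is d f, and \<open>d\<close>
    is invertible in K.\<close>
  then have "const (inverse (of_nat d)) * (const (of_nat d) * f) \<in> I"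
    by (rule idealD(4) [OF mpolys_const])
  ultimately have "f \<in> I"
    by (simp add: mult.assoc [symmetric] const_mult [symmetric])
  with nin show False by blast
qed

end

theorem corollary8p4:
  fixes n d :: nat and I :: "'k::field mpoly set"
  assumes "perfect_field TYPE('k)"
    and "zero_dim_subscheme n I"
    and "rational_support n I"
    and "\<forall>P\<in>support n I. indet 0 \<notin> P"
    and "CHAR('k) = 0 \<or> CHAR('k) > regularity_index n I"
  shows "CBP n I d \<longleftrightarrow>
    (\<forall>J. subscheme_of n J I \<and> scheme_degree n J + 1 = scheme_degree n I \<longrightarrow>
      HF_kaehler n I d = HF_kaehler n J d)"
proof -
  interpret indet_0_avoiding n I
    using assms(2,4) by unfold_locales (auto simp: zero_dim_subscheme_def)
  show ?thesis
  proof
    assume "CBP n I d"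
    then show "\<forall>J. subscheme_of n J I \<and> scheme_degree n J + 1 = scheme_degree n I \<longrightarrow>
        HF_kaehler n I d = HF_kaehler n J d"
      using CBP_imp_HF_kaehler_eq by blast
  next
    assume "\<forall>J. subscheme_of n J I \<and> scheme_degree n J + 1 = scheme_degree n I \<longrightarrow>
        HF_kaehler n I d = HF_kaehler n J d"
    \<comment> \<open>The condition \<open>d > 0\<close> required for membership comes from
      \<open>is_hypersurface\<close>.\<close>
    then show "CBP n I d"
      unfolding CBP_def is_hypersurface_def using HF_kaehler_eq_imp_mem [OF assms(5)] by blast
  qed
qed

end
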